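(* Let $(\Sigma,G)$ be a cell decomposition of a closed surface with vertex set $V$, edge set $E$, $2$-cell set $F$, and dual vertex set $V^*=\{f^*:f\in F\}$. Let $(\varepsilon,\varepsilon,\delta)\in\{-1,0,1\}^3$, $\theta:E\to\mathring I_\delta$ and $h\in\mathbb{R}$. Then the map $r\mapsto K_h(r)$ from $\mathcal{E}_{\varepsilon,\delta}(\theta)\subset(J_{\varepsilon\delta})^{V^*}$ to $\mathbb{R}^{V^*}$ is a smooth embedding; in particular a circle pattern metric $r$ is determined by its generalized curvature $K_h$.
   Context: Generalized hyperbolic triangles (in $\mathbb{H}^2$) are convex regions bounded by three geodesics (forming a Euclidean triangle in the Klein model) truncated by common perpendiculars at vertices outside $\overline{\mathbb{H}^2}$, with horodisks at ideal vertices; a generalized vertex has type $1$ (in $\mathbb{H}^2$), $0$ (ideal) or $-1$ (hyperideal). Generalized angle: interior angle (type 1), twice the horocyclic arc length between the sides (type 0), distance between the two sides (type $-1$). Generalized edge length between generalized vertices $u,v$: with $B_u$ the point, the horodisk, or the half-plane beyond the truncating perpendicular, it is $d(B_u,B_v)$ if these are disjoint and minus the distance between the points where $\partial B_u,\partial B_v$ meet the side otherwise. $\mathring I_\delta=\mathbb{R}_{>0}$ for $\delta\in\{0,-1\}$, $(0,\pi)$ for $\delta=1$; $J_\sigma=\mathbb{R}_{>0}$ for $\sigma=\pm1$, $J_0=\mathbb{R}$; $\rho_1=\sin$, $\rho_0(t)=t$, $\rho_{-1}=\sinh$. For $\phi\in\mathring I_\delta$, $\mathcal{D}_{\varepsilon,\delta}(\phi)$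 is the set of $(a,b)\in(J_{\varepsilon\delta})^2$ such that some generalized triangle of type $(\varepsilon,\varepsilon,\delta)$ has sides of lengths $a,b$ at its type-$\delta$ vertex with generalized angle $\phi$ there. Joining each $v\in V$ to $f^*$ inside each $2$-cell $f$ with $v$ on its boundary decomposes $\Sigma$ into quadrilaterals $(v,v',f^*,f'^* )$, one for each edge $vv'\in E$, where $f,f'$ are the $2$-cells containing $vv'$. $\mathcal{E}_{\varepsilon,\delta}(\theta)$ is the set of $r\in(J_{\varepsilon\delta})^{V^*}$ with $(r(f^* ),r(f'^* ))\in\mathcal{D}_{\varepsilon,\delta}(\theta(vv'))$ for every such quadrilateral. For such $r$, each quadrilateral is realized as the metric double, across the side $f^*f'^*$, of the generalized triangle $\Delta f^*f'^*v$ of type $(\varepsilon,\varepsilon,\delta)$ with $f^*,f'^*$ of type $\varepsilon$, $v$ of type $\delta$, sides $vf^*,vf'^*$ of lengths $r(f^* ),r(f'^* )$ and generalized angle $\theta(vv')$ at $v$. The generalized curvature is $K_h(f^* )=\sum_{i=1}^m 2\int_1^{a_i}\rho_\varepsilon^h(t)\,dt$, where $a_1,\dots,a_m$ are the generalized angles at $f^*$ of the triangles $\Delta f^*f'^*v$ over all quadrilaterals having $f^*$ as a vertex. *)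

theory Defs
  imports "HOL-Analysis.Analysis"
begin

definition mink :: "real^3 \<Rightarrow> real^3 \<Rightarrow> real" where
  "mink x y = x$1 * y$1 + x$2 * y$2 - x$3 * y$3"

definition H2 :: "(real^3) set" where
  "H2 = {x. mink x x = -1 \<and> x$3 > 0}"

definition hdist :: "real^3 \<Rightarrow> real^3 \<Rightarrow> real" where
  "hdist x y = arcosh (- mink x y)"

definition hsetdist :: "(real^3) set \<Rightarrow> (real^3) set \<Rightarrow> real" where
  "hsetdist A B = Inf {hdist x y | x y. x \<in> A \<and> y \<in> B}"

text \<open>A generalized vertex of type sigma (1: point of H2, 0: ideal point with a horodisk,
  -1: hyperideal point).  It is encoded by a vector w with w3 > 0 and Minkowski norm -sigma:
  type 1: the point itself; type 0: a light-like vector, the horodisk being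
  {x. -<x,w> \<le> 1}; type -1: a unit space-like vector (the Klein point w/w3 lies outside
  the closed disk), the truncating perpendicular being its polar {x. <x,w> = 0}.\<close>
definition gvertex :: "int \<Rightarrow> real^3 \<Rightarrow> bool" where
  "gvertex \<sigma> w \<longleftrightarrow> \<sigma> \<in> {-1, 0, 1} \<and> mink w w = - of_int \<sigma> \<and> w$3 > 0"

text \<open>B_u: the point, the horodisk, or the half-plane beyond the truncating perpendicular\<close>
definition Bset :: "int \<Rightarrow> real^3 \<Rightarrow> (real^3) set" where
  "Bset \<sigma> w = (if \<sigma> = 1 then {w}
     else if \<sigma> = 0 then {x \<in> H2. - mink x w \<le> 1}
     else {x \<in> H2. mink x w \<ge> 0})"

definition bdryB :: "int \<Rightarrow> real^3 \<Rightarrow> (real^3) set" where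
  "bdryB \<sigma> w = (if \<sigma> = 1 then {w}
     else if \<sigma> = 0 then {x \<in> H2. - mink x w = 1}
     else {x \<in> H2. mink x w = 0})"

definition geod :: "real^3 \<Rightarrow> real^3 \<Rightarrow> (real^3) set" where
  "geod u v = {x \<in> H2. \<exists>a b. x = a *\<^sub>R u + b *\<^sub>R v}"

definition bpt :: "int \<Rightarrow> real^3 \<Rightarrow> real^3 \<Rightarrow> real^3" where
  "bpt \<sigma> u v = (THE x. x \<in> bdryB \<sigma> u \<inter> geod u v)"

definition glen :: "int \<Rightarrow> int \<Rightarrow> real^3 \<Rightarrow> real^3 \<Rightarrow> real" where
  "glen \<sigma> \<tau> u v = (if Bset \<sigma> u \<inter> Bset \<tau> v = {}
       then hsetdist (Bset \<sigma> u) (Bset \<tau> v)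
       else - hdist (bpt \<sigma> u v) (bpt \<tau> v u))"

definition horo_arclen :: "real^3 \<Rightarrow> real^3 \<Rightarrow> real" where
  "horo_arclen x y = 2 * sinh (hdist x y / 2)"

definition gangle :: "int \<Rightarrow> real^3 \<Rightarrow> real^3 \<Rightarrow> real^3 \<Rightarrow> real" where
  "gangle \<sigma> w u v =
     (if \<sigma> = 1 then
        (let tu = u + mink u w *\<^sub>R w; tv = v + mink v w *\<^sub>R w
         in arccos (mink tu tv / sqrt (mink tu tu * mink tv tv)))
      else if \<sigma> = 0 then 2 * horo_arclen (bpt 0 w u) (bpt 0 w v)
      else hsetdist (geod w u) (geod w v))"

text \<open>the Klein segment between u and v meets H2\<close>
definition seg_meets :: "real^3 \<Rightarrow> real^3 \<Rightarrow> bool" where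
  "seg_meets u v \<longleftrightarrow> (\<exists>a b. a \<ge> 0 \<and> b \<ge> 0 \<and> mink (a *\<^sub>R u + b *\<^sub>R v) (a *\<^sub>R u + b *\<^sub>R v) < 0)"

text \<open>generalized hyperbolic triangle of type (s1,s2,s3) with generalized vertices w1 w2 w3:
  a non-degenerate Euclidean triangle in the Klein model all of whose sides meet H2\<close>
definition gtri :: "int \<Rightarrow> int \<Rightarrow> int \<Rightarrow> real^3 \<Rightarrow> real^3 \<Rightarrow> real^3 \<Rightarrow> bool" where
  "gtri s1 s2 s3 w1 w2 w3 \<longleftrightarrow>
     gvertex s1 w1 \<and> gvertex s2 w2 \<and> gvertex s3 w3 \<and>
     (\<forall>a b c. a *\<^sub>R w1 + b *\<^sub>R w2 + c *\<^sub>R w3 = 0 \<longrightarrow> a = 0 \<and> b = 0 \<and> c = 0) \<and>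
     seg_meets w1 w2 \<and> seg_meets w2 w3 \<and> seg_meets w1 w3"

definition Iopen :: "int \<Rightarrow> real set" where
  "Iopen \<delta> = (if \<delta> = 1 then {0<..<pi} else {0<..})"

definition J :: "int \<Rightarrow> real set" where
  "J \<sigma> = (if \<sigma> = 0 then UNIV else {0<..})"

definition rho :: "int \<Rightarrow> real \<Rightarrow> real" where
  "rho \<epsilon> t = (if \<epsilon> = 1 then sin t else if \<epsilon> = 0 then t else sinh t)"

definition Ddom :: "int \<Rightarrow> int \<Rightarrow> real \<Rightarrow> (real \<times> real) set" where
  "Ddom \<epsilon> \<delta> \<phi> = {(a, b). a \<in> J (\<epsilon> * \<delta>) \<and> b \<in> J (\<epsilon> * \<delta>) \<and>
     (\<exists>w1 w2 w3. gtri \<delta> \<epsilon> \<epsilon> w1 w2 w3 \<and> glen \<delta> \<epsilon> w1 w2 = a \<and> glen \<delta> \<epsilon> w1 w3 = b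
        \<and> gangle \<delta> w1 w2 w3 = \<phi>)}"

text \<open>generalized angle at the type-eps vertex w2 (whose side to the type-delta vertex has
  length a) of the generalized triangle of type (eps,eps,delta) with sides a, b at the
  type-delta vertex and generalized angle phi there (unique up to isometry)\<close>
definition tri_angle :: "int \<Rightarrow> int \<Rightarrow> real \<Rightarrow> real \<Rightarrow> real \<Rightarrow> real" where
  "tri_angle \<epsilon> \<delta> \<phi> a b = (THE \<alpha>. \<exists>w1 w2 w3. gtri \<delta> \<epsilon> \<epsilon> w1 w2 w3 \<and>
     glen \<delta> \<epsilon> w1 w2 = a \<and> glen \<delta> \<epsilon> w1 w3 = b \<and> gangle \<delta> w1 w2 w3 = \<phi> \<and>
     gangle \<epsilon> w2 w1 w3 = \<alpha>)"

inductive_set orb :: "('d \<Rightarrow> 'd) set \<Rightarrow> 'd \<Rightarrow> 'd set" for fs :: "('d \<Rightarrow> 'd) set" and x :: 'd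
where
  base: "x \<in> orb fs x"
| step: "y \<in> orb fs x \<Longrightarrow> g \<in> fs \<Longrightarrow> g y \<in> orb fs x"

text \<open>A connected 2-dimensional generalized map without boundary on the finite dart type 'd,
  i.e. a cell decomposition of a closed surface.  The 2-cells are the orbits of
  <a0,a1>, indexed by the type 'f via face; the edges are the orbits of <a0,a2>, indexed
  by 'e via edge; the two 2-cells on the sides of the edge of a dart x are those of x and
  of a2 x.\<close>
definition cell_decomp ::
  "('d::finite \<Rightarrow> 'd) \<Rightarrow> ('d \<Rightarrow> 'd) \<Rightarrow> ('d \<Rightarrow> 'd) \<Rightarrow> ('d \<Rightarrow> 'f) \<Rightarrow> ('d \<Rightarrow> 'e) \<Rightarrow> bool" where
  "cell_decomp a0 a1 a2 face edge \<longleftrightarrow>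
     (\<forall>i \<in> {a0, a1, a2}. \<forall>x. i (i x) = x \<and> i x \<noteq> x) \<and>
     (\<forall>x. a0 (a2 x) = a2 (a0 x) \<and> a0 (a2 x) \<noteq> x) \<and>
     (\<forall>x. orb {a0, a1, a2} x = UNIV) \<and>
     surj face \<and> (\<forall>x y. face x = face y \<longleftrightarrow> y \<in> orb {a0, a1} x) \<and>
     surj edge \<and> (\<forall>x y. edge x = edge y \<longleftrightarrow> y \<in> orb {a0, a2} x)"

definition Eset :: "int \<Rightarrow> int \<Rightarrow> ('e \<Rightarrow> real) \<Rightarrow> ('d \<Rightarrow> 'f) \<Rightarrow> ('d \<Rightarrow> 'e) \<Rightarrow> ('d \<Rightarrow> 'd)
   \<Rightarrow> (real^'f::finite) set" where
  "Eset \<epsilon> \<delta> \<theta> face edge a2 = {r. (\<forall>g. r$g \<in> J (\<epsilon> * \<delta>)) \<and>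
     (\<forall>x. (r$(face x), r$(face (a2 x))) \<in> Ddom \<epsilon> \<delta> (\<theta> (edge x)))}"

text \<open>K_h(f*) = sum of 2 * integral_1^{a_i} rho_eps^h over the angles a_i at f*.  Each pair
  (edge, side) is represented by exactly two darts (x and a0 x), hence the division by 2.\<close>
definition Kh :: "int \<Rightarrow> int \<Rightarrow> real \<Rightarrow> ('e \<Rightarrow> real) \<Rightarrow> ('d::finite \<Rightarrow> 'f) \<Rightarrow> ('d \<Rightarrow> 'e)
   \<Rightarrow> ('d \<Rightarrow> 'd) \<Rightarrow> real^'f::finite \<Rightarrow> real^'f" where
  "Kh \<epsilon> \<delta> h \<theta> face edge a2 r = (\<chi> g.
     (\<Sum>x \<in> {x. face x = g}.
        2 * interval_lebesgue_integral lborel (ereal 1)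
              (ereal (tri_angle \<epsilon> \<delta> (\<theta> (edge x)) (r$(face x)) (r$(face (a2 x)))))
              (\<lambda>t. rho \<epsilon> t powr h)) / 2)"

definition smooth_on :: "('a::euclidean_space) set \<Rightarrow> ('a \<Rightarrow> 'b::euclidean_space) \<Rightarrow> bool" where
  "smooth_on S f \<longleftrightarrow> open S \<and>
     (\<exists>D :: 'a list \<Rightarrow> 'a \<Rightarrow> 'b. D [] = f \<and>
        (\<forall>vs. \<forall>x \<in> S. (D vs has_derivative (\<lambda>v. D (v # vs) x)) (at x)))"

definition smooth_embedding :: "('a::euclidean_space) set \<Rightarrow> ('a \<Rightarrow> 'b::euclidean_space) \<Rightarrow> bool" where
  "smooth_embedding S f \<longleftrightarrow> smooth_on S f \<and> inj_on f S \<and>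
     (\<forall>x \<in> S. \<forall>f'. (f has_derivative f') (at x) \<longrightarrow> inj f') \<and>
     continuous_on (f ` S) (the_inv_into S f)"

end

theory Submission
  imports Defs
begin

text \<open>Write \<open>x\<close>, \<open>y\<close>, \<open>z\<close> for the negated Minkowski products of the three vertices of a triangle of type
  \<open>(\<delta>, \<epsilon>, \<epsilon>)\<close>.  The lengths of the two sides at the \<open>\<delta>\<close>-vertex determine \<open>x\<close> and \<open>y\<close>, the generalized
  angle there determines \<open>z\<close>, and the only condition for the triangle to exist is \<open>z > 1\<close> if \<open>\<epsilon> = -1\<close>.
  The angle at the first \<open>\<epsilon>\<close>-vertex is a decreasing function of \<open>q = (x z - \<epsilon> y) / sqrt \<Delta>\<close>, where \<open>\<Delta>\<close> is
  the determinant of the negated Gram matrix.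

  There is a coordinate \<open>u\<close> on the radii, independent of \<open>h\<close>, in which the set of admissible pairs of
  radii of each quadrilateral is convex and \<open>q\<close> satisfies \<open>\<bar>\<partial>q/\<partial>v\<bar> < \<partial>q/\<partial>u\<close>.  For two circle pattern
  metrics, at a 2-cell where the difference of the coordinates is largest in absolute value, all angles
  therefore differ in the same direction, so the curvatures differ there whatever \<open>h\<close> is.  The
  linearized argument gives the injectivity of the derivative, and invariance of domain the continuity of
  the inverse.  This maximum principle avoids the variational potential, whose domain of definition need
  not be convex if \<open>\<epsilon> = -1\<close>.\<close>

section \<open>Smooth functions\<close>

text \<open>The coordinate has derivative \<open>1 / X\<close> in the radius, where \<open>X\<close>
  is the square root of \<open>x^2 - \<delta> * \<epsilon>\<close> up to a constant factor:
  \<open>sinh\<close>, \<open>cosh\<close> or \<open>exp\<close> of the radius for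
  \<delta>\<epsilon> = 1, -1, 0. In it the domination inequality becomes a condition on
  \<open>u - v\<close> or \<open>u + v\<close> alone. For \<epsilon> = 1 it is a variant of
  \<open>cosh (u - v) > cos \<phi>\<close> and holds everywhere. For \<epsilon> = -1 it reads
  \<open>u + v > c\<close>, and this is exactly the existence condition \<open>z > 1\<close>; so the
  inequality holds on the whole domain, and the domain is cut out by a half-plane, hence convex. For
  \<epsilon> = 0 the cotangent \<open>q\<close> does not depend on \<open>v\<close> at all. The
  coordinate depends on \<delta>\<epsilon> only. It is therefore common to all edges, whatever their
  \<theta>, and differences at different 2-cells can be compared. The exponent \<open>h\<close>
  enters through the integrand \<open>rho \<epsilon> t powr h\<close>, which is positive and cannot
  change a sign.\<close>

lemma smooth_onI:
  fixes f :: "'a::euclidean_space \<Rightarrow> 'b::euclidean_space"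
  assumes "open S" "f \<in> C"
    and step: "\<And>g. g \<in> C \<Longrightarrow> \<exists>D. (\<forall>x\<in>S. (g has_derivative (\<lambda>v. D v x)) (at x)) \<and> (\<forall>v. D v \<in> C)"
  shows "smooth_on S f"
proof -
  from step obtain st where
    st: "\<And>g. g \<in> C \<Longrightarrow> (\<forall>x\<in>S. (g has_derivative (\<lambda>v. st g v x)) (at x)) \<and> (\<forall>v. st g v \<in> C)"
    by metis
  \<comment> \<open>Coinduction: \<open>C\<close> is closed under directional derivatives, so
    derivatives of all orders can be chosen inside it by recursion on the list of
    directions.\<close>
  define E where "E vs = foldr (\<lambda>v g. st g v) vs f" for vs
  have mem: "E vs \<in> C" for vs
    by (induction vs) (use assms(2) st in \<open>auto simp: E_def\<close>)
  have "(E vs has_derivative (\<lambda>v. E (v # vs) x)) (at x)" if "x \<in> S" for vs x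
    using st[OF mem[of vs]] that by (simp add: E_def)
  moreover have "E [] = f" by (simp add: E_def)
  ultimately show ?thesis
    using \<open>open S\<close> unfolding smooth_on_def by blast
qed

lemma smooth_onD:
  fixes f :: "'a::euclidean_space \<Rightarrow> 'b::euclidean_space"
  assumes "smooth_on S f"
  shows "\<exists>D. (\<forall>x\<in>S. (f has_derivative (\<lambda>v. D v x)) (at x)) \<and> (\<forall>v. smooth_on S (D v))"
proof -
  from assms obtain E where "open S" and E: "E [] = f"
    "\<And>vs x. x \<in> S \<Longrightarrow> (E vs has_derivative (\<lambda>v. E (v # vs) x)) (at x)"
    unfolding smooth_on_def by blast
  have "smooth_on S (E [v])" for v
  proof (rule smooth_onI[OF \<open>open S\<close>, where C = "range E"])
    fix g assume "g \<in> range E"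
    then obtain vs where "g = E vs" by blast
    then show "\<exists>D. (\<forall>x\<in>S. (g has_derivative (\<lambda>v. D v x)) (at x)) \<and> (\<forall>v. D v \<in> range E)"
      using E(2)[of _ vs] by (intro exI[of _ "\<lambda>v. E (v # vs)"]) auto
  qed simp
  with E(2)[of _ "[]"] E(1) show ?thesis by (intro exI[of _ "\<lambda>v. E [v]"]) auto
qed

lemma smooth_on_open: "smooth_on S f \<Longrightarrow> open S"
  by (simp add: smooth_on_def)

text \<open>Since \<open>S\<close> is open, derivatives on \<open>S\<close> depend only on the
  values there. From the first derivative on, the family for \<open>f\<close> serves for
  \<open>g\<close>, so only \<open>g\<close> itself has to be adjoined to the class.\<close>

lemma smooth_on_cong:
  fixes f :: "'a::euclidean_space \<Rightarrow> 'b::euclidean_space"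
  assumes "smooth_on S f" "\<And>x. x \<in> S \<Longrightarrow> g x = f x"
  shows "smooth_on S g"
proof (rule smooth_onI[where C = "insert g {k. smooth_on S k}"])
  show op: "open S" using assms(1) by (rule smooth_on_open)
  fix k assume "k \<in> insert g {k. smooth_on S k}"
  then consider "k = g" | "smooth_on S k" by blast
  then show "\<exists>D. (\<forall>x\<in>S. (k has_derivative (\<lambda>v. D v x)) (at x)) \<and>
      (\<forall>v. D v \<in> insert g {k. smooth_on S k})"
  proof cases
    case 1
    obtain D where D: "\<forall>x\<in>S. (f has_derivative (\<lambda>v. D v x)) (at x)" "\<forall>v. smooth_on S (D v)"
      using smooth_onD[OF assms(1)] by blast
    have "(g has_derivative (\<lambda>v. D v x)) (at x)" if "x \<in> S" for x
      using has_derivative_transform_within_open[OF bspec[OF D(1) that] op that] assms(2) by simp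
    with D(2) 1 show ?thesis by blast
  next
    case 2
    then show ?thesis using smooth_onD[OF 2] by blast
  qed
qed simp

lemma smooth_on_compose_linear:
  fixes f :: "'a::euclidean_space \<Rightarrow> 'b::euclidean_space" and L :: "'c::euclidean_space \<Rightarrow> 'a"
  assumes "smooth_on T f" "bounded_linear L" "open S" "\<And>x. x \<in> S \<Longrightarrow> L x \<in> T"
  shows "smooth_on S (\<lambda>x. f (L x))"
proof (rule smooth_onI[where C = "{\<lambda>x. g (L x) | g. smooth_on T g}"])
  fix k assume "k \<in> {\<lambda>x. g (L x) | g. smooth_on T g}"
  then obtain g where g: "smooth_on T g" "k = (\<lambda>x. g (L x))" by blast
  obtain D where D: "\<forall>x\<in>T. (g has_derivative (\<lambda>v. D v x)) (at x)" "\<forall>v. smooth_on T (D v)"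
    using smooth_onD[OF g(1)] by blast
  have "(k has_derivative (\<lambda>v. D (L v) (L x))) (at x)" if "x \<in> S" for x
    using has_derivative_compose[OF bounded_linear.has_derivative[OF assms(2) has_derivative_ident], of g _ x]
      D(1) assms(4)[OF that] unfolding g(2) by auto
  with D(2) show "\<exists>D. (\<forall>x\<in>S. (k has_derivative (\<lambda>v. D v x)) (at x)) \<and>
      (\<forall>v. D v \<in> {\<lambda>x. g (L x) | g. smooth_on T g})"
    by (intro exI[of _ "\<lambda>v x. D (L v) (L x)"]) blast
qed (use assms in auto)

lemma smooth_on_vec:
  fixes f :: "'a::euclidean_space \<Rightarrow> 'n::finite \<Rightarrow> real"
  assumes "open S" "\<And>i. smooth_on S (\<lambda>x. f x i)"
  shows "smooth_on S (\<lambda>x. \<chi> i. f x i)"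
proof (rule smooth_onI[where C = "{\<lambda>x. \<chi> i. g i x | g. \<forall>i. smooth_on S (g i)}"])
  show "(\<lambda>x. \<chi> i. f x i) \<in> {\<lambda>x. \<chi> i. g i x | g. \<forall>i. smooth_on S (g i)}"
    using assms(2) by (intro CollectI exI[of _ "\<lambda>i x. f x i"]) simp
  fix k assume "k \<in> {\<lambda>x. \<chi> i::'n. (g i x :: real) | g. \<forall>i. smooth_on S (g i)}"
  then obtain g where g: "\<And>i. smooth_on S (g i)" "k = (\<lambda>x. \<chi> i. g i x)" by blast
  obtain D where D: "\<And>i x. x \<in> S \<Longrightarrow> (g i has_derivative (\<lambda>v. D i v x)) (at x)"
      "\<And>i v. smooth_on S (D i v)"
    using smooth_onD[OF g(1)] by metis
  have "(k has_derivative (\<lambda>v. \<chi> i. D i v x)) (at x)" if "x \<in> S" for x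
    unfolding has_derivative_componentwise_within[of k]
    using D(1)[OF that] by (simp add: Basis_vec_def inner_axis g(2))
  moreover have "(\<lambda>x. \<chi> i. D i v x) \<in> {\<lambda>x. \<chi> i. g i x | g. \<forall>i. smooth_on S (g i)}" for v
    using D(2) by (intro CollectI exI[of _ "\<lambda>i. D i v"]) simp
  ultimately show "\<exists>D. (\<forall>x\<in>S. (k has_derivative (\<lambda>v. D v x)) (at x)) \<and>
     (\<forall>v. D v \<in> {\<lambda>x. \<chi> i. g i x | g. \<forall>i. smooth_on S (g i)})"
    by (intro exI[of _ "\<lambda>v x. \<chi> i. D i v x"] conjI allI ballI)
qed (use assms in auto)

lemma smooth_on_const: "open S \<Longrightarrow> smooth_on S (\<lambda>x. c)"
proof (rule smooth_onI[where C = "range (\<lambda>c x. c)"])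
  fix g :: "'a \<Rightarrow> 'b" assume "g \<in> range (\<lambda>c x. c)"
  then obtain c where g: "g = (\<lambda>x. c)" by blast
  show "\<exists>D. (\<forall>x\<in>S. (g has_derivative (\<lambda>v. D v x)) (at x)) \<and> (\<forall>v. D v \<in> range (\<lambda>c x. c))"
    unfolding g by (rule exI[of _ "\<lambda>v x. 0"]) simp
qed auto

lemma smooth_on_linear:
  fixes L :: "'a::euclidean_space \<Rightarrow> 'b::euclidean_space"
  assumes "bounded_linear L" "open S"
  shows "smooth_on S L"
proof (rule smooth_onI[where C = "insert L {k. smooth_on S k}"])
  fix g assume "g \<in> insert L {k. smooth_on S k}"
  then consider "g = L" | "smooth_on S g" by blast
  then show "\<exists>D. (\<forall>x\<in>S. (g has_derivative (\<lambda>v. D v x)) (at x)) \<and>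
      (\<forall>v. D v \<in> insert L {k. smooth_on S k})"
  proof cases
    case 1
    show ?thesis
      unfolding 1
      by (rule exI[of _ "\<lambda>v x. L v"])
        (simp add: bounded_linear_imp_has_derivative assms smooth_on_const)
  next
    case 2
    then show ?thesis using smooth_onD[OF 2] by blast
  qed
qed (simp_all add: assms)

text \<open>Closing under sums, products and outer compositions at once makes the set of functions stable
  under differentiation, so that no Leibniz or Faa di Bruno formula is needed.\<close>

inductive smooth_alg :: "'a::euclidean_space set \<Rightarrow> ('a \<Rightarrow> real) \<Rightarrow> bool" for S where
  base: "smooth_on S f \<Longrightarrow> smooth_alg S f"
| add: "smooth_alg S f \<Longrightarrow> smooth_alg S g \<Longrightarrow> smooth_alg S (\<lambda>x. f x + g x)"
| mult: "smooth_alg S f \<Longrightarrow> smooth_alg S g \<Longrightarrow> smooth_alg S (\<lambda>x. f x * g x)"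
| comp: "smooth_on I g \<Longrightarrow> smooth_alg S f \<Longrightarrow> (\<forall>x\<in>S. f x \<in> I) \<Longrightarrow> smooth_alg S (\<lambda>x. g (f x))"

lemma smooth_alg_deriv:
  assumes "smooth_alg S f"
  shows "\<exists>D. (\<forall>x\<in>S. (f has_derivative (\<lambda>v. D v x)) (at x)) \<and> (\<forall>v. smooth_alg S (D v))"
  using assms
proof induction
  case (base f)
  then show ?case using smooth_onD[OF base] smooth_alg.base by blast
next
  case (add f g)
  then obtain D E where DE: "\<And>x. x \<in> S \<Longrightarrow> (f has_derivative (\<lambda>v. D v x)) (at x)"
    "\<And>v. smooth_alg S (D v)" "\<And>x. x \<in> S \<Longrightarrow> (g has_derivative (\<lambda>v. E v x)) (at x)"
    "\<And>v. smooth_alg S (E v)" by metis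
  show ?case
  proof (intro exI[of _ "\<lambda>v x. D v x + E v x"] conjI ballI allI)
    show "((\<lambda>x. f x + g x) has_derivative (\<lambda>v. D v x + E v x)) (at x)" if "x \<in> S" for x
      by (intro has_derivative_add DE that)
    show "smooth_alg S (\<lambda>x. D v x + E v x)" for v
      by (intro smooth_alg.add DE)
  qed
next
  case (mult f g)
  then obtain D E where DE: "\<And>x. x \<in> S \<Longrightarrow> (f has_derivative (\<lambda>v. D v x)) (at x)"
    "\<And>v. smooth_alg S (D v)" "\<And>x. x \<in> S \<Longrightarrow> (g has_derivative (\<lambda>v. E v x)) (at x)"
    "\<And>v. smooth_alg S (E v)" by metis
  show ?case
  proof (intro exI[of _ "\<lambda>v x. f x * E v x + D v x * g x"] conjI ballI allI)
    show "((\<lambda>x. f x * g x) has_derivative (\<lambda>v. f x * E v x + D v x * g x)) (at x)" if "x \<in> S" for x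
      by (intro has_derivative_mult DE that)
    show "smooth_alg S (\<lambda>x. f x * E v x + D v x * g x)" for v
      by (intro smooth_alg.add smooth_alg.mult DE mult.hyps)
  qed
next
  case (comp I g f)
  then obtain D where D: "\<forall>x\<in>S. (f has_derivative (\<lambda>v. D v x)) (at x)" "\<forall>v. smooth_alg S (D v)"
    by blast
  obtain E where E: "\<forall>x\<in>I. (g has_derivative (\<lambda>v. E v x)) (at x)" "\<forall>v. smooth_on I (E v)"
    using smooth_onD[OF comp.hyps(1)] by blast
  \<comment> \<open>The chain rule yields \<open>E (D v x) (f x)\<close>, whose direction varies
    with \<open>x\<close>. Linearity in the direction turns it into a product of two members of
    \<open>smooth_alg\<close>.\<close>
  have lin: "E v t = v * E 1 t" if "t \<in> I" for v t
    using linear_scale[OF has_derivative_linear[OF bspec[OF E(1) that]], of v 1]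
    unfolding real_scaleR_def mult_1_right .
  have "((\<lambda>x. g (f x)) has_derivative (\<lambda>v. D v x * E 1 (f x))) (at x)" if "x \<in> S" for x
  proof -
    have "((\<lambda>x. g (f x)) has_derivative (\<lambda>v. E (D v x) (f x))) (at x)"
      using has_derivative_compose[OF bspec[OF D(1) that], of g] E(1) comp.hyps(3) that by blast
    moreover have "(\<lambda>v. E (D v x) (f x)) = (\<lambda>v. D v x * E 1 (f x))"
      by (rule ext, rule lin[OF bspec[OF comp.hyps(3) that]])
    ultimately show ?thesis by simp
  qed
  moreover have "smooth_alg S (\<lambda>x. D v x * E 1 (f x))" for v
    by (intro smooth_alg.mult smooth_alg.comp[of I "E 1"] D(2)[rule_format] E(2)[rule_format] comp.hyps)
  ultimately show ?case by (intro exI[of _ "\<lambda>v x. D v x * E 1 (f x)"]) blast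
qed

lemma smooth_alg_imp_smooth_on:
  assumes "open S" "smooth_alg S f"
  shows "smooth_on S f"
  by (rule smooth_onI[OF assms(1), where C = "Collect (smooth_alg S)"])
    (use assms(2) smooth_alg_deriv in blast)+

lemma smooth_on_add:
  fixes f g :: "'a::euclidean_space \<Rightarrow> real"
  shows "smooth_on S f \<Longrightarrow> smooth_on S g \<Longrightarrow> smooth_on S (\<lambda>x. f x + g x)"
  by (rule smooth_alg_imp_smooth_on[OF smooth_on_open smooth_alg.add[OF smooth_alg.base smooth_alg.base]])

lemma smooth_on_mult:
  fixes f g :: "'a::euclidean_space \<Rightarrow> real"
  shows "smooth_on S f \<Longrightarrow> smooth_on S g \<Longrightarrow> smooth_on S (\<lambda>x. f x * g x)"
  by (rule smooth_alg_imp_smooth_on[OF smooth_on_open smooth_alg.mult[OF smooth_alg.base smooth_alg.base]])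

lemma smooth_on_compose:
  fixes f :: "'a::euclidean_space \<Rightarrow> real" and g :: "real \<Rightarrow> real"
  shows "smooth_on I g \<Longrightarrow> smooth_on S f \<Longrightarrow> (\<And>x. x \<in> S \<Longrightarrow> f x \<in> I) \<Longrightarrow> smooth_on S (\<lambda>x. g (f x))"
  by (rule smooth_alg_imp_smooth_on[OF smooth_on_open smooth_alg.comp[OF _ smooth_alg.base]]) auto

lemma smooth_on_uminus:
  fixes f :: "'a::euclidean_space \<Rightarrow> real"
  shows "smooth_on S f \<Longrightarrow> smooth_on S (\<lambda>x. - f x)"
  using smooth_on_mult[OF smooth_on_const[of S "-1::real"], of f] smooth_on_open by fastforce

lemma smooth_on_diff:
  fixes f g :: "'a::euclidean_space \<Rightarrow> real"
  shows "smooth_on S f \<Longrightarrow> smooth_on S g \<Longrightarrow> smooth_on S (\<lambda>x. f x - g x)"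
  using smooth_on_add[OF _ smooth_on_uminus, of S f g] by simp

lemma smooth_on_sum:
  fixes f :: "'i \<Rightarrow> 'a::euclidean_space \<Rightarrow> real"
  assumes "open S" "\<And>i. i \<in> A \<Longrightarrow> smooth_on S (f i)"
  shows "smooth_on S (\<lambda>x. \<Sum>i\<in>A. f i x)"
  using assms(2) by (induction A rule: infinite_finite_induct)
    (auto intro!: smooth_on_const smooth_on_add assms(1))

text \<open>Adjoining \<open>F\<close> to the smooth functions gives a class closed under
  differentiation. This serves for functions best known through their derivatives: the logarithm,
  the arctangent, two of the coordinates on the radii and the curvature integral.\<close>

lemma smooth_on_antideriv:
  fixes F :: "real \<Rightarrow> real"
  assumes "smooth_on I F'" "\<And>t. t \<in> I \<Longrightarrow> (F has_real_derivative F' t) (at t)"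
  shows "smooth_on I F"
proof (rule smooth_onI[where C = "insert F {k. smooth_on I k}"])
  show op: "open I" using assms(1) by (rule smooth_on_open)
  fix k assume "k \<in> insert F {k. smooth_on I k}"
  then consider "k = F" | "smooth_on I k" by blast
  then show "\<exists>D. (\<forall>x\<in>I. (k has_derivative (\<lambda>v. D v x)) (at x)) \<and>
      (\<forall>v. D v \<in> insert F {k. smooth_on I k})"
  proof cases
    case 1
    then show ?thesis
      using assms(2) smooth_on_mult[OF assms(1) smooth_on_const[OF op]]
      by (intro exI[of _ "\<lambda>v t. F' t * v"]) (auto simp: has_field_derivative_def)
  next
    case 2
    then show ?thesis using smooth_onD[OF 2] by blast
  qed
qed simp

section \<open>Smoothness of the elementary functions\<close>

lemma smooth_on_ident: "open S \<Longrightarrow> smooth_on S (\<lambda>x::real. x)"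
  by (intro smooth_on_linear bounded_linear_ident)

lemma smooth_on_exp: "smooth_on UNIV (exp :: real \<Rightarrow> real)"
proof (rule smooth_onI[where C = "range (\<lambda>c t. c * exp t)"])
  show "exp \<in> range (\<lambda>(c::real) t. c * exp t)"
    by (rule range_eqI[of _ _ 1]) simp
  fix g assume "g \<in> range (\<lambda>(c::real) t. c * exp t)"
  then obtain c where "g = (\<lambda>t. c * exp t)" by blast
  then show "\<exists>D. (\<forall>x\<in>UNIV. (g has_derivative (\<lambda>v. D v x)) (at x)) \<and>
      (\<forall>v. D v \<in> range (\<lambda>(c::real) t. c * exp t))"
    by (intro exI[of _ "\<lambda>v t. (c * v) * exp t"]) (auto intro!: derivative_eq_intros)
qed simp

lemma smooth_on_sin_cos: "smooth_on UNIV (\<lambda>t::real. a * sin t + b * cos t)"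
proof (rule smooth_onI[where C = "{\<lambda>t. a * sin t + b * cos t | a b. True}"])
  fix g assume "g \<in> {\<lambda>t::real. a * sin t + b * cos t | a b. True}"
  then obtain a b where g: "g = (\<lambda>t. a * sin t + b * cos t)" by blast
  show "\<exists>D. (\<forall>x\<in>UNIV. (g has_derivative (\<lambda>v. D v x)) (at x)) \<and>
      (\<forall>v. D v \<in> {\<lambda>t::real. a * sin t + b * cos t | a b. True})"
  proof (intro exI[of _ "\<lambda>v t. (- b * v) * sin t + (a * v) * cos t"] conjI allI ballI)
    show "(g has_derivative (\<lambda>v. (- b * v) * sin x + (a * v) * cos x)) (at x)" for x
      unfolding g by (auto intro!: derivative_eq_intros simp: algebra_simps)
  qed blast
qed auto

lemma smooth_on_sin: "smooth_on UNIV (sin :: real \<Rightarrow> real)"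
  using smooth_on_sin_cos[of 1 0] by simp

lemma smooth_on_cos: "smooth_on UNIV (cos :: real \<Rightarrow> real)"
  using smooth_on_sin_cos[of 0 1] by simp

lemma smooth_on_powr: "smooth_on {0<..} (\<lambda>t::real. t powr k)"
proof (rule smooth_onI[where C = "range (\<lambda>(c, k) t. c * t powr k)"])
  show "(\<lambda>t. t powr k) \<in> range (\<lambda>(c, k) t. c * t powr k)"
    by (rule range_eqI[of _ _ "(1, k)"]) simp
  fix g assume "g \<in> range (\<lambda>(c, k) (t::real). c * t powr k)"
  then obtain c k where g: "g = (\<lambda>t. c * t powr k)" by auto
  have "(g has_real_derivative c * (k * t powr (k - 1))) (at t)" if "0 < t" for t
    unfolding g using that by (auto intro!: derivative_eq_intros simp: powr_diff)
  moreover have "(*) (c * (k * t powr (k - 1))) = (\<lambda>v. (c * v * k) * t powr (k - 1))" for t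
    by auto
  ultimately have "(g has_derivative (\<lambda>v. (c * v * k) * t powr (k - 1))) (at t)" if "t \<in> {0<..}" for t
    using that by (simp add: has_field_derivative_def)
  moreover have "(\<lambda>t. (c * v * k) * t powr (k - 1)) \<in> range (\<lambda>(c, k) t. c * t powr k)" for v
    by (rule range_eqI[of _ _ "(c * v * k, k - 1)"]) simp
  ultimately show "\<exists>D. (\<forall>x\<in>{0<..}. (g has_derivative (\<lambda>v. D v x)) (at x)) \<and>
      (\<forall>v. D v \<in> range (\<lambda>(c, k) (t::real). c * t powr k))"
    by (intro exI[of _ "\<lambda>v t. (c * v * k) * t powr (k - 1)"] conjI ballI allI)
qed auto

lemma smooth_on_inverse_pos: "smooth_on {0<..} (inverse :: real \<Rightarrow> real)"
  by (rule smooth_on_cong[OF smooth_on_powr[of "-1"]]) (auto simp: powr_minus)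

lemma smooth_on_divide:
  fixes f g :: "'a::euclidean_space \<Rightarrow> real"
  assumes "smooth_on S f" "smooth_on S g" "\<And>x. x \<in> S \<Longrightarrow> 0 < g x"
  shows "smooth_on S (\<lambda>x. f x / g x)"
  using smooth_on_mult[OF assms(1) smooth_on_compose[OF smooth_on_inverse_pos assms(2)]] assms(3)
  by (simp add: field_class.field_divide_inverse)

lemma smooth_on_ln: "smooth_on {0<..} (ln :: real \<Rightarrow> real)"
  by (rule smooth_on_antideriv[OF smooth_on_inverse_pos])
    (auto intro!: derivative_eq_intros simp: field_simps)

lemma smooth_on_sinh: "smooth_on UNIV (sinh :: real \<Rightarrow> real)"
  and smooth_on_cosh: "smooth_on UNIV (cosh :: real \<Rightarrow> real)"
proof -
  have e: "smooth_on UNIV (\<lambda>t::real. exp (- t))"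
    by (intro smooth_on_compose[OF smooth_on_exp] smooth_on_uminus smooth_on_ident) auto
  show "smooth_on UNIV (sinh :: real \<Rightarrow> real)"
    by (rule smooth_on_cong[OF smooth_on_mult[OF smooth_on_const[of _ "1/2"] smooth_on_diff[OF smooth_on_exp e]]])
      (auto simp: sinh_def)
  show "smooth_on UNIV (cosh :: real \<Rightarrow> real)"
    by (rule smooth_on_cong[OF smooth_on_mult[OF smooth_on_const[of _ "1/2"] smooth_on_add[OF smooth_on_exp e]]])
      (auto simp: cosh_def)
qed

lemma smooth_on_arctan: "smooth_on UNIV (arctan :: real \<Rightarrow> real)"
proof (rule smooth_on_antideriv)
  have "smooth_on UNIV (\<lambda>t::real. 1 + t * t)"
    by (intro smooth_on_add smooth_on_mult smooth_on_ident smooth_on_const) auto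
  then show "smooth_on UNIV (\<lambda>t::real. 1 / (1 + t * t))"
    by (intro smooth_on_divide smooth_on_const) (auto simp: add_pos_nonneg)
qed (auto intro!: derivative_eq_intros simp: power2_eq_square field_simps)

section \<open>The maximum principle\<close>

text \<open>The data of one edge of a circle pattern: \<open>T a b\<close> is the contribution to the curvature at the
  first 2-cell, and \<open>U\<close> is a coordinate in which the own variable dominates the other one.
  \<open>X\<close> is the reciprocal of the derivative of \<open>U\<close>.\<close>

definition edge_dominant ::
  "(real \<Rightarrow> real) \<Rightarrow> (real \<Rightarrow> real) \<Rightarrow> (real \<times> real) set \<Rightarrow> (real \<Rightarrow> real \<Rightarrow> real) \<Rightarrow> bool" where
  "edge_dominant U X D T \<longleftrightarrow>
     smooth_on D (\<lambda>p. T (fst p) (snd p)) \<and>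
     (\<forall>a b a' b'. (a, b) \<in> D \<longrightarrow> (a', b') \<in> D \<longrightarrow> U a' < U a \<longrightarrow> \<bar>U b - U b'\<bar> \<le> U a - U a' \<longrightarrow>
        T a b < T a' b') \<and>
     (\<forall>a b. (a, b) \<in> D \<longrightarrow> X a > 0 \<and> X b > 0 \<and>
        (\<exists>A B. ((\<lambda>p. T (fst p) (snd p)) has_derivative (\<lambda>p. A * fst p + B * snd p)) (at (a, b)) \<and>
          \<bar>B\<bar> * X b < - A * X a))"

lemma obtain_max:
  fixes w :: "'f::finite \<Rightarrow> real"
  obtains g where "\<And>k. w k \<le> w g"
proof -
  have "Max (range w) \<in> range w" by (intro Max_in) auto
  then obtain g where "w g = Max (range w)" by force
  then have "w k \<le> w g" for k by simp
  then show ?thesis by (rule that)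
qed

text \<open>\<open>x\<close> runs through the darts, \<open>face x\<close> is its own 2-cell and
  \<open>nb x\<close> the one across its edge; the two may coincide. One coordinate \<open>U\<close>
  serves all darts, while \<open>D x\<close> and \<open>T x\<close> vary from edge to edge.\<close>

locale dominant_pattern =
  fixes face nb :: "'d::finite \<Rightarrow> 'f::finite"
    and U X :: "real \<Rightarrow> real"
    and D :: "'d \<Rightarrow> (real \<times> real) set"
    and T :: "'d \<Rightarrow> real \<Rightarrow> real \<Rightarrow> real"
    and S :: "(real^'f) set" and K :: "real^'f \<Rightarrow> real^'f"
  assumes surj: "surj face"
    and dom: "\<And>x. edge_dominant U X (D x) (T x)"
    and injU: "\<And>x a b a' b'. (a, b) \<in> D x \<Longrightarrow> (a', b') \<in> D x \<Longrightarrow> U a = U a' \<Longrightarrow> a = a'"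
    and S_def: "S = {r. \<forall>x. (r $ face x, r $ nb x) \<in> D x}"
    and K_def: "\<And>r. K r = (\<chi> g. (\<Sum>x\<in>{x. face x = g}. T x (r $ face x) (r $ nb x)) / 2)"
begin

lemma bounded_linear_pair: "bounded_linear (\<lambda>r::real^'f. (r $ i, r $ j))"
  by (intro bounded_linear_Pair bounded_linear_vec_nth)

lemma open_S: "open S"
proof -
  have "S = (\<Inter>x. (\<lambda>r. (r $ face x, r $ nb x)) -` D x)"
    by (auto simp: S_def)
  moreover have "open ((\<lambda>r::real^'f. (r $ face x, r $ nb x)) -` D x)" for x
  proof (rule open_vimage)
    show "open (D x)" using dom smooth_on_open unfolding edge_dominant_def by blast
    show "continuous_on UNIV (\<lambda>r::real^'f. (r $ face x, r $ nb x))"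
      by (intro continuous_intros)
  qed
  ultimately show ?thesis by (simp add: open_INT)
qed

lemma smooth_K: "smooth_on S K"
proof -
  have "smooth_on S (\<lambda>r. T x (r $ face x) (r $ nb x))" for x
    using smooth_on_compose_linear[OF _ bounded_linear_pair open_S, of "D x" "\<lambda>p. T x (fst p) (snd p)"]
      dom unfolding edge_dominant_def S_def by auto
  then have "smooth_on S (\<lambda>r. (\<Sum>x\<in>{x. face x = g}. T x (r $ face x) (r $ nb x)) * (1 / 2))" for g
    by (intro smooth_on_mult smooth_on_sum smooth_on_const open_S)
  then have "smooth_on S (\<lambda>r. \<chi> g. (\<Sum>x\<in>{x. face x = g}. T x (r $ face x) (r $ nb x)) / 2)"
    by (intro smooth_on_vec open_S) simp
  then show ?thesis by (simp add: K_def[abs_def])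
qed

text \<open>Each dart of \<open>g\<close> meets the premise of the monotonicity clause of
  \<open>edge_dominant\<close>: in the coordinate \<open>U\<close> the neighbour differs by no more
  than \<open>g\<close> does, with equality if the neighbour is \<open>g\<close> itself.
  Surjectivity of \<open>face\<close> makes the sum nonempty, hence the strict inequality.\<close>

lemma K_less:
  assumes "r \<in> S" "s \<in> S" "U (s $ g) < U (r $ g)"
    and max: "\<And>k. \<bar>U (r $ k) - U (s $ k)\<bar> \<le> U (r $ g) - U (s $ g)"
  shows "K r $ g < K s $ g"
proof -
  have "{x. face x = g} \<noteq> {}" using surj by (metis (mono_tags) empty_iff mem_Collect_eq surjD)
  moreover have "T x (r $ face x) (r $ nb x) < T x (s $ face x) (s $ nb x)" if "face x = g" for x
    using dom[of x] assms that unfolding edge_dominant_def S_def by blast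
  ultimately have "(\<Sum>x\<in>{x. face x = g}. T x (r $ face x) (r $ nb x))
      < (\<Sum>x\<in>{x. face x = g}. T x (s $ face x) (s $ nb x))"
    by (intro sum_strict_mono) auto
  then show ?thesis by (simp add: K_def)
qed

lemma inj_K: "inj_on K S"
proof (rule inj_onI)
  fix r s assume rs: "r \<in> S" "s \<in> S" "K r = K s"
  \<comment> \<open>The absolute difference is maximized, so that one \<open>g\<close> serves both
    signs; exchanging \<open>r\<close> and \<open>s\<close> in \<open>K_less\<close> excludes the
    second sign.\<close>
  obtain g where g: "\<And>k. \<bar>U (r $ k) - U (s $ k)\<bar> \<le> \<bar>U (r $ g) - U (s $ g)\<bar>"
    using obtain_max[of "\<lambda>k. \<bar>U (r $ k) - U (s $ k)\<bar>"] by blast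
  have "\<not> U (s $ g) < U (r $ g)" using K_less[of r s g] rs g by auto
  moreover have "\<not> U (r $ g) < U (s $ g)"
    using K_less[of s r g] rs g by (auto simp: abs_minus_commute)
  ultimately have "U (r $ k) = U (s $ k)" for k using g[of k] by auto
  moreover have "\<exists>x. face x = k" for k using surj by (metis surjD)
  ultimately have "r $ k = s $ k" for k
    using injU rs unfolding S_def by (metis (mono_tags, lifting) mem_Collect_eq)
  then show "r = s" by (simp add: vec_eq_iff)
qed

lemma inj_deriv_K:
  assumes r: "r \<in> S" and f': "(K has_derivative f') (at r)"
  shows "inj f'"
proof -
  have mem: "(r $ face x, r $ nb x) \<in> D x" for x using r by (simp add: S_def)
  let ?P = "\<lambda>x A B. ((\<lambda>p. T x (fst p) (snd p)) has_derivative (\<lambda>p. A * fst p + B * snd p))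
        (at (r $ face x, r $ nb x)) \<and> \<bar>B\<bar> * X (r $ nb x) < - A * X (r $ face x)"
  have "\<forall>x. \<exists>A B. ?P x A B"
    using dom mem unfolding edge_dominant_def by fast
  then obtain A where "\<forall>x. \<exists>B. ?P x (A x) B" by (rule choice[THEN exE])
  then obtain B where P: "\<forall>x. ?P x (A x) (B x)" by (rule choice[THEN exE])
  have AB: "((\<lambda>p. T x (fst p) (snd p)) has_derivative (\<lambda>p. A x * fst p + B x * snd p))
        (at (r $ face x, r $ nb x))" for x using P by blast
  have dm: "\<bar>B x\<bar> * X (r $ nb x) < - A x * X (r $ face x)" for x using P by blast
  have X: "X (r $ face x) > 0" for x using dom[of x] mem[of x] unfolding edge_dominant_def by blast
  have X': "X (r $ nb x) > 0" for x using dom[of x] mem[of x] unfolding edge_dominant_def by blast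
  have Tx: "((\<lambda>r. T x (r $ face x) (r $ nb x)) has_derivative (\<lambda>v. A x * v $ face x + B x * v $ nb x)) (at r)" for x
    using has_derivative_compose[OF bounded_linear.has_derivative[OF bounded_linear_pair has_derivative_ident] AB]
    by simp
  have comp: "f' v $ g = (\<Sum>x\<in>{x. face x = g}. A x * v $ face x + B x * v $ nb x) * (1 / 2)" for v g
  proof -
    have "((\<lambda>r. K r $ g) has_derivative (\<lambda>v. f' v $ g)) (at r)"
      by (rule bounded_linear.has_derivative[OF bounded_linear_vec_nth f'])
    moreover have "((\<lambda>r. K r $ g) has_derivative
        (\<lambda>v. (\<Sum>x\<in>{x. face x = g}. A x * v $ face x + B x * v $ nb x) * (1 / 2))) (at r)"
    proof -
      have "(\<lambda>r. K r $ g) = (\<lambda>r. (\<Sum>x\<in>{x. face x = g}. T x (r $ face x) (r $ nb x)) * (1 / 2))"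
        by (simp add: K_def)
      then show ?thesis by (simp only:) (intro has_derivative_mult_left has_derivative_sum Tx)
    qed
    ultimately show ?thesis by (rule has_derivative_unique[THEN fun_cong])
  qed
  have "v = 0" if "f' v = 0" for v
  proof (rule ccontr)
    assume "v \<noteq> 0"
    then obtain k0 where k0: "v $ k0 \<noteq> 0" by (auto simp: vec_eq_iff)
    \<comment> \<open>\<open>w\<close> is the tangent vector \<open>v\<close> written in the
      coordinate \<open>U\<close>, \<open>X\<close> being the reciprocal of the derivative of
      \<open>U\<close>.\<close>
    define w where "w k = v $ k / X (r $ k)" for k
    obtain g where g: "\<And>k. \<bar>w k\<bar> \<le> \<bar>w g\<bar>" using obtain_max[of "\<lambda>k. \<bar>w k\<bar>"] by blast
    have fx: "\<exists>x. face x = k" for k using surj by (metis surjD)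
    have Xk: "X (r $ k) > 0" for k using fx X by metis
    have "w k0 \<noteq> 0" using k0 Xk[of k0] by (simp add: w_def)
    then have wg: "\<bar>w g\<bar> > 0" using g[of k0] by linarith
    have vw: "v $ k = X (r $ k) * w k" for k using Xk[of k] by (simp add: w_def)
    \<comment> \<open>Multiplying by \<open>w g\<close> treats both signs at once: the own term
      becomes \<open>A x * X (r $ face x)\<close> times the square of \<open>w g\<close>, which is
      negative and outweighs the term of the neighbour.\<close>
    have neg: "(A x * v $ face x + B x * v $ nb x) * w g < 0" if "face x = g" for x
    proof -
      have "B x * v $ nb x * w g \<le> \<bar>B x\<bar> * X (r $ nb x) * (\<bar>w (nb x)\<bar> * \<bar>w g\<bar>)"
        using X'[of x] abs_ge_self[of "B x * v $ nb x * w g"] by (simp add: vw abs_mult)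
      also have "\<dots> \<le> \<bar>B x\<bar> * X (r $ nb x) * (\<bar>w g\<bar> * \<bar>w g\<bar>)"
        using X'[of x] g by (intro mult_left_mono mult_right_mono) auto
      also have "\<dots> < - A x * X (r $ face x) * (\<bar>w g\<bar> * \<bar>w g\<bar>)"
        by (intro mult_strict_right_mono dm mult_pos_pos wg)
      also have "\<dots> = - (A x * v $ face x * w g)"
        using that by (simp add: vw algebra_simps)
      finally show ?thesis by (simp add: algebra_simps)
    qed
    have "(\<Sum>x\<in>{x. face x = g}. (A x * v $ face x + B x * v $ nb x) * w g) < (\<Sum>x\<in>{x. face x = g}. 0)"
      using neg fx[of g] by (intro sum_strict_mono) auto
    then have "f' v $ g * w g < 0" by (simp add: comp sum_distrib_right)
    then show False using that by simp
  qed
  then show ?thesis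
    using linear_injective_0[OF has_derivative_linear[OF f']] by blast
qed

theorem smooth_embedding_K: "smooth_embedding S K"
proof -
  have cont: "continuous_on S K"
    using smooth_onD[OF smooth_K] has_derivative_continuous continuous_at_imp_continuous_on by blast
  \<comment> \<open>Invariance of domain applies because source and target have the same
    dimension.\<close>
  have "continuous_on (K ` S) (the_inv_into S K)"
    by (rule continuous_on_inverse_open[OF open_S cont]) (auto simp: the_inv_into_f_f inj_K)
  then show ?thesis
    unfolding smooth_embedding_def using smooth_K inj_K inj_deriv_K by blast
qed

end

text \<open>Along the segment from \<open>(u', v')\<close> to \<open>(u, v)\<close> the derivative
  is \<open>A * (u - u') + B * (v - v')\<close>, which is at least
  \<open>(A - \<bar>B\<bar>) * (u - u') > 0\<close>. Convexity of \<open>W\<close> keeps the segment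
  where the partial derivatives are controlled.\<close>

lemma mono_of_dominant_partials:
  fixes Q :: "real \<Rightarrow> real \<Rightarrow> real"
  assumes "convex W"
    and der: "\<And>u v. (u, v) \<in> W \<Longrightarrow>
      ((\<lambda>p. Q (fst p) (snd p)) has_derivative (\<lambda>p. A u v * fst p + B u v * snd p)) (at (u, v))"
    and dm: "\<And>u v. (u, v) \<in> W \<Longrightarrow> \<bar>B u v\<bar> < A u v"
    and W: "(u, v) \<in> W" "(u', v') \<in> W" and le: "u' < u" "\<bar>v - v'\<bar> \<le> u - u'"
  shows "Q u' v' < Q u v"
proof -
  define l where "l t = (u' + t * (u - u'), v' + t * (v - v'))" for t
  have lW: "l t \<in> W" if "0 \<le> t" "t \<le> 1" for t
  proof -
    have "(1 - t) *\<^sub>R (u', v') + t *\<^sub>R (u, v) \<in> W"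
      using assms(1) W that by (intro convexD) auto
    moreover have "(1 - t) *\<^sub>R (u', v') + t *\<^sub>R (u, v) = l t"
      by (simp add: l_def algebra_simps)
    ultimately show ?thesis by simp
  qed
  define d where "d t = A (fst (l t)) (snd (l t)) * (u - u') + B (fst (l t)) (snd (l t)) * (v - v')" for t
  have der_pos: "((\<lambda>t. Q (fst (l t)) (snd (l t))) has_real_derivative d t) (at t) \<and> 0 < d t"
    if t: "0 \<le> t" "t \<le> 1" for t
  proof
    have l': "(l has_derivative (\<lambda>s. (s * (u - u'), s * (v - v')))) (at t)"
      unfolding l_def by (auto intro!: derivative_eq_intros)
    have "((\<lambda>t. Q (fst (l t)) (snd (l t))) has_derivative
        (\<lambda>s. A (fst (l t)) (snd (l t)) * (s * (u - u')) + B (fst (l t)) (snd (l t)) * (s * (v - v')))) (at t)"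
      using has_derivative_compose[OF l' der[of "fst (l t)" "snd (l t)", unfolded prod.collapse]] lW[OF t]
      by simp
    then show "((\<lambda>t. Q (fst (l t)) (snd (l t))) has_real_derivative d t) (at t)"
      unfolding has_field_derivative_def d_def
      by (rule has_derivative_eq_rhs) (auto simp: algebra_simps)
    have dmt: "\<bar>B (fst (l t)) (snd (l t))\<bar> < A (fst (l t)) (snd (l t))"
      using dm lW[OF t] by (metis prod.collapse)
    have "- (B (fst (l t)) (snd (l t)) * (v - v')) \<le> \<bar>B (fst (l t)) (snd (l t))\<bar> * (u - u')"
      using mult_left_mono[OF le(2), of "\<bar>B (fst (l t)) (snd (l t))\<bar>"]
      by (simp add: abs_mult[symmetric])
    also have "\<dots> < A (fst (l t)) (snd (l t)) * (u - u')"
      using dmt le by (intro mult_strict_right_mono) auto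
    finally show "0 < d t" unfolding d_def by linarith
  qed
  have "Q (fst (l 0)) (snd (l 0)) < Q (fst (l 1)) (snd (l 1))"
    by (rule DERIV_pos_imp_increasing[OF zero_less_one]) (rule exI, erule (1) der_pos)
  then show ?thesis by (simp add: l_def)
qed

lemma open_coord_domain:
  fixes U X :: "real \<Rightarrow> real"
  assumes "smooth_on Z U" "\<And>a. a \<in> Z \<Longrightarrow> (U has_real_derivative 1 / X a) (at a)" "open W"
  shows "open {(a, b). a \<in> Z \<and> b \<in> Z \<and> (U a, U b) \<in> W}"
proof -
  have contU: "continuous_on Z U"
    by (intro continuous_at_imp_continuous_on ballI DERIV_isCont[OF assms(2)])
  have "open Z" using assms(1) by (rule smooth_on_open)
  have "open ((Z \<times> Z) \<inter> (\<lambda>p. (U (fst p), U (snd p))) -` W)"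
  proof (rule continuous_open_preimage[OF _ open_Times[OF \<open>open Z\<close> \<open>open Z\<close>] assms(3)])
    show "continuous_on (Z \<times> Z) (\<lambda>p. (U (fst p), U (snd p)))"
      by (intro continuous_on_Pair continuous_on_compose2[OF contU] continuous_on_fst
          continuous_on_snd continuous_on_id) auto
  qed
  moreover have "(Z \<times> Z) \<inter> (\<lambda>p. (U (fst p), U (snd p))) -` W = {(a, b). a \<in> Z \<and> b \<in> Z \<and> (U a, U b) \<in> W}"
    by auto
  ultimately show ?thesis by simp
qed

text \<open>The chain rule for \<open>F (Q (U a) (U b))\<close> brings in the factors
  \<open>1 / X a\<close> and \<open>1 / X b\<close>, which cancel against the weights in
  \<open>edge_dominant\<close>; the negative factor \<open>F'\<close> reverses the sign.
  \<open>I\<close> is an interval because comparing two values of \<open>F\<close> uses its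
  derivative at all points between.\<close>

lemma edge_dominantI:
  fixes U X :: "real \<Rightarrow> real" and F F' :: "real \<Rightarrow> real" and Q A B :: "real \<Rightarrow> real \<Rightarrow> real"
  assumes U: "smooth_on Z U" "\<And>a. a \<in> Z \<Longrightarrow> (U has_real_derivative 1 / X a) (at a)"
      "\<And>a. a \<in> Z \<Longrightarrow> 0 < X a"
    and D: "D = {(a, b). a \<in> Z \<and> b \<in> Z \<and> (U a, U b) \<in> W}"
    and W: "convex W" "open W"
    and Q: "smooth_on D (\<lambda>p. Q (U (fst p)) (U (snd p)))"
      "\<And>u v. (u, v) \<in> W \<Longrightarrow>
      ((\<lambda>p. Q (fst p) (snd p)) has_derivative (\<lambda>p. A u v * fst p + B u v * snd p)) (at (u, v))"
      "\<And>u v. (u, v) \<in> W \<Longrightarrow> \<bar>B u v\<bar> < A u v"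
    and QI: "\<And>a b. (a, b) \<in> D \<Longrightarrow> Q (U a) (U b) \<in> I"
    and I: "is_interval I"
    and F: "smooth_on I F" "\<And>q. q \<in> I \<Longrightarrow> (F has_real_derivative F' q) (at q)"
      "\<And>q. q \<in> I \<Longrightarrow> F' q < 0"
    and T: "\<And>a b. (a, b) \<in> D \<Longrightarrow> T a b = F (Q (U a) (U b))"
  shows "edge_dominant U X D T"
proof -
  have openD: "open D" unfolding D by (rule open_coord_domain[OF U(1,2) W(2)])
  have J: "a \<in> Z" "b \<in> Z" "(U a, U b) \<in> W" if "(a, b) \<in> D" for a b
    using that by (auto simp: D)
  have dQ: "((\<lambda>p. Q (U (fst p)) (U (snd p))) has_derivative
      (\<lambda>p. A (U a) (U b) / X a * fst p + B (U a) (U b) / X b * snd p)) (at (a, b))"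
    if "(a, b) \<in> D" for a b
  proof -
    have "((\<lambda>p. U (fst p)) has_derivative (\<lambda>p. 1 / X a * fst p)) (at (a, b))"
      using has_derivative_compose[OF has_derivative_fst[OF has_derivative_ident], of U "(*) (1 / X a)" "(a, b)"]
        U(2)[OF J(1)[OF that]] unfolding has_field_derivative_def fst_conv by blast
    moreover have "((\<lambda>p. U (snd p)) has_derivative (\<lambda>p. 1 / X b * snd p)) (at (a, b))"
      using has_derivative_compose[OF has_derivative_snd[OF has_derivative_ident], of U "(*) (1 / X b)" "(a, b)"]
        U(2)[OF J(2)[OF that]] unfolding has_field_derivative_def snd_conv by blast
    ultimately have "((\<lambda>p. (U (fst p), U (snd p))) has_derivative (\<lambda>p. (1 / X a * fst p, 1 / X b * snd p))) (at (a, b))"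
      by (rule has_derivative_Pair)
    from has_derivative_compose[OF this, of "\<lambda>p. Q (fst p) (snd p)", unfolded fst_conv snd_conv,
        OF Q(2)[OF J(3)[OF that]]]
    show ?thesis by simp
  qed
  have dT: "((\<lambda>p. T (fst p) (snd p)) has_derivative
      (\<lambda>p. F' (Q (U a) (U b)) * (A (U a) (U b) / X a) * fst p
         + F' (Q (U a) (U b)) * (B (U a) (U b) / X b) * snd p)) (at (a, b))"
    if ab: "(a, b) \<in> D" for a b
  proof -
    have "((\<lambda>p. F (Q (U (fst p)) (U (snd p)))) has_derivative
      (\<lambda>p. F' (Q (U a) (U b)) * (A (U a) (U b) / X a * fst p + B (U a) (U b) / X b * snd p))) (at (a, b))"
      using has_derivative_compose[OF dQ[OF ab], of F "(*) (F' (Q (U a) (U b)))"] F(2)[OF QI[OF ab]]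
      unfolding has_field_derivative_def fst_conv snd_conv by blast
    then have "((\<lambda>p. T (fst p) (snd p)) has_derivative
      (\<lambda>p. F' (Q (U a) (U b)) * (A (U a) (U b) / X a * fst p + B (U a) (U b) / X b * snd p))) (at (a, b))"
      by (rule has_derivative_transform_within_open[OF _ openD ab]) (auto simp: T)
    then show ?thesis by (simp only: distrib_left mult.assoc)
  qed
  have sm: "smooth_on D (\<lambda>p. T (fst p) (snd p))"
    by (rule smooth_on_cong[OF smooth_on_compose[OF F(1) Q(1)]]) (use QI T in auto)
  have mono: "T a b < T a' b'"
    if "(a, b) \<in> D" "(a', b') \<in> D" "U a' < U a" "\<bar>U b - U b'\<bar> \<le> U a - U a'" for a b a' b'
  proof -
    have lt: "Q (U a') (U b') < Q (U a) (U b)"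
      by (rule mono_of_dominant_partials[OF W(1) Q(2,3)]) (use that J in auto)
    have "F (Q (U a) (U b)) < F (Q (U a') (U b'))"
    proof (rule DERIV_neg_imp_decreasing[OF lt])
      fix q assume "Q (U a') (U b') \<le> q" "q \<le> Q (U a) (U b)"
      then have "q \<in> I" by (rule mem_is_interval_1_I[OF I QI[OF that(2)] QI[OF that(1)]])
      then show "\<exists>y. (F has_real_derivative y) (at q) \<and> y < 0" using F(2,3) by blast
    qed
    then show ?thesis using T that by simp
  qed
  have ex: "\<exists>A B. ((\<lambda>p. T (fst p) (snd p)) has_derivative (\<lambda>p. A * fst p + B * snd p)) (at (a, b)) \<and>
          \<bar>B\<bar> * X b < - A * X a" if ab: "(a, b) \<in> D" for a b
  proof (intro exI conjI, rule dT[OF ab])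
    have X: "0 < X a" "0 < X b" using U(3) J[OF ab] by auto
    have "\<bar>F' (Q (U a) (U b)) * (B (U a) (U b) / X b)\<bar> * X b = - F' (Q (U a) (U b)) * \<bar>B (U a) (U b)\<bar>"
      using F(3)[OF QI[OF ab]] X by (simp add: abs_mult)
    also have "\<dots> < - F' (Q (U a) (U b)) * A (U a) (U b)"
      using F(3)[OF QI[OF ab]] Q(3)[OF J(3)[OF ab]] by (intro mult_strict_left_mono) auto
    finally show "\<bar>F' (Q (U a) (U b)) * (B (U a) (U b) / X b)\<bar> * X b
        < - (F' (Q (U a) (U b)) * (A (U a) (U b) / X a)) * X a" using X by simp
  qed
  show ?thesis
    unfolding edge_dominant_def
  proof (intro conjI allI impI)
    fix a b assume ab: "(a, b) \<in> D"
    show "0 < X a" "0 < X b" using U(3) J[OF ab] by auto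
    show "\<exists>A B. ((\<lambda>p. T (fst p) (snd p)) has_derivative (\<lambda>p. A * fst p + B * snd p)) (at (a, b)) \<and>
          \<bar>B\<bar> * X b < - A * X a" by (rule ex[OF ab])
  qed (rule sm, rule mono)
qed

section \<open>Distances in the hyperboloid model\<close>

lemma mink_add_left: "mink (x + y) z = mink x z + mink y z"
  and mink_add_right: "mink z (x + y) = mink z x + mink z y"
  and mink_diff_left: "mink (x - y) z = mink x z - mink y z"
  and mink_diff_right: "mink z (x - y) = mink z x - mink z y"
  and mink_scaleR_left: "mink (c *\<^sub>R x) z = c * mink x z"
  and mink_scaleR_right: "mink z (c *\<^sub>R x) = c * mink z x"
  and mink_minus_left: "mink (- x) z = - mink x z"
  and mink_minus_right: "mink z (- x) = - mink z x"
  by (simp_all add: mink_def algebra_simps)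

lemmas mink_simps = mink_add_left mink_add_right mink_diff_left mink_diff_right
  mink_scaleR_left mink_scaleR_right mink_minus_left mink_minus_right

lemma mink_commute: "mink x y = mink y x"
  by (simp add: mink_def mult.commute)

lemma cauchy_schwarz_2: "(a * c + b * d)\<^sup>2 \<le> (a\<^sup>2 + b\<^sup>2) * (c\<^sup>2 + (d::real)\<^sup>2)"
proof -
  have "(a\<^sup>2 + b\<^sup>2) * (c\<^sup>2 + d\<^sup>2) - (a * c + b * d)\<^sup>2 = (a * d - b * c)\<^sup>2"
    by (simp add: power2_eq_square algebra_simps)
  then show ?thesis by (metis diff_ge_0_iff_ge zero_le_power2)
qed

lemma mink_self: "mink x x = (x$1)\<^sup>2 + (x$2)\<^sup>2 - (x$3)\<^sup>2"
  by (simp add: mink_def power2_eq_square)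

text \<open>Replacing the first two coordinates by their Euclidean lengths \<open>p\<close>,
  \<open>q\<close> only strengthens the claim, and in one space dimension it follows from
  \<open>(a^2 - p^2) * (b^2 - q^2) = (a * b - p * q)^2 - (a * q - b * p)^2\<close>.\<close>

lemma reverse_cauchy_schwarz:
  assumes "mink x x \<le> 0" "mink y y \<le> 0" "x$3 > 0" "y$3 > 0"
  shows "sqrt (- mink x x) * sqrt (- mink y y) \<le> - mink x y"
proof -
  define p q where "p = sqrt ((x$1)\<^sup>2 + (x$2)\<^sup>2)" and "q = sqrt ((y$1)\<^sup>2 + (y$2)\<^sup>2)"
  have pq: "p \<ge> 0" "q \<ge> 0" "p\<^sup>2 = (x$1)\<^sup>2 + (x$2)\<^sup>2" "q\<^sup>2 = (y$1)\<^sup>2 + (y$2)\<^sup>2"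
    by (auto simp: p_def q_def)
  have px: "p \<le> x$3"
    by (rule power2_le_imp_le) (use assms in \<open>simp_all add: pq(3) mink_self\<close>)
  have qy: "q \<le> y$3"
    by (rule power2_le_imp_le) (use assms in \<open>simp_all add: pq(4) mink_self\<close>)
  have c: "x$1 * y$1 + x$2 * y$2 \<le> p * q"
  proof (rule power2_le_imp_le)
    show "(x$1 * y$1 + x$2 * y$2)\<^sup>2 \<le> (p * q)\<^sup>2"
      using cauchy_schwarz_2[of "x$1" "y$1" "x$2" "y$2"] by (simp add: power_mult_distrib pq)
    show "0 \<le> p * q" using pq by simp
  qed
  have "(sqrt (- mink x x) * sqrt (- mink y y))\<^sup>2 = ((x$3)\<^sup>2 - p\<^sup>2) * ((y$3)\<^sup>2 - q\<^sup>2)"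
    using assms(1,2) by (simp add: power_mult_distrib mink_self pq(3,4))
  also have "\<dots> = (x$3 * y$3 - p * q)\<^sup>2 - (x$3 * q - y$3 * p)\<^sup>2"
    by (simp add: power2_eq_square algebra_simps)
  also have "\<dots> \<le> (x$3 * y$3 - p * q)\<^sup>2" by simp
  finally have "sqrt (- mink x x) * sqrt (- mink y y) \<le> x$3 * y$3 - p * q"
    by (rule power2_le_imp_le) (use px qy pq in \<open>simp add: mult_mono\<close>)
  with c show ?thesis by (simp add: mink_def)
qed

lemma mink_future_neg:
  assumes "mink x x < 0" "mink y y \<le> 0" "x$3 > 0" "y$3 > 0"
  shows "mink x y < 0"
proof -
  have "(x$1 * y$1 + x$2 * y$2)\<^sup>2 \<le> ((x$1)\<^sup>2 + (x$2)\<^sup>2) * ((y$1)\<^sup>2 + (y$2)\<^sup>2)"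
    by (rule cauchy_schwarz_2)
  also have "\<dots> \<le> ((x$1)\<^sup>2 + (x$2)\<^sup>2) * (y$3)\<^sup>2"
    using assms by (intro mult_left_mono) (auto simp: mink_self)
  also have "\<dots> < (x$3)\<^sup>2 * (y$3)\<^sup>2"
    using assms by (intro mult_strict_right_mono) (auto simp: mink_self)
  finally have "(x$1 * y$1 + x$2 * y$2)\<^sup>2 < (x$3 * y$3)\<^sup>2" by (simp add: power_mult_distrib)
  then have "x$1 * y$1 + x$2 * y$2 < x$3 * y$3"
    by (rule power_less_imp_less_base) (use assms in simp)
  then show ?thesis by (simp add: mink_def)
qed

text \<open>Otherwise \<open>- x\<close> would lie in the future cone and have negative product with
  \<open>u\<close>. This places constructed points on the upper sheet of the hyperboloid.\<close>

lemma future_if_mink_neg: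
  assumes "mink x x < 0" "mink u u \<le> 0" "u$3 > 0" "mink x u < 0"
  shows "x$3 > 0"
proof (rule ccontr)
  assume "\<not> x$3 > 0"
  moreover have "x$3 \<noteq> 0"
    using assms(1) not_sum_power2_lt_zero[of "x$1" "x$2"] by (auto simp: mink_self)
  ultimately have "0 < (- x)$3" by simp
  moreover have "mink (- x) (- x) < 0" using assms(1) by (simp add: mink_minus_left mink_minus_right)
  ultimately have "mink (- x) u < 0" by (rule mink_future_neg[OF _ assms(2) _ assms(3), rotated])
  then show False using assms(4) by (simp add: mink_minus_left)
qed

text \<open>The orthogonal complement of a light-like vector is tangent to the light cone, so it
  contains no time-like vector.\<close>

lemma orth_null_nonneg:
  assumes "mink w w = 0" "w$3 > 0" "mink y w = 0"
  shows "mink y y \<ge> 0"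
proof -
  have "(y$3)\<^sup>2 * (w$3)\<^sup>2 = (y$1 * w$1 + y$2 * w$2)\<^sup>2"
    using assms(3) by (simp add: mink_def power_mult_distrib[symmetric])
  also have "\<dots> \<le> ((y$1)\<^sup>2 + (y$2)\<^sup>2) * ((w$1)\<^sup>2 + (w$2)\<^sup>2)"
    by (rule cauchy_schwarz_2)
  also have "\<dots> = ((y$1)\<^sup>2 + (y$2)\<^sup>2) * (w$3)\<^sup>2"
    using assms(1) by (simp add: mink_self)
  finally show ?thesis using assms(2) by (simp add: mink_self)
qed

lemma H2_D: "x \<in> H2 \<Longrightarrow> mink x x = -1" "x \<in> H2 \<Longrightarrow> x$3 > 0"
  by (auto simp: H2_def)

lemma H2_mink_ge_1: "x \<in> H2 \<Longrightarrow> y \<in> H2 \<Longrightarrow> 1 \<le> - mink x y"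
  using reverse_cauchy_schwarz[of x y] H2_D[of x] H2_D[of y] by simp

lemma hdist_nonneg: "x \<in> H2 \<Longrightarrow> y \<in> H2 \<Longrightarrow> 0 \<le> hdist x y"
  using H2_mink_ge_1 by (simp add: hdist_def)

text \<open>Distance estimates from a half-plane and from a horodisk: the polar hyperplane of \<open>v\<close> is
  split off in the first one, and \<open>u / n - x / k\<close> is orthogonal to the light-like vector \<open>w\<close>
  in the second one.\<close>

lemma halfplane_bound:
  assumes v: "mink v v = 1" "v$3 > 0" and x: "x \<in> H2" "mink x v \<ge> 0"
    and u: "u$3 > 0" "mink u u = - \<tau>" "mink u v < 0" "\<tau> + (mink u v)\<^sup>2 > 0"
  shows "sqrt (\<tau> + (mink u v)\<^sup>2) \<le> - mink x u"
proof -
  define k where "k = mink x v"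
  define t where "t = - mink u v"
  define x' where "x' = x - k *\<^sub>R v"
  define u' where "u' = u + t *\<^sub>R v"
  have m: "mink v x = k" "mink v u = - t" "mink x v = k" "mink u v = - t"
    by (auto simp: k_def t_def mink_commute)
  have t: "t > 0" and k: "k \<ge> 0" using u x by (auto simp: t_def k_def)
  have xx: "mink x' x' = - (1 + k\<^sup>2)"
    by (simp add: x'_def mink_simps m v H2_D(1)[OF x(1)] power2_eq_square)
  have uu: "mink u' u' = - (\<tau> + t\<^sup>2)"
    by (simp add: u'_def mink_simps m v u(2) power2_eq_square)
  have xu: "mink x' u' = mink x u + t * k"
    by (simp add: x'_def u'_def mink_simps m v algebra_simps)
  have "0 < 1 + k\<^sup>2" by (simp add: add_pos_nonneg)
  then have "mink x' x' < 0" using xx by simp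
  moreover have "mink x' x < 0"
    using \<open>0 < 1 + k\<^sup>2\<close> by (simp add: x'_def mink_simps m H2_D(1)[OF x(1)] power2_eq_square)
  ultimately have x3: "x'$3 > 0"
    using future_if_mink_neg[of x' x] H2_D[OF x(1)] by auto
  have u3: "u'$3 > 0" using u v t by (simp add: u'_def add_pos_pos)
  have "sqrt (- mink x' x') * sqrt (- mink u' u') \<le> - mink x' u'"
    using \<open>mink x' x' < 0\<close> uu u(4) x3 u3 m by (intro reverse_cauchy_schwarz) auto
  then have "sqrt (1 + k\<^sup>2) * sqrt (\<tau> + t\<^sup>2) \<le> - (mink x u + t * k)"
    unfolding xx uu xu minus_minus .
  moreover have "sqrt (\<tau> + t\<^sup>2) \<le> sqrt (1 + k\<^sup>2) * sqrt (\<tau> + t\<^sup>2)"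
    using u(4) m by (simp add: mult_le_cancel_right1)
  moreover have "t * k \<ge> 0" using t k by simp
  ultimately have "sqrt (\<tau> + t\<^sup>2) \<le> - mink x u" by linarith
  then show ?thesis by (simp add: t_def)
qed

lemma add_inverse_mono:
  fixes a b :: real
  assumes "1 \<le> a" "a \<le> b"
  shows "a + 1 / a \<le> b + 1 / b"
proof -
  have "b + 1 / b - (a + 1 / a) = (b - a) * (a * b - 1) / (a * b)"
    using assms by (simp add: field_simps)
  moreover have "1 \<le> a * b" using assms mult_mono[of 1 a 1 b] by simp
  ultimately have "0 \<le> b + 1 / b - (a + 1 / a)" using assms by simp
  then show ?thesis by simp
qed

lemma horodisk_bound:
  assumes w: "mink w w = 0" "w$3 > 0" and x: "x \<in> H2" "- mink x w \<le> 1"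
    and u: "u \<in> H2" "1 \<le> n" "n \<le> - mink u w"
  shows "(n + 1 / n) / 2 \<le> - mink x u"
proof -
  define k where "k = - mink x w"
  define m where "m = - mink u w"
  define y where "y = (1 / m) *\<^sub>R u - (1 / k) *\<^sub>R x"
  have k: "0 < k" "k \<le> 1"
    using mink_future_neg[of x w] H2_D[OF x(1)] w x by (auto simp: k_def)
  have m: "n \<le> m" "0 < m" using u by (auto simp: m_def)
  have "mink y w = 0" using k m unfolding y_def mink_simps by (simp add: k_def m_def)
  then have "0 \<le> mink y y" using orth_null_nonneg w by blast
  also have "mink y y = - 1 / m\<^sup>2 - 1 / k\<^sup>2 - 2 * mink x u / (k * m)"
    by (simp add: y_def mink_simps H2_D(1)[OF x(1)] H2_D(1)[OF u(1)] mink_commute[of u x]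
        power2_eq_square algebra_simps)
  finally have "0 \<le> (- 1 / m\<^sup>2 - 1 / k\<^sup>2 - 2 * mink x u / (k * m)) * (k * m)"
    using k m by (simp add: mult_nonneg_nonneg)
  also have "\<dots> = - (k / m) - m / k - 2 * mink x u"
    using k m by (simp add: field_simps power2_eq_square)
  \<comment> \<open>\<open>m / k\<close> plays the role of \<open>exp d\<close> in
    \<open>2 * cosh d = exp d + exp (- d)\<close>. It is at least \<open>n\<close> because
    \<open>k \<le> 1\<close>, the point \<open>x\<close> lying in the horodisk.\<close>
  finally have "m / k + 1 / (m / k) \<le> - 2 * mink x u" by simp
  moreover have "n \<le> m / k"
    using k m u mult_mono[of k 1 n m] by (simp add: pos_le_divide_eq mult.commute)
  ultimately show ?thesis using add_inverse_mono[OF u(2)] by fastforce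
qed

text \<open>\<open>y\<close> is the projection of \<open>x\<close> to the complement of the plane
  spanned by \<open>u\<close> and \<open>w\<close>. Being orthogonal to the light-like
  \<open>u\<close> it has nonnegative norm, and this norm is
  \<open>2 * (mink x u * mink x w) / s - 1\<close>.\<close>

lemma null_null_bound:
  assumes u: "mink u u = 0" "u$3 > 0" and w: "mink w w = 0" and x: "x \<in> H2" and t: "mink u w < 0"
  shows "- mink u w \<le> 2 * (mink x u * mink x w)"
proof -
  define s where "s = - mink u w"
  define y where "y = x + (mink x w / s) *\<^sub>R u + (mink x u / s) *\<^sub>R w"
  have s: "s > 0" "mink u w = - s" "mink w u = - s" using t by (auto simp: s_def mink_commute)
  have "mink y u = 0" using s by (simp add: y_def mink_simps u)
  then have "0 \<le> mink y y" using orth_null_nonneg u by blast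
  also have "mink y y = 2 * (mink x u * mink x w) / s - 1"
    using s by (simp add: y_def mink_simps u w H2_D(1)[OF x] mink_commute[of u x] mink_commute[of w x] field_simps)
  finally show ?thesis using s by (simp add: field_simps)
qed

text \<open>The infimum is attained at \<open>(x0, y0)\<close>; \<open>1 \<le> c\<close> puts all
  arguments into the range where \<open>arcosh\<close> is increasing.\<close>

lemma hsetdist_eqI:
  assumes "x0 \<in> A" "y0 \<in> B" "- mink x0 y0 = c" "1 \<le> c"
    and "\<And>x y. x \<in> A \<Longrightarrow> y \<in> B \<Longrightarrow> c \<le> - mink x y"
  shows "hsetdist A B = arcosh c"
  unfolding hsetdist_def
proof (rule cInf_eq_minimum)
  show "arcosh c \<in> {hdist x y |x y. x \<in> A \<and> y \<in> B}"
    using assms(1-3) unfolding hdist_def by blast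
  fix d assume "d \<in> {hdist x y |x y. x \<in> A \<and> y \<in> B}"
  then obtain x y where "x \<in> A" "y \<in> B" "d = arcosh (- mink x y)" by (auto simp: hdist_def)
  moreover from this have "c \<le> - mink x y" using assms by blast
  moreover have "arcosh c \<le> arcosh e" if "c \<le> e" for e
    using that assms(4) arcosh_real_strict_mono[of c e] by (auto simp: le_less)
  ultimately show "arcosh c \<le> d" by blast
qed

lemma hdist_commute: "hdist x y = hdist y x"
  by (simp add: hdist_def mink_commute)

lemma hsetdist_commute: "hsetdist A B = hsetdist B A"
proof -
  have "{hdist x y |x y. x \<in> A \<and> y \<in> B} = {hdist y x |x y. x \<in> B \<and> y \<in> A}" by blast
  also have "\<dots> = {hdist x y |x y. x \<in> B \<and> y \<in> A}"
    by (simp add: hdist_commute)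
  finally show ?thesis by (simp add: hsetdist_def)
qed

lemma glen_commute: "glen \<sigma> \<tau> u v = glen \<tau> \<sigma> v u"
  unfolding glen_def by (simp add: hsetdist_commute Int_commute hdist_commute)

section \<open>Points where the sides meet the boundaries of the vertex sets\<close>

lemma bpt_point: "u \<in> H2 \<Longrightarrow> bpt 1 u v = u"
  unfolding bpt_def bdryB_def geod_def
proof (rule the_equality)
  assume "u \<in> H2"
  moreover have "u = 1 *\<^sub>R u + 0 *\<^sub>R v" by simp
  ultimately show "u \<in> (if 1 = (1::int) then {u}
      else if 1 = (0::int) then {x \<in> H2. - mink x u = 1} else {x \<in> H2. mink x u = 0}) \<inter>
     {x \<in> H2. \<exists>a b. x = a *\<^sub>R u + b *\<^sub>R v}"
    by (simp del: scaleR_one scaleR_zero_left add_0_right) blast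
qed simp

text \<open>In terms of \<open>u\<close> and \<open>v\<close> the equation
  \<open>mink p u = -1\<close> fixes the coefficient \<open>1 / t\<close> of \<open>v\<close>, after
  which \<open>mink p p = -1\<close> is linear in the coefficient of \<open>u\<close>. The point is
  unique without a choice of sign.\<close>

lemma bpt_ideal:
  assumes u: "mink u u = 0" "u$3 > 0" and v: "mink v v = - \<tau>" and t: "t = - mink u v" "0 < t"
  defines "p \<equiv> ((1 - \<tau> / t\<^sup>2) / 2) *\<^sub>R u + (1 / t) *\<^sub>R v"
  shows "bpt 0 u v = p" "bpt 0 u v \<in> H2" "mink (bpt 0 u v) u = -1"
proof -
  define c where "c = 1 / t"
  have c: "t * c = 1" "c * t = 1" using t by (auto simp: c_def)
  have pc: "p = ((1 - \<tau> * c\<^sup>2) / 2) *\<^sub>R u + c *\<^sub>R v"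
    by (simp add: p_def c_def power_divide)
  have m: "mink u v = - t" "mink v u = - t" using t by (auto simp: mink_commute)
  have pu: "mink p u = -1" using c by (simp add: pc mink_simps u m)
  have "mink p p = - (1 - \<tau> * c\<^sup>2) * (c * t) - \<tau> * c\<^sup>2"
    by (simp add: pc mink_simps u m v power2_eq_square algebra_simps)
  then have pp: "mink p p = -1" using c by simp
  have p: "p \<in> H2"
    using future_if_mink_neg[of p u] pp pu u by (auto simp: H2_def)
  show eq: "bpt 0 u v = p"
    unfolding bpt_def
  proof (rule the_equality)
    show "p \<in> bdryB 0 u \<inter> geod u v"
      using p pu unfolding bdryB_def geod_def p_def by auto
    fix x assume "x \<in> bdryB 0 u \<inter> geod u v"
    then obtain a b where x: "x = a *\<^sub>R u + b *\<^sub>R v" "mink x x = -1" "mink x u = -1"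
      by (auto simp: bdryB_def geod_def H2_def)
    have "b * t = 1" using x(3) by (simp add: x(1) mink_simps u m)
    then have b: "b = c" using t by (simp add: c_def field_simps)
    have "- b\<^sup>2 * \<tau> - 2 * a * (b * t) = -1"
      using x(2) by (simp add: x(1) mink_simps u m v power2_eq_square algebra_simps)
    then have "a = (1 - \<tau> * c\<^sup>2) / 2" unfolding b c(2) by (simp add: algebra_simps)
    with b show "x = p" by (simp add: x(1) pc)
  qed
  show "bpt 0 u v \<in> H2" "mink (bpt 0 u v) u = -1" using p pu eq by simp_all
qed

text \<open>\<open>t *\<^sub>R u + v\<close> is the projection of \<open>v\<close> to the polar
  plane of \<open>u\<close> and has norm \<open>- (\<tau> + t^2)\<close>. Normalizing leaves a sign
  open, and \<open>fut\<close> selects the upper sheet.\<close>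

lemma bpt_hyperideal:
  assumes u: "mink u u = 1" and v: "mink v v = - \<tau>" and t: "t = - mink u v" "0 < \<tau> + t\<^sup>2"
    and fut: "t * u$3 + v$3 > 0"
  defines "p \<equiv> (1 / sqrt (\<tau> + t\<^sup>2)) *\<^sub>R (t *\<^sub>R u + v)"
  shows "bpt (-1) u v = p" "bpt (-1) u v \<in> H2" "mink (bpt (-1) u v) u = 0"
proof -
  have m: "mink u v = - t" "mink v u = - t" using t by (auto simp: mink_commute)
  have nn: "mink (t *\<^sub>R u + v) (t *\<^sub>R u + v) = - (\<tau> + t\<^sup>2)"
    by (simp add: mink_simps u v m power2_eq_square)
  define N where "N = sqrt (\<tau> + t\<^sup>2)"
  have N: "N > 0" "N\<^sup>2 = \<tau> + t\<^sup>2" using t by (auto simp: N_def)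
  have pu: "mink p u = 0" by (simp add: p_def mink_simps u m)
  have pp: "mink p p = -1"
    unfolding p_def mink_scaleR_left mink_scaleR_right nn
    unfolding N_def[symmetric] N(2)[symmetric] using N(1) by (simp add: power2_eq_square)
  have p: "p \<in> H2"
    using pp fut t by (simp add: H2_def p_def)
  show eq: "bpt (-1) u v = p"
    unfolding bpt_def
  proof (rule the_equality)
    have "p = (1 / N * t) *\<^sub>R u + (1 / N) *\<^sub>R v" by (simp add: p_def N_def scaleR_add_right)
    then show "p \<in> bdryB (-1) u \<inter> geod u v"
      using p pu unfolding bdryB_def geod_def by auto
    fix x assume "x \<in> bdryB (-1) u \<inter> geod u v"
    then obtain a b where x: "x = a *\<^sub>R u + b *\<^sub>R v" "mink x x = -1" "mink x u = 0" "x$3 > 0"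
      by (auto simp: bdryB_def geod_def H2_def)
    have a: "a = b * t" using x(3) by (simp add: x(1) mink_simps u m)
    then have xb: "x = b *\<^sub>R (t *\<^sub>R u + v)" by (simp add: x(1) algebra_simps)
    have "b * (b * (\<tau> + t\<^sup>2)) = 1" 
      using x(2) unfolding xb mink_scaleR_left mink_scaleR_right nn mult_minus_right by linarith
    then have "(b * N)\<^sup>2 = 1" by (simp add: power_mult_distrib N power2_eq_square[of b] mult.assoc)
    moreover have "b * (t * u$3 + v$3) > 0" using x(4) by (simp add: xb)
    then have "b > 0" using fut by (simp add: zero_less_mult_iff)
    then have "0 < b * N" using N by simp
    ultimately have "b * N = 1" by (auto simp: power2_eq_1_iff)
    then have "b = 1 / N" using N by (simp add: field_simps)
    then show "x = p" by (simp add: xb p_def N_def)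
  qed
  show "bpt (-1) u v \<in> H2" "mink (bpt (-1) u v) u = 0" using p pu eq by simp_all
qed

text \<open>The left argument is \<open>cosh (ln t)\<close>. The absolute value lets both branches
  of \<open>glen\<close> combine to one logarithm: it is the distance while positive, and minus the
  distance otherwise.\<close>

lemma arcosh_avg_inverse:
  assumes "0 < (t::real)"
  shows "arcosh ((t + 1 / t) / 2) = \<bar>ln t\<bar>"
proof -
  have "(t + 1 / t) / 2 = cosh \<bar>ln t\<bar>"
    using assms by (simp add: cosh_ln_real inverse_eq_divide abs_if)
  then show ?thesis by (simp only: arcosh_cosh_real[OF abs_ge_zero])
qed

lemma avg_inverse_ge_1:
  assumes "0 < (t::real)"
  shows "1 \<le> (t + 1 / t) / 2"
  using cosh_real_ge_1[of "ln t"] assms by (simp add: cosh_ln_real inverse_eq_divide)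

section \<open>Generalized lengths as functions of the Minkowski product\<close>

lemma Bset_simps:
  "Bset 1 w = {w}"
  "Bset 0 w = {x \<in> H2. - mink x w \<le> 1}"
  "Bset (-1) w = {x \<in> H2. mink x w \<ge> 0}"
  by (simp_all add: Bset_def)

lemma glen_point_point:
  assumes "u \<in> H2" "v \<in> H2" "u \<noteq> v"
  shows "glen 1 1 u v = arcosh (- mink u v)"
proof -
  have "hsetdist {u} {v} = arcosh (- mink u v)"
    by (rule hsetdist_eqI) (use H2_mink_ge_1[OF assms(1,2)] in auto)
  then show ?thesis using assms by (simp add: glen_def Bset_simps)
qed

text \<open>\<open>u\<close> lies outside the horodisk precisely if \<open>t > 1\<close>. In either
  case the relevant distance is \<open>\<bar>ln t\<bar>\<close>, attained where the horocycle meets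
  the side, and its sign in \<open>glen\<close> is that of \<open>ln t\<close>.\<close>

lemma glen_point_ideal:
  assumes u: "u \<in> H2" and w: "mink w w = 0" "w$3 > 0" and t: "t = - mink u w"
  shows "glen 1 0 u w = ln t"
proof -
  have t0: "t > 0" using mink_future_neg[of u w] H2_D[OF u] w t by simp
  note p = bpt_ideal[OF w, of u 1 t, unfolded mink_commute[of w u], OF H2_D(1)[OF u] t t0]
  define c where "c = 1 / t"
  have ct: "c * t = 1" using t0 by (simp add: c_def)
  have m: "mink u w = - t" using t by simp
  have up: "- mink u (bpt 0 w u) = (t + 1 / t) / 2"
  proof -
    have "- mink u (bpt 0 w u) = (1 - c\<^sup>2) / 2 * t + c"
      unfolding p(1) mink_simps m H2_D(1)[OF u] by (simp add: c_def power_divide)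
    also have "\<dots> = (t - c * (c * t)) / 2 + c" by (simp add: power2_eq_square algebra_simps)
    also have "\<dots> = (t + c) / 2" unfolding ct by (simp add: field_simps)
    finally show ?thesis by (simp add: c_def)
  qed
  have mem: "bpt 0 w u \<in> Bset 0 w" using p by (simp add: Bset_simps)
  show ?thesis
  proof (cases "t > 1")
    case True
    have "hsetdist {u} (Bset 0 w) = arcosh ((t + 1 / t) / 2)"
    proof (rule hsetdist_eqI[OF _ mem up avg_inverse_ge_1[OF t0]])
      fix x y assume "x \<in> {u}" "y \<in> Bset 0 w"
      then show "(t + 1 / t) / 2 \<le> - mink x y"
        using horodisk_bound[OF w, of y u t] u True t by (simp add: Bset_simps mink_commute[of y u])
    qed simp
    moreover have "Bset 1 u \<inter> Bset 0 w = {}" using True t by (auto simp: Bset_simps)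
    ultimately show ?thesis
      using True by (simp add: glen_def Bset_simps(1) arcosh_avg_inverse)
  next
    case False
    then have "u \<in> Bset 1 u \<inter> Bset 0 w" using u t by (simp add: Bset_simps)
    then have "glen 1 0 u w = - hdist u (bpt 0 w u)"
      unfolding glen_def bpt_point[OF u] by auto
    also have "\<dots> = - \<bar>ln t\<bar>" unfolding hdist_def up using t0 by (simp add: arcosh_avg_inverse)
    finally show ?thesis using False t0 by simp
  qed
qed

text \<open>For \<open>t \<le> 0\<close> the point lies in the half-plane, and only the sign of the
  length is recorded: \<open>J (-1)\<close> consists of positive numbers, so the sign already
  excludes such a side.\<close>

lemma glen_point_hyperideal:
  assumes u: "u \<in> H2" and v: "mink v v = 1" "v$3 > 0" and t: "t = - mink u v"
  shows "0 < t \<Longrightarrow> glen 1 (-1) u v = arsinh t" "t \<le> 0 \<Longrightarrow> glen 1 (-1) u v \<le> 0"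
proof -
  have pos: "0 < 1 + t\<^sup>2" by (simp add: add_pos_nonneg)
  have m: "mink u v = - t" "mink v u = - t" using t by (auto simp: mink_commute)
  have "mink (t *\<^sub>R v + u) (t *\<^sub>R v + u) = - (1 + t\<^sup>2)"
    by (simp add: mink_simps m v H2_D(1)[OF u] power2_eq_square)
  moreover have "mink (t *\<^sub>R v + u) u = - (1 + t\<^sup>2)"
    by (simp add: mink_simps m H2_D(1)[OF u] power2_eq_square)
  ultimately have "(t *\<^sub>R v + u)$3 > 0"
    using future_if_mink_neg[of "t *\<^sub>R v + u" u] H2_D[OF u] pos by simp
  then have fut: "t * v$3 + u$3 > 0" by simp
  have tv: "t = - mink v u" using m by simp
  note p = bpt_hyperideal[OF v(1) H2_D(1)[OF u] tv pos fut]
  have mem: "bpt (-1) v u \<in> Bset (-1) v" using p by (simp add: Bset_simps)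
  have up: "- mink u (bpt (-1) v u) = sqrt (1 + t\<^sup>2)"
  proof -
    define c where "c = 1 / sqrt (1 + t\<^sup>2)"
    have "- mink u (bpt (-1) v u) = (1 + t\<^sup>2) * c"
      unfolding p(1) c_def[symmetric] mink_simps m H2_D(1)[OF u] by (simp add: power2_eq_square algebra_simps)
    then show ?thesis using pos by (simp add: c_def real_div_sqrt)
  qed
  show "glen 1 (-1) u v = arsinh t" if "0 < t"
  proof -
    have ge1: "1 \<le> sqrt (1 + t\<^sup>2)" by simp
    have "hsetdist {u} (Bset (-1) v) = arcosh (sqrt (1 + t\<^sup>2))"
    proof (rule hsetdist_eqI[OF _ mem up ge1])
      fix x y assume "x \<in> {u}" "y \<in> Bset (-1) v"
      then show "sqrt (1 + t\<^sup>2) \<le> - mink x y"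
        using halfplane_bound[OF v, of y u 1] H2_D[OF u] that pos
        by (simp add: Bset_simps mink_commute[of y u] m)
    qed simp
    moreover have "Bset 1 u \<inter> Bset (-1) v = {}" using that m by (auto simp: Bset_simps)
    moreover have "arcosh (sqrt (1 + t\<^sup>2)) = arsinh t"
      using arcosh_cosh_real[OF less_imp_le[OF arsinh_real_pos_iff[THEN iffD2, OF that]]]
      by (simp add: cosh_arsinh_real add.commute)
    ultimately show ?thesis by (simp add: glen_def Bset_simps(1))
  qed
  show "glen 1 (-1) u v \<le> 0" if "t \<le> 0"
  proof -
    have "u \<in> Bset 1 u \<inter> Bset (-1) v" using u m that by (simp add: Bset_simps)
    then have "glen 1 (-1) u v = - hdist u (bpt (-1) v u)"
      unfolding glen_def bpt_point[OF u] by auto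
    then show ?thesis using hdist_nonneg[OF u p(2)] by simp
  qed
qed

text \<open>The horodisks are tangent at \<open>t = 2\<close>, which explains \<open>t / 2\<close>.
  On the first horodisk \<open>null_null_bound\<close> gives \<open>t / 2 \<le> - mink x w\<close>,
  and this reduces the distance to the one between a point and a horodisk.\<close>

lemma glen_ideal_ideal:
  assumes u: "mink u u = 0" "u$3 > 0" and w: "mink w w = 0" "w$3 > 0"
    and t: "t = - mink u w" "0 < t"
  shows "glen 0 0 u w = ln (t / 2)"
proof -
  have m: "mink u w = - t" "mink w u = - t" using t by (auto simp: mink_commute)
  have z: "mink w w = - 0" "mink u u = - 0" using u w by simp_all
  have tw: "t = - mink w u" using m by simp
  note p = bpt_ideal[OF u z(1) t] and q = bpt_ideal[OF w z(2) tw t(2)]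
  have pq: "- mink (bpt 0 u w) (bpt 0 w u) = (t / 2 + 1 / (t / 2)) / 2"
    unfolding p(1) q(1) mink_simps m u w using t by (simp add: field_simps)
  have mem: "bpt 0 u w \<in> Bset 0 u" "bpt 0 w u \<in> Bset 0 w"
    using p q by (simp_all add: Bset_simps)
  have t2: "0 < t / 2" using t by simp
  have key: "t / 2 \<le> - mink x w" if "x \<in> Bset 0 u" for x
  proof -
    have x: "x \<in> H2" "- mink x u \<le> 1" using that by (auto simp: Bset_simps)
    have neg: "mink x u < 0" "mink x w < 0"
      using mink_future_neg[of x] H2_D[OF x(1)] u w by auto
    have "t \<le> 2 * (mink x u * mink x w)"
      using null_null_bound[OF u w(1) x(1)] t by simp
    also have "mink x u * mink x w \<le> 1 * (- mink x w)"
      using x neg mult_right_mono[of "- mink x u" 1 "- mink x w"] by simp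
    finally show ?thesis by simp
  qed
  show ?thesis
  proof (cases "t > 2")
    case True
    have "hsetdist (Bset 0 u) (Bset 0 w) = arcosh ((t / 2 + 1 / (t / 2)) / 2)"
    proof (rule hsetdist_eqI[OF mem pq avg_inverse_ge_1[OF t2]])
      fix x y assume "x \<in> Bset 0 u" "y \<in> Bset 0 w"
      then show "(t / 2 + 1 / (t / 2)) / 2 \<le> - mink x y"
        using horodisk_bound[OF w, of y x "t / 2"] key[of x] True
        by (simp add: Bset_simps mink_commute[of y x])
    qed
    moreover have "Bset 0 u \<inter> Bset 0 w = {}" using True key by (fastforce simp: Bset_simps)
    ultimately show ?thesis
      using True by (simp add: glen_def arcosh_avg_inverse[OF t2, simplified])
  next
    case False
    \<comment> \<open>\<open>u + w\<close> has norm \<open>- 2 * t\<close>, so \<open>x\<close> is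
      the normalized midpoint. Its product with \<open>u\<close> and with \<open>w\<close> is
      \<open>- sqrt (t / 2)\<close>, and it lies in both horodisks when
      \<open>t \<le> 2\<close>.\<close>
    define c where "c = 1 / sqrt (2 * t)"
    have c: "c > 0" "c * c * (2 * t) = 1" using t by (auto simp: c_def)
    define x where "x = c *\<^sub>R (u + w)"
    have "mink x x = - (c * c * (2 * t))" by (simp add: x_def mink_simps m u w algebra_simps)
    then have xx: "mink x x = -1" using c by simp
    have xH: "x \<in> H2" using xx c u w by (simp add: H2_def) (simp add: x_def)
    have "c * t \<le> 1"
    proof (rule power2_le_imp_le)
      have "(c * t)\<^sup>2 = (c * c * (2 * t)) * (t / 2)" by (simp add: power2_eq_square)
      then show "(c * t)\<^sup>2 \<le> 1\<^sup>2" using c False by simp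
    qed simp
    then have "x \<in> Bset 0 u \<inter> Bset 0 w" using xH by (simp add: Bset_simps) (simp add: x_def mink_simps m u w)
    then have "glen 0 0 u w = - hdist (bpt 0 u w) (bpt 0 w u)" unfolding glen_def by auto
    also have "\<dots> = - \<bar>ln (t / 2)\<bar>" unfolding hdist_def pq arcosh_avg_inverse[OF t2] ..
    finally show ?thesis using False t by simp
  qed
qed

lemma glen_ideal_hyperideal:
  assumes u: "mink u u = 0" "u$3 > 0" and v: "mink v v = 1" "v$3 > 0"
    and t: "t = - mink u v" "0 < t"
  shows "glen 0 (-1) u v = ln t"
proof -
  have m: "mink u v = - t" "mink v u = - t" using t by (auto simp: mink_commute)
  have z: "mink v v = - (-1)" "mink u u = - 0" using u v by simp_all
  have tv: "t = - mink v u" using m by simp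
  have pos: "0 < 0 + t\<^sup>2" using t by simp
  have fut: "t * v$3 + u$3 > 0" using t(2) u(2) v(2) by (simp add: add_pos_pos)
  note p = bpt_ideal[OF u z(1) t] and q = bpt_hyperideal[OF v(1) z(2) tv pos fut]
  define c where "c = 1 / t"
  have ct: "c * t = 1" "t * c = 1" using t by (auto simp: c_def)
  have pc: "bpt 0 u v = ((1 + c\<^sup>2) / 2) *\<^sub>R u + c *\<^sub>R v"
    unfolding p(1) by (simp add: c_def power_divide)
  have qc: "bpt (-1) v u = v + c *\<^sub>R u"
    unfolding q(1) using t(2) by (simp add: c_def scaleR_add_right)
  have pq: "- mink (bpt 0 u v) (bpt (-1) v u) = (t + 1 / t) / 2"
  proof -
    have "- mink (bpt 0 u v) (bpt (-1) v u) = (1 + c\<^sup>2) / 2 * t - c * (1 - c * t)"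
      unfolding pc qc mink_simps m u v
      by (simp add: algebra_simps add_divide_distrib diff_divide_distrib)
    also have "\<dots> = (t + c * (c * t)) / 2 - c * (1 - c * t)"
      by (simp add: power2_eq_square algebra_simps)
    finally show ?thesis unfolding ct by (simp add: c_def)
  qed
  have mem: "bpt 0 u v \<in> Bset 0 u" "bpt (-1) v u \<in> Bset (-1) v"
    using p q by (simp_all add: Bset_simps)
  have key: "t \<le> - mink y u" if "y \<in> Bset (-1) v" for y
    using halfplane_bound[OF v, of y u 0] that u t(2) by (simp add: Bset_simps m)
  show ?thesis
  proof (cases "t > 1")
    case True
    have "hsetdist (Bset 0 u) (Bset (-1) v) = arcosh ((t + 1 / t) / 2)"
    proof (rule hsetdist_eqI[OF mem pq avg_inverse_ge_1[OF t(2)]])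
      fix x y assume "x \<in> Bset 0 u" "y \<in> Bset (-1) v"
      then show "(t + 1 / t) / 2 \<le> - mink x y"
        using horodisk_bound[OF u, of x y t] key[of y] True by (simp add: Bset_simps)
    qed
    moreover have "Bset 0 u \<inter> Bset (-1) v = {}" using True key by (fastforce simp: Bset_simps)
    ultimately show ?thesis
      using True by (simp add: glen_def arcosh_avg_inverse)
  next
    case False
    \<comment> \<open>The foot \<open>v + c *\<^sub>R u\<close> on the polar line has product
      \<open>- t\<close> with \<open>u\<close>, so it belongs to the horodisk once
      \<open>t \<le> 1\<close>.\<close>
    have "bpt (-1) v u \<in> Bset 0 u \<inter> Bset (-1) v"
      using mem q(2) False by (simp add: Bset_simps) (simp add: qc mink_simps m u)
    then have "glen 0 (-1) u v = - hdist (bpt 0 u v) (bpt (-1) v u)" unfolding glen_def by auto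
    also have "\<dots> = - \<bar>ln t\<bar>" unfolding hdist_def pq arcosh_avg_inverse[OF t(2)] ..
    finally show ?thesis using False t by simp
  qed
qed

text \<open>\<open>halfplane_bound\<close> is used twice: with \<tau> = -1 it bounds the product of
  a point \<open>x\<close> of the first half-plane with \<open>v\<close>; with \<tau> = 1 it then
  bounds the product of \<open>x\<close> with the points of the second one. The two roots compose as
  \<open>sqrt (1 + (t^2 - 1)) = t\<close>.\<close>

lemma glen_hyperideal_hyperideal:
  assumes u: "mink u u = 1" "u$3 > 0" and v: "mink v v = 1" "v$3 > 0"
    and t: "t = - mink u v" "1 < t"
  shows "glen (-1) (-1) u v = arcosh t"
proof -
  have m: "mink u v = - t" "mink v u = - t" using t by (auto simp: mink_commute)
  have z: "mink v v = - (-1)" "mink u u = - (-1)" using u v by simp_all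
  have tv: "t = - mink v u" using m by simp
  have t1: "1 < t\<^sup>2" using t(2) by (simp add: one_less_power)
  then have pos: "0 < -1 + t\<^sup>2" by simp
  have fut: "t * v$3 + u$3 > 0" "t * u$3 + v$3 > 0" using t(2) u(2) v(2) by (simp_all add: add_pos_pos)
  note p = bpt_hyperideal[OF u(1) z(1) t(1) pos fut(2)] and q = bpt_hyperideal[OF v(1) z(2) tv pos fut(1)]
  define c where "c = 1 / sqrt (-1 + t\<^sup>2)"
  have c: "c * c * (t\<^sup>2 - 1) = 1" using pos by (simp add: c_def)
  have pq: "- mink (bpt (-1) u v) (bpt (-1) v u) = t"
  proof -
    have "- mink (bpt (-1) u v) (bpt (-1) v u) = c * c * (t\<^sup>2 - 1) * t"
      unfolding p(1) q(1) c_def[symmetric] mink_simps m u v by (simp add: power2_eq_square algebra_simps)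
    then show ?thesis using c by simp
  qed
  have mem: "bpt (-1) u v \<in> Bset (-1) u" "bpt (-1) v u \<in> Bset (-1) v"
    using p q by (simp_all add: Bset_simps)
  have key: "sqrt (-1 + t\<^sup>2) \<le> - mink x v" if "x \<in> Bset (-1) u" for x
    using halfplane_bound[OF u, of x v "-1"] that v t(2) t1 by (simp add: Bset_simps m)
  have s0: "sqrt (-1 + t\<^sup>2) > 0" using pos by simp
  have "hsetdist (Bset (-1) u) (Bset (-1) v) = arcosh t"
  proof (rule hsetdist_eqI[OF mem pq])
    fix x y assume xy: "x \<in> Bset (-1) u" "y \<in> Bset (-1) v"
    have xH: "x \<in> H2" using xy by (simp add: Bset_simps)
    have neg: "mink x v < 0" using key[OF xy(1)] s0 by linarith
    have "sqrt (1 + (mink x v)\<^sup>2) \<le> - mink y x"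
      using halfplane_bound[OF v, of y x 1] xy(2) H2_D[OF xH] neg by (simp add: Bset_simps add_pos_nonneg)
    moreover have "t \<le> sqrt (1 + (mink x v)\<^sup>2)"
    proof (rule real_le_rsqrt)
      have "(sqrt (-1 + t\<^sup>2))\<^sup>2 \<le> (- mink x v)\<^sup>2"
        using key[OF xy(1)] s0 by (intro power_mono) auto
      then show "t\<^sup>2 \<le> 1 + (mink x v)\<^sup>2" using pos by simp
    qed
    ultimately show "t \<le> - mink x y" by (simp add: mink_commute[of y x])
  qed (use t in simp)
  moreover have "Bset (-1) u \<inter> Bset (-1) v = {}"
  proof (rule equals0I)
    fix x assume "x \<in> Bset (-1) u \<inter> Bset (-1) v"
    then have "sqrt (-1 + t\<^sup>2) \<le> - mink x v" "0 \<le> mink x v"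
      using key[of x] by (auto simp: Bset_simps)
    then show False using s0 by linarith
  qed
  ultimately show ?thesis by (simp add: glen_def)
qed

section \<open>Generalized angles as functions of the Minkowski products\<close>

lemma gangle_point:
  assumes w: "mink w w = -1" and u: "mink u u = - \<tau>" and v: "mink v v = - \<tau>'"
  shows "gangle 1 w u v = arccos ((mink w u * mink w v + mink u v) /
    sqrt (((mink w u)\<^sup>2 - \<tau>) * ((mink w v)\<^sup>2 - \<tau>')))"
proof -
  have "mink (u + mink u w *\<^sub>R w) (v + mink v w *\<^sub>R w) = mink w u * mink w v + mink u v"
    by (simp add: mink_simps w mink_commute[of u w] mink_commute[of v w])
  moreover have "mink (u + mink u w *\<^sub>R w) (u + mink u w *\<^sub>R w) = (mink w u)\<^sup>2 - \<tau>"
    by (simp add: mink_simps w u mink_commute[of u w] power2_eq_square)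
  moreover have "mink (v + mink v w *\<^sub>R w) (v + mink v w *\<^sub>R w) = (mink w v)\<^sup>2 - \<tau>'"
    by (simp add: mink_simps w v mink_commute[of v w] power2_eq_square)
  ultimately show ?thesis by (simp add: gangle_def Let_def)
qed

lemma horo_arclen_eq:
  assumes "x \<in> H2" "y \<in> H2"
  shows "horo_arclen x y = sqrt (2 * (- mink x y - 1))"
proof -
  define d where "d = hdist x y"
  have d: "cosh d = - mink x y" "d \<ge> 0"
    using H2_mink_ge_1[OF assms] hdist_nonneg[OF assms] by (simp_all add: d_def hdist_def)
  have "cosh (2 * (d / 2)) = 2 * (cosh (d / 2))\<^sup>2 - 1" by (rule cosh_double_cosh)
  then have "(2 * sinh (d / 2))\<^sup>2 = 2 * (cosh d - 1)"
    by (simp add: power_mult_distrib sinh_square_eq)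
  moreover have "0 \<le> 2 * sinh (d / 2)" using d by simp
  ultimately have "2 * sinh (d / 2) = sqrt (2 * (cosh d - 1))"
    by (metis real_sqrt_abs abs_of_nonneg)
  then show ?thesis by (simp add: horo_arclen_def d_def[symmetric] d)
qed

lemma gangle_ideal:
  assumes w: "mink w w = 0" "w$3 > 0" and u: "mink u u = - \<tau>" and v: "mink v v = - \<tau>'"
    and p: "p = - mink w u" "0 < p" and q: "q = - mink w v" "0 < q" and m: "m = - mink u v"
  shows "gangle 0 w u v = 2 * sqrt (2 * m / (p * q) - \<tau> / p\<^sup>2 - \<tau>' / q\<^sup>2)"
proof -
  note P = bpt_ideal[OF w u p] and Q = bpt_ideal[OF w v q]
  have mm: "mink w u = - p" "mink u w = - p" "mink w v = - q" "mink v w = - q" "mink u v = - m"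
    using p q m by (auto simp: mink_commute)
  define c d where "c = 1 / p" and "d = 1 / q"
  have cd: "c * p = 1" "d * q = 1" using p q by (auto simp: c_def d_def)
  have Pc: "bpt 0 w u = ((1 - \<tau> * c\<^sup>2) / 2) *\<^sub>R w + c *\<^sub>R u"
    unfolding P(1) by (simp add: c_def power_divide)
  have Qd: "bpt 0 w v = ((1 - \<tau>' * d\<^sup>2) / 2) *\<^sub>R w + d *\<^sub>R v"
    unfolding Q(1) by (simp add: d_def power_divide)
  have "- mink (bpt 0 w u) (bpt 0 w v) =
      (1 - \<tau> * c\<^sup>2) / 2 * (d * q) + (1 - \<tau>' * d\<^sup>2) / 2 * (c * p) + c * d * m"
    unfolding Pc Qd mink_simps mm w by (simp add: algebra_simps add_divide_distrib diff_divide_distrib)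
  then have "2 * (- mink (bpt 0 w u) (bpt 0 w v) - 1) = 2 * m * (c * d) - \<tau> * c\<^sup>2 - \<tau>' * d\<^sup>2"
    unfolding cd by (simp add: field_simps)
  also have "\<dots> = 2 * m / (p * q) - \<tau> / p\<^sup>2 - \<tau>' / q\<^sup>2"
    by (simp add: c_def d_def power_divide)
  finally have "2 * (- mink (bpt 0 w u) (bpt 0 w v) - 1) = 2 * m / (p * q) - \<tau> / p\<^sup>2 - \<tau>' / q\<^sup>2" .
  then show ?thesis by (simp only: gangle_def horo_arclen_eq[OF P(2) Q(2)]) simp
qed

text \<open>\<open>P\<close> is the foot of the geodesic on the polar line of \<open>w\<close>, and
  \<open>a\<close> is \<open>sinh\<close> of the signed distance of \<open>x\<close> from that line.
  The positive root is forced because \<open>x\<close> and \<open>P\<close> lie on the same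
  sheet.\<close>

lemma geod_hyperideal:
  assumes w: "mink w w = 1" and P: "P \<in> H2" "mink w P = 0" and x: "x \<in> H2" "x = a *\<^sub>R w + b *\<^sub>R P"
  shows "x = a *\<^sub>R w + sqrt (1 + a\<^sup>2) *\<^sub>R P"
proof -
  have Pw: "mink P w = 0" using P by (simp add: mink_commute)
  have "mink x x = a * a - b * b" unfolding x(2) by (simp add: mink_simps w P Pw H2_D(1)[OF P(1)])
  then have "b\<^sup>2 = 1 + a\<^sup>2" using H2_D(1)[OF x(1)] by (simp add: power2_eq_square)
  moreover have "b > 0"
    using H2_mink_ge_1[OF x(1) P(1)] unfolding x(2) by (simp add: mink_simps P H2_D(1)[OF P(1)])
  ultimately have "b = sqrt (1 + a\<^sup>2)" by (metis real_sqrt_abs abs_of_pos)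
  then show ?thesis using x(2) by simp
qed

text \<open>The polar line of \<open>w\<close> is perpendicular to both sides, so their distance is
  attained at the feet \<open>P\<close> and \<open>Q\<close>. For points with parameters
  \<open>k\<close>, \<open>l\<close> the negated product is \<open>R * C - k * l\<close>, and
  \<open>(R - 1) * C \<ge> R - 1 \<ge> k * l\<close> shows that it is at least
  \<open>C\<close>.\<close>

lemma gangle_hyperideal:
  assumes w: "mink w w = 1" "w$3 > 0" and u: "mink u u = - \<tau>" "u$3 > 0" and v: "mink v v = - \<tau>'" "v$3 > 0"
    and p: "p = - mink w u" "0 < p" "0 < \<tau> + p\<^sup>2" and q: "q = - mink w v" "0 < q" "0 < \<tau>' + q\<^sup>2"
    and m: "m = - mink u v"
  shows "gangle (-1) w u v = arcosh ((p * q + m) / (sqrt (\<tau> + p\<^sup>2) * sqrt (\<tau>' + q\<^sup>2)))"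
    and "1 \<le> (p * q + m) / (sqrt (\<tau> + p\<^sup>2) * sqrt (\<tau>' + q\<^sup>2))"
proof -
  have fut: "p * w$3 + u$3 > 0" "q * w$3 + v$3 > 0" using p(2) q(2) w(2) u(2) v(2) by (simp_all add: add_pos_pos)
  define P Q where "P = bpt (-1) w u" and "Q = bpt (-1) w v"
  define M N where "M = sqrt (\<tau> + p\<^sup>2)" and "N = sqrt (\<tau>' + q\<^sup>2)"
  note P = bpt_hyperideal[OF w(1) u(1) p(1,3) fut(1), folded P_def M_def]
  note Q = bpt_hyperideal[OF w(1) v(1) q(1,3) fut(2), folded Q_def N_def]
  have MN: "M > 0" "N > 0" using p q by (auto simp: M_def N_def)
  have mm: "mink w u = - p" "mink u w = - p" "mink w v = - q" "mink v w = - q" "mink u v = - m"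
    using p q m by (auto simp: mink_commute)
  define C where "C = - mink P Q"
  have C: "C = (p * q + m) / (M * N)"
    unfolding C_def P(1) Q(1) mink_simps mm w(1) using MN by (simp add: field_simps)
  have C1: "1 \<le> C" unfolding C_def by (rule H2_mink_ge_1[OF P(2) Q(2)])
  then show "1 \<le> (p * q + m) / (sqrt (\<tau> + p\<^sup>2) * sqrt (\<tau>' + q\<^sup>2))" by (simp add: C M_def N_def)
  have uP: "u = M *\<^sub>R P - p *\<^sub>R w" using MN by (simp add: P(1))
  have vQ: "v = N *\<^sub>R Q - q *\<^sub>R w" using MN by (simp add: Q(1))
  have PQw: "mink w P = 0" "mink w Q = 0" "mink P w = 0" "mink Q w = 0"
    using P(3) Q(3) by (simp_all add: mink_commute)
  have "P = (1 / M * p) *\<^sub>R w + (1 / M) *\<^sub>R u" by (simp add: P(1) scaleR_add_right)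
  then have Pg: "P \<in> geod w u" using P(2) unfolding geod_def by blast
  have "Q = (1 / N * q) *\<^sub>R w + (1 / N) *\<^sub>R v" by (simp add: Q(1) scaleR_add_right)
  then have Qg: "Q \<in> geod w v" using Q(2) unfolding geod_def by blast
  have "hsetdist (geod w u) (geod w v) = arcosh C"
  proof (rule hsetdist_eqI[OF Pg Qg C_def[symmetric] C1])
    fix x y assume "x \<in> geod w u" "y \<in> geod w v"
    then obtain a b a' b' where x: "x \<in> H2" "x = a *\<^sub>R w + b *\<^sub>R u"
      and y: "y \<in> H2" "y = a' *\<^sub>R w + b' *\<^sub>R v" by (auto simp: geod_def)
    define k l where "k = a - b * p" and "l = a' - b' * q"
    have "x = k *\<^sub>R w + (b * M) *\<^sub>R P" by (simp add: x(2) uP k_def algebra_simps)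
    from geod_hyperideal[OF w(1) P(2) PQw(1) x(1) this]
    have x': "x = k *\<^sub>R w + sqrt (1 + k\<^sup>2) *\<^sub>R P" .
    have "y = l *\<^sub>R w + (b' * N) *\<^sub>R Q" by (simp add: y(2) vQ l_def algebra_simps)
    from geod_hyperideal[OF w(1) Q(2) PQw(2) y(1) this]
    have y': "y = l *\<^sub>R w + sqrt (1 + l\<^sup>2) *\<^sub>R Q" .
    define R where "R = sqrt (1 + k\<^sup>2) * sqrt (1 + l\<^sup>2)"
    have xy: "- mink x y = R * C - k * l"
      unfolding x' y' mink_simps PQw w(1) by (simp add: R_def C_def)
    have "1 + k * l \<le> R"
    proof (rule power2_le_imp_le)
      have "R\<^sup>2 = (1 + k\<^sup>2) * (1 + l\<^sup>2)" by (simp add: R_def power_mult_distrib)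
      also have "\<dots> = (1 + k * l)\<^sup>2 + (k - l)\<^sup>2" by (simp add: power2_eq_square algebra_simps)
      finally show "(1 + k * l)\<^sup>2 \<le> R\<^sup>2" by simp
      show "0 \<le> R" by (simp add: R_def)
    qed
    moreover have "1 \<le> R"
    proof -
      have "1 * 1 \<le> R" unfolding R_def by (intro mult_mono) auto
      then show ?thesis by simp
    qed
    then have "(R - 1) * 1 \<le> (R - 1) * C" using C1 by (intro mult_left_mono) auto
    ultimately have "C \<le> R * C - k * l" by (simp add: algebra_simps)
    then show "C \<le> - mink x y" unfolding xy .
  qed
  then show "gangle (-1) w u v = arcosh ((p * q + m) / (sqrt (\<tau> + p\<^sup>2) * sqrt (\<tau>' + q\<^sup>2)))"
    by (simp add: gangle_def C M_def N_def)
qed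

section \<open>Generalized triangles and their Gram data\<close>

text \<open>The inverse of the length formulas: the negated Minkowski product as a function of the
  signed length. The factor 2 for two ideal vertices stems from horodisks being tangent when their
  vectors have product -2.\<close>

definition side_gram :: "int \<Rightarrow> int \<Rightarrow> real \<Rightarrow> real" where
  "side_gram \<sigma> \<tau> a = (if \<sigma> = 0 \<and> \<tau> = 0 then 2 * exp a else if \<sigma> * \<tau> = 0 then exp a
     else if \<sigma> * \<tau> = 1 then cosh a else sinh a)"

lemma side_gram_commute: "side_gram \<sigma> \<tau> = side_gram \<tau> \<sigma>"
  by (auto simp: side_gram_def mult.commute)

lemma seg_meets_commute: "seg_meets u v \<longleftrightarrow> seg_meets v u"
  unfolding seg_meets_def by (metis add.commute)

lemma gvertexD:
  assumes "gvertex \<sigma> w"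
  shows "mink w w = - of_int \<sigma>" "w$3 > 0"
  using assms by (auto simp: gvertex_def)

lemma gvertex_H2: "gvertex 1 w \<Longrightarrow> w \<in> H2"
  by (auto simp: gvertex_def H2_def)

lemma seg_meetsD:
  assumes "gvertex \<sigma> u" "gvertex \<tau> v" "seg_meets u v"
  obtains a b :: real where "a \<ge> 0" "b \<ge> 0"
    "2 * a * b * mink u v < real_of_int \<sigma> * a\<^sup>2 + real_of_int \<tau> * b\<^sup>2"
proof -
  from assms(3) obtain a b where ab: "a \<ge> 0" "b \<ge> 0"
    "mink (a *\<^sub>R u + b *\<^sub>R v) (a *\<^sub>R u + b *\<^sub>R v) < 0" by (auto simp: seg_meets_def)
  have "mink (a *\<^sub>R u + b *\<^sub>R v) (a *\<^sub>R u + b *\<^sub>R v) = 2 * a * b * mink u v - \<sigma> * a\<^sup>2 - \<tau> * b\<^sup>2"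
    by (simp add: mink_simps gvertexD(1)[OF assms(1)] gvertexD(1)[OF assms(2)] mink_commute[of v u]
        power2_eq_square algebra_simps)
  with ab that show ?thesis by simp
qed

text \<open>A vertex of type 1 alone makes \<open>seg_meets\<close> true, hence the exclusion.
  Otherwise the diagonal terms of the norm of \<open>a *\<^sub>R u + b *\<^sub>R v\<close> are
  nonnegative, so the mixed term is negative; for two hyperideal vertices
  \<open>a^2 + b^2 \<ge> 2 * a * b\<close> sharpens this to the bound -1.\<close>

lemma seg_meets_mink_neg:
  assumes "gvertex \<sigma> u" "gvertex \<tau> v" "seg_meets u v" "\<sigma> \<noteq> 1" "\<tau> \<noteq> 1"
  shows "mink u v < 0" "\<sigma> = -1 \<Longrightarrow> \<tau> = -1 \<Longrightarrow> mink u v < -1"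
proof -
  have st: "\<sigma> \<in> {-1, 0}" "\<tau> \<in> {-1, 0}" using assms by (auto simp: gvertex_def)
  obtain a b :: real where ab: "a \<ge> 0" "b \<ge> 0"
    and lt: "2 * a * b * mink u v < real_of_int \<sigma> * a\<^sup>2 + real_of_int \<tau> * b\<^sup>2"
    using seg_meetsD[OF assms(1-3)] .
  have "real_of_int \<sigma> * a\<^sup>2 + real_of_int \<tau> * b\<^sup>2 \<le> 0" using st by auto
  with lt have "(2 * a * b) * mink u v < 0" by simp
  moreover have "0 \<le> 2 * a * b" using ab by simp
  ultimately show "mink u v < 0" by (meson mult_less_0_iff not_less)
  show "mink u v < -1" if "\<sigma> = -1" "\<tau> = -1"
  proof (rule ccontr)
    assume "\<not> mink u v < -1"
    then have "(2 * a * b) * (-1) \<le> (2 * a * b) * mink u v" using ab by (intro mult_left_mono) auto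
    then have "(a - b)\<^sup>2 < 0" using lt that by (simp add: power2_eq_square algebra_simps)
    then show False by simp
  qed
qed

lemma seg_meetsI:
  assumes "gvertex \<sigma> u" "gvertex \<tau> v" "mink u v < 0" "\<sigma> = -1 \<Longrightarrow> \<tau> = -1 \<Longrightarrow> mink u v < -1"
  shows "seg_meets u v"
proof -
  have m: "mink (a *\<^sub>R u + b *\<^sub>R v) (a *\<^sub>R u + b *\<^sub>R v) = 2 * a * b * mink u v - \<sigma> * a\<^sup>2 - \<tau> * b\<^sup>2" for a b :: real
    by (simp add: mink_simps gvertexD(1)[OF assms(1)] gvertexD(1)[OF assms(2)] mink_commute[of v u]
        power2_eq_square algebra_simps)
  have st: "\<sigma> \<in> {-1, 0, 1}" "\<tau> \<in> {-1, 0, 1}" using assms by (auto simp: gvertex_def)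
  consider "\<sigma> = -1 \<and> \<tau> = 0" | "\<sigma> = 0 \<and> \<tau> = -1" | "\<not> (\<sigma> = -1 \<and> \<tau> = 0) \<and> \<not> (\<sigma> = 0 \<and> \<tau> = -1)" by blast
  then show ?thesis
  proof cases
    case 1
    \<comment> \<open>The norm \<open>1 + 2 * b * mink u v\<close> is -1 for the chosen
      \<open>b\<close>, whereas \<open>b = 1\<close> need not make it negative.\<close>
    have "mink (1 *\<^sub>R u + (- 1 / mink u v) *\<^sub>R v) (1 *\<^sub>R u + (- 1 / mink u v) *\<^sub>R v) < 0"
      using m[of 1 "- 1 / mink u v"] 1 assms(3) by simp
    moreover have "0 \<le> - 1 / mink u v" using assms(3) by (simp add: divide_nonpos_neg)
    ultimately show ?thesis unfolding seg_meets_def by (meson zero_le_one)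
  next
    case 2
    have "mink ((- 1 / mink u v) *\<^sub>R u + 1 *\<^sub>R v) ((- 1 / mink u v) *\<^sub>R u + 1 *\<^sub>R v) < 0"
      using m[of "- 1 / mink u v" 1] 2 assms(3) by simp
    moreover have "0 \<le> - 1 / mink u v" using assms(3) by (simp add: divide_nonpos_neg)
    ultimately show ?thesis unfolding seg_meets_def by (meson zero_le_one)
  next
    case 3
    have "mink (1 *\<^sub>R u + 1 *\<^sub>R v) (1 *\<^sub>R u + 1 *\<^sub>R v) < 0"
      using m[of 1 1] 3 st assms(3,4) by auto
    then show ?thesis unfolding seg_meets_def by (meson zero_le_one)
  qed
qed

text \<open>Each pair of types has its own length formula, which \<open>side_gram\<close> inverts on
  \<open>J\<close>. For types 1 and -1 a negated product that is not positive gives a length that is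
  not positive, so that both sides of the equivalence fail.\<close>

lemma glen_eq_iff_ordered:
  assumes "gvertex \<sigma> u" "gvertex \<tau> v" "u \<noteq> v" "seg_meets u v" "a \<in> J (\<sigma> * \<tau>)" "\<sigma> \<ge> \<tau>"
  shows "glen \<sigma> \<tau> u v = a \<longleftrightarrow> - mink u v = side_gram \<sigma> \<tau> a"
proof -
  define t where "t = - mink u v"
  note m = gvertexD[OF assms(1)] gvertexD[OF assms(2)]
  have "\<sigma> \<in> {-1, 0, 1}" "\<tau> \<in> {-1, 0, 1}" using assms by (auto simp: gvertex_def)
  with \<open>\<sigma> \<ge> \<tau>\<close> consider "\<sigma> = 1" "\<tau> = 1" | "\<sigma> = 1" "\<tau> = 0" | "\<sigma> = 1" "\<tau> = -1" | "\<sigma> = 0" "\<tau> = 0"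
    | "\<sigma> = 0" "\<tau> = -1" | "\<sigma> = -1" "\<tau> = -1" by fastforce
  then have "glen \<sigma> \<tau> u v = a \<longleftrightarrow> t = side_gram \<sigma> \<tau> a"
  proof cases
    case 1
    have H: "u \<in> H2" "v \<in> H2" using assms 1 gvertex_H2 by auto
    have "1 \<le> t" using H2_mink_ge_1[OF H] by (simp add: t_def)
    moreover have "0 < a" using assms(5) 1 by (simp add: J_def)
    ultimately show ?thesis
      using glen_point_point[OF H assms(3)] 1 arcosh_cosh_real[of a] cosh_arcosh_real[of t]
      by (auto simp: side_gram_def t_def[symmetric])
  next
    case 2
    have H: "u \<in> H2" using assms 2 gvertex_H2 by auto
    have t0: "0 < t" using mink_future_neg[of u v] H2_D[OF H] m 2 by (simp add: t_def)
    have "glen 1 0 u v = ln t" by (rule glen_point_ideal[OF H]) (use m 2 in \<open>auto simp: t_def\<close>)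
    then show ?thesis using 2 t0 by (auto simp: side_gram_def)
  next
    case 3
    have H: "u \<in> H2" using assms 3 gvertex_H2 by auto
    have v: "mink v v = 1" "v$3 > 0" using m 3 by auto
    note g = glen_point_hyperideal[OF H v t_def]
    have a: "0 < a" using assms(5) 3 by (simp add: J_def)
    show ?thesis
    proof (cases "0 < t")
      case True
      then show ?thesis
        using g(1) 3 arsinh_sinh_real[of a] sinh_arsinh_real[of t] by (auto simp: side_gram_def)
    next
      case False
      moreover have "0 < sinh a" using a by simp
      ultimately show ?thesis using g(2) 3 a by (auto simp: side_gram_def)
    qed
  next
    case 4
    have t0: "0 < t" using seg_meets_mink_neg(1)[OF assms(1,2,4)] 4 by (simp add: t_def)
    have "glen 0 0 u v = ln (t / 2)"
      by (rule glen_ideal_ideal[OF _ _ _ _ t_def t0]) (use m 4 in auto)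
    moreover have "ln (t / 2) = a \<longleftrightarrow> t / 2 = exp a" using t0 by auto
    ultimately show ?thesis using 4 by (auto simp: side_gram_def)
  next
    case 5
    have t0: "0 < t" using seg_meets_mink_neg(1)[OF assms(1,2,4)] 5 by (simp add: t_def)
    have "glen 0 (-1) u v = ln t"
      by (rule glen_ideal_hyperideal[OF _ _ _ _ t_def t0]) (use m 5 in auto)
    then show ?thesis using 5 t0 by (auto simp: side_gram_def)
  next
    case 6
    have t1: "1 < t" using seg_meets_mink_neg(2)[OF assms(1,2,4)] 6 by (simp add: t_def)
    have "glen (-1) (-1) u v = arcosh t"
      by (rule glen_hyperideal_hyperideal[OF _ _ _ _ t_def t1]) (use m 6 in auto)
    moreover have "0 < a" using assms(5) 6 by (simp add: J_def)
    ultimately show ?thesis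
      using 6 t1 arcosh_cosh_real[of a] cosh_arcosh_real[of t] by (auto simp: side_gram_def)
  qed
  then show ?thesis by (simp add: t_def)
qed

lemma glen_eq_iff:
  assumes "gvertex \<sigma> u" "gvertex \<tau> v" "u \<noteq> v" "seg_meets u v" "a \<in> J (\<sigma> * \<tau>)"
  shows "glen \<sigma> \<tau> u v = a \<longleftrightarrow> - mink u v = side_gram \<sigma> \<tau> a"
proof (cases "\<sigma> \<ge> \<tau>")
  case True
  then show ?thesis using glen_eq_iff_ordered assms by blast
next
  case False
  then have "glen \<tau> \<sigma> v u = a \<longleftrightarrow> - mink v u = side_gram \<tau> \<sigma> a"
    using assms by (intro glen_eq_iff_ordered) (auto simp: seg_meets_commute mult.commute)
  then show ?thesis by (simp add: glen_commute[of \<sigma>] mink_commute[of u] side_gram_commute[of \<sigma>])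
qed

section \<open>Gram determinants and laws of cosines\<close>

definition vol :: "real^3 \<Rightarrow> real^3 \<Rightarrow> real^3 \<Rightarrow> real" where
  "vol u v w = u$1 * (v$2 * w$3 - v$3 * w$2) + u$2 * (v$3 * w$1 - v$1 * w$3) + u$3 * (v$1 * w$2 - v$2 * w$1)"

text \<open>The Gram matrix arises from diag(1, 1, -1) by congruence with the coordinate matrix, so
  its determinant is minus the square of the volume.\<close>

lemma gram_vol:
  "(vol u v w)\<^sup>2 = - (mink u u * mink v v * mink w w + 2 * mink u v * mink u w * mink v w
     - mink u u * (mink v w)\<^sup>2 - mink v v * (mink u w)\<^sup>2 - mink w w * (mink u v)\<^sup>2)"
  unfolding vol_def mink_def by algebra

lemma vol_nonzero_independent:
  assumes "vol u v w \<noteq> 0" "a *\<^sub>R u + b *\<^sub>R v + c *\<^sub>R w = 0"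
  shows "a = 0 \<and> b = 0 \<and> c = 0"
proof -
  have e: "a * u$i + b * v$i + c * w$i = 0" for i
    using arg_cong[OF assms(2), of "\<lambda>x. x$i"] by simp
  have "a * vol u v w = 0" "b * vol u v w = 0" "c * vol u v w = 0"
    using e[of 1] e[of 2] e[of 3] unfolding vol_def by algebra+
  then show ?thesis using assms(1) by simp
qed

text \<open>The Gram data of a triangle of type \<open>(\<delta>, \<epsilon>, \<epsilon>)\<close>: \<open>x\<close> and \<open>y\<close> are the negated products of the
  \<open>\<delta>\<close>-vertex with the other two, whose negated product is \<open>opp_gram\<close>, and \<open>root_det\<close> is the
  square root of the determinant of the negated Gram matrix.\<close>

definition root_det :: "int \<Rightarrow> int \<Rightarrow> real \<Rightarrow> real \<Rightarrow> real \<Rightarrow> real" where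
  "root_det \<epsilon> \<delta> \<phi> x y = (if \<delta> = 0 then \<phi> / 2 else if \<delta> = 1 then sin \<phi> else sinh \<phi>)
     * (sqrt (x\<^sup>2 - \<delta> * \<epsilon>) * sqrt (y\<^sup>2 - \<delta> * \<epsilon>))"

definition opp_gram :: "int \<Rightarrow> int \<Rightarrow> real \<Rightarrow> real \<Rightarrow> real \<Rightarrow> real" where
  "opp_gram \<epsilon> \<delta> \<phi> x y =
     (if \<delta> = 0 then x * y * \<phi>\<^sup>2 / 8 + \<epsilon> * (x / y + y / x) / 2
      else if \<delta> = 1 then x * y - cos \<phi> * (sqrt (x\<^sup>2 - \<epsilon>) * sqrt (y\<^sup>2 - \<epsilon>))
      else cosh \<phi> * (sqrt (\<epsilon> + x\<^sup>2) * sqrt (\<epsilon> + y\<^sup>2)) - x * y)"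

definition cot_gram :: "int \<Rightarrow> int \<Rightarrow> real \<Rightarrow> real \<Rightarrow> real \<Rightarrow> real" where
  "cot_gram \<epsilon> \<delta> \<phi> x y = (x * opp_gram \<epsilon> \<delta> \<phi> x y - \<epsilon> * y) / root_det \<epsilon> \<delta> \<phi> x y"

text \<open>The inverse function of the generalized cotangent: \<open>cot\<close>, \<open>2 / \<alpha>\<close> or \<open>coth\<close>.\<close>

definition acot_gen :: "int \<Rightarrow> real \<Rightarrow> real" where
  "acot_gen \<epsilon> q = (if \<epsilon> = 1 then pi / 2 - arctan q else if \<epsilon> = 0 then 2 / q else ln ((q + 1) / (q - 1)) / 2)"

lemma root_det_pos:
  fixes x y :: real
  assumes "\<phi> \<in> Iopen \<delta>" "\<delta> \<in> {-1, 0, 1}" "0 < x\<^sup>2 - real_of_int \<delta> * real_of_int \<epsilon>"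
    "0 < y\<^sup>2 - real_of_int \<delta> * real_of_int \<epsilon>"
  shows "0 < root_det \<epsilon> \<delta> \<phi> x y"
  using assms by (auto simp: root_det_def Iopen_def sin_gt_zero split: if_splits)

text \<open>Inserting the law of cosines for \<open>z\<close> into the determinant leaves
  \<open>sin^2\<close>, \<open>sinh^2\<close> or \<open>\<phi>^2 / 4\<close> times the product of
  \<open>x^2 - \<delta> * \<epsilon>\<close> and \<open>y^2 - \<delta> * \<epsilon>\<close>.\<close>

lemma root_det_square:
  fixes x y z :: real
  assumes "\<delta> \<in> {-1, 0, 1}" "\<epsilon> \<in> {-1, 0, 1}" "0 < x" "0 < y" "0 < x\<^sup>2 - \<delta> * \<epsilon>" "0 < y\<^sup>2 - \<delta> * \<epsilon>"
    "z = opp_gram \<epsilon> \<delta> \<phi> x y"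
  shows "(root_det \<epsilon> \<delta> \<phi> x y)\<^sup>2 = \<delta> * ((real_of_int \<epsilon>)\<^sup>2 - z\<^sup>2) - \<epsilon> * (x\<^sup>2 + y\<^sup>2) + 2 * x * y * z"
proof -
  define A B where "A = sqrt (x\<^sup>2 - \<delta> * \<epsilon>)" and "B = sqrt (y\<^sup>2 - \<delta> * \<epsilon>)"
  have A: "A\<^sup>2 = x\<^sup>2 - \<delta> * \<epsilon>" and B: "B\<^sup>2 = y\<^sup>2 - \<delta> * \<epsilon>" using assms by (auto simp: A_def B_def)
  consider "\<delta> = 0" | "\<delta> = 1" | "\<delta> = -1" using assms by auto
  then show ?thesis
  proof cases
    case 1
    have "2 * x * y * z = (x * y * \<phi> / 2)\<^sup>2 + \<epsilon> * (x\<^sup>2 + y\<^sup>2)"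
      using assms(3,4) 1 unfolding assms(7) opp_gram_def by (simp add: power2_eq_square field_simps)
    then show ?thesis using assms(3,4) 1 by (simp add: root_det_def power_mult_distrib power_divide)
  next
    case 2
    have z: "z = x * y - cos \<phi> * (A * B)"
      unfolding assms(7) opp_gram_def A_def B_def using 2 by simp
    have s: "(sin \<phi>)\<^sup>2 = 1 - (cos \<phi>)\<^sup>2" by (simp add: sin_squared_eq)
    have "(root_det \<epsilon> \<delta> \<phi> x y)\<^sup>2 = (1 - (cos \<phi>)\<^sup>2) * (A\<^sup>2 * B\<^sup>2)"
      unfolding s[symmetric]
      using 2 by (simp add: root_det_def power_mult_distrib A_def B_def)
    also have "\<dots> = A\<^sup>2 * B\<^sup>2 - (x * y - z)\<^sup>2"
      unfolding z by (simp add: power2_eq_square algebra_simps)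
    also have "\<dots> = \<delta> * ((real_of_int \<epsilon>)\<^sup>2 - z\<^sup>2) - \<epsilon> * (x\<^sup>2 + y\<^sup>2) + 2 * x * y * z"
      unfolding A B using 2 by (simp add: power2_eq_square algebra_simps)
    finally show ?thesis .
  next
    case 3
    have z: "z = cosh \<phi> * (A * B) - x * y"
      unfolding assms(7) opp_gram_def A_def B_def using 3 by (simp add: add.commute)
    have s: "(sinh \<phi>)\<^sup>2 = (cosh \<phi>)\<^sup>2 - 1" by (rule sinh_square_eq)
    have "(root_det \<epsilon> \<delta> \<phi> x y)\<^sup>2 = ((cosh \<phi>)\<^sup>2 - 1) * (A\<^sup>2 * B\<^sup>2)"
      unfolding s[symmetric]
      using 3 by (simp add: root_det_def power_mult_distrib A_def B_def)
    also have "\<dots> = (x * y + z)\<^sup>2 - A\<^sup>2 * B\<^sup>2"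
      unfolding z by (simp add: power2_eq_square algebra_simps)
    also have "\<dots> = \<delta> * ((real_of_int \<epsilon>)\<^sup>2 - z\<^sup>2) - \<epsilon> * (x\<^sup>2 + y\<^sup>2) + 2 * x * y * z"
      unfolding A B using 3 by (simp add: power2_eq_square algebra_simps)
    finally show ?thesis .
  qed
qed

text \<open>\<open>opp_gram\<close> is the law of cosines at \<open>w\<close>, solved for the
  product belonging to the opposite side.\<close>

lemma gangle_eq_iff:
  fixes x y z :: real
  assumes w: "gvertex \<delta> w" and u: "gvertex \<epsilon> u" and v: "gvertex \<epsilon> v"
    and xyz: "x = - mink w u" "y = - mink w v" "z = - mink u v"
    and pos: "0 < x" "0 < y" "0 < x\<^sup>2 - \<delta> * \<epsilon>" "0 < y\<^sup>2 - \<delta> * \<epsilon>"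
    and \<phi>: "\<phi> \<in> Iopen \<delta>"
  shows "gangle \<delta> w u v = \<phi> \<longleftrightarrow> z = opp_gram \<epsilon> \<delta> \<phi> x y"
proof -
  note g = gvertexD[OF w] gvertexD[OF u] gvertexD[OF v]
  have m: "mink w u = - x" "mink w v = - y" "mink u v = - z" using xyz by auto
  have "\<delta> \<in> {-1, 0, 1}" using w by (auto simp: gvertex_def)
  then consider "\<delta> = 0" | "\<delta> = 1" | "\<delta> = -1" by auto
  then show ?thesis
  proof cases
    case 1
    have ww: "mink w w = 0" using g 1 by simp
    define E where "E = 2 * z / (x * y) - \<epsilon> / x\<^sup>2 - \<epsilon> / y\<^sup>2"
    have ga: "gangle 0 w u v = 2 * sqrt E"
      unfolding E_def by (rule gangle_ideal[OF ww g(2) g(3) g(5) xyz(1) pos(1) xyz(2) pos(2) xyz(3)])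
    have p: "0 < \<phi>" using \<phi> 1 by (simp add: Iopen_def)
    \<comment> \<open>A priori \<open>E\<close> may be negative; its \<open>sqrt\<close> would then
      be negative too, so \<open>\<phi> > 0\<close> forces \<open>E > 0\<close>.\<close>
    have "2 * sqrt E = \<phi> \<longleftrightarrow> E = \<phi>\<^sup>2 / 4"
    proof
      assume s: "2 * sqrt E = \<phi>"
      then have "0 < sqrt E" using p by linarith
      then have "0 < E" by simp
      then have "(2 * sqrt E)\<^sup>2 = 4 * E" by (simp add: power_mult_distrib)
      then show "E = \<phi>\<^sup>2 / 4" using s by simp
    next
      assume "E = \<phi>\<^sup>2 / 4"
      then have "E = (\<phi> / 2)\<^sup>2" by (simp add: power_divide)
      then show "2 * sqrt E = \<phi>" using p by simp
    qed
    also have "\<dots> \<longleftrightarrow> E * (x * y / 2) = \<phi>\<^sup>2 / 4 * (x * y / 2)"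
      using pos(1,2) by (subst mult_cancel_right) simp
    also have "E * (x * y / 2) = z - \<epsilon> * (x / y + y / x) / 2"
      using pos(1,2) by (simp add: E_def power2_eq_square field_simps)
    finally have "2 * sqrt E = \<phi> \<longleftrightarrow> z - \<epsilon> * (x / y + y / x) / 2 = \<phi>\<^sup>2 / 4 * (x * y / 2)" .
    moreover have "opp_gram \<epsilon> 0 \<phi> x y = \<phi>\<^sup>2 / 4 * (x * y / 2) + \<epsilon> * (x / y + y / x) / 2"
      by (simp add: opp_gram_def)
    ultimately have "2 * sqrt E = \<phi> \<longleftrightarrow> z = opp_gram \<epsilon> 0 \<phi> x y" by (simp only: diff_eq_eq)
    then show ?thesis using 1 ga by simp
  next
    case 2
    have ww: "mink w w = -1" using g 2 by simp
    define R where "R = sqrt (x\<^sup>2 - \<epsilon>) * sqrt (y\<^sup>2 - \<epsilon>)"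
    have R: "0 < R" "R\<^sup>2 = (x\<^sup>2 - \<epsilon>) * (y\<^sup>2 - \<epsilon>)"
      using pos 2 by (simp_all add: R_def power_mult_distrib)
    have ga: "gangle 1 w u v = arccos ((x * y - z) / R)"
      using gangle_point[OF ww g(3) g(5)] by (simp add: m R_def real_sqrt_mult)
    \<comment> \<open>\<open>arccos\<close> inverts \<open>cos\<close> only for arguments from -1 to
      1. The argument lies there because this difference is a squared volume.\<close>
    have "R\<^sup>2 - (x * y - z)\<^sup>2 = (vol w u v)\<^sup>2"
      unfolding gram_vol R(2) m g using 2 by (simp add: power2_eq_square algebra_simps)
    then have "(x * y - z)\<^sup>2 \<le> R\<^sup>2" by (metis diff_ge_0_iff_ge zero_le_power2)
    then have "\<bar>x * y - z\<bar> \<le> R" using R(1) by (metis abs_le_square_iff abs_of_pos)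
    then have c: "-1 \<le> (x * y - z) / R" "(x * y - z) / R \<le> 1"
      using R(1) by (auto simp: field_simps)
    have p: "0 \<le> \<phi>" "\<phi> \<le> pi" using \<phi> 2 by (auto simp: Iopen_def)
    have "arccos ((x * y - z) / R) = \<phi> \<longleftrightarrow> (x * y - z) / R = cos \<phi>"
      using cos_arccos[OF c] arccos_cos[OF p] by auto
    also have "\<dots> \<longleftrightarrow> z = x * y - cos \<phi> * R" using R(1) by (auto simp: field_simps)
    finally show ?thesis using 2 ga by (simp add: opp_gram_def R_def)
  next
    case 3
    have ww: "mink w w = 1" using g 3 by simp
    have pos': "0 < \<epsilon> + x\<^sup>2" "0 < \<epsilon> + y\<^sup>2" using pos 3 by simp_all
    define R where "R = sqrt (\<epsilon> + x\<^sup>2) * sqrt (\<epsilon> + y\<^sup>2)"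
    have R: "0 < R" using pos' by (simp add: R_def)
    note G = gangle_hyperideal[OF ww g(2) g(3,4) g(5,6) xyz(1) pos(1) pos'(1) xyz(2) pos(2) pos'(2) xyz(3),
        folded R_def]
    have p: "0 \<le> \<phi>" using \<phi> 3 by (simp add: Iopen_def)
    have "arcosh ((x * y + z) / R) = \<phi> \<longleftrightarrow> (x * y + z) / R = cosh \<phi>"
      using cosh_arcosh_real[OF G(2)] arcosh_cosh_real[OF p] by auto
    also have "\<dots> \<longleftrightarrow> z = cosh \<phi> * R - x * y" using R by (auto simp: field_simps)
    finally show ?thesis using 3 G(1) by (simp add: opp_gram_def R_def)
  qed
qed

lemma arccos_eq_arctan:
  assumes "0 < S"
  shows "arccos (N / sqrt (N\<^sup>2 + S\<^sup>2)) = pi / 2 - arctan (N / S)"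
proof -
  have "N / sqrt (N\<^sup>2 + S\<^sup>2) = sin (arctan (N / S))"
  proof -
    have "sqrt (1 + (N / S)\<^sup>2) = sqrt (N\<^sup>2 + S\<^sup>2) / S"
    proof -
      have "1 + (N / S)\<^sup>2 = (N\<^sup>2 + S\<^sup>2) / S\<^sup>2" using assms by (simp add: field_simps)
      then show ?thesis using assms by (simp add: real_sqrt_divide)
    qed
    then show ?thesis using assms by (simp add: sin_arctan)
  qed
  also have "\<dots> = cos (pi / 2 - arctan (N / S))" by (simp add: cos_sin_eq)
  finally show ?thesis
    using arctan_lbound[of "N / S"] arctan_ubound[of "N / S"] by (simp add: arccos_cos)
qed

text \<open>This is the area hyperbolic cotangent of \<open>N / S\<close>: with the roots
  \<open>A\<close>, \<open>B\<close> of \<open>N + S\<close>, \<open>N - S\<close>, the argument of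
  \<open>arcosh\<close> is \<open>cosh (ln (A / B))\<close>.\<close>

lemma arcosh_eq_ln:
  assumes "0 < S" "S < (N::real)"
  shows "arcosh (N / sqrt (N\<^sup>2 - S\<^sup>2)) = ln ((N / S + 1) / (N / S - 1)) / 2"
proof -
  define A B where "A = sqrt (N + S)" and "B = sqrt (N - S)"
  have AB: "0 < B" "B < A" "A\<^sup>2 = N + S" "B\<^sup>2 = N - S" using assms by (auto simp: A_def B_def)
  have "A * B = sqrt (N\<^sup>2 - S\<^sup>2)"
    unfolding A_def B_def real_sqrt_mult[symmetric] by (simp add: power2_eq_square algebra_simps)
  moreover have "(A / B + 1 / (A / B)) / 2 = (A\<^sup>2 + B\<^sup>2) / (2 * (A * B))"
    using AB(1,2) by (simp add: field_simps power2_eq_square)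
  then have "(A / B + 1 / (A / B)) / 2 = N / (A * B)" using AB by simp
  moreover have "arcosh ((A / B + 1 / (A / B)) / 2) = ln (A / B)"
    using arcosh_avg_inverse[of "A / B"] AB(1,2) by simp
  moreover have "(N / S + 1) / (N / S - 1) = (A / B)\<^sup>2"
    unfolding power_divide AB(3,4) using assms by (simp add: field_simps)
  moreover have "ln ((A / B)\<^sup>2) = 2 * ln (A / B)" using AB(1,2) by (simp add: ln_realpow)
  ultimately show ?thesis by simp
qed

text \<open>For \<open>N = x * z - \<epsilon> * y\<close> the determinant identity \<open>N^2 +
  \<epsilon> * S^2 = (x^2 - \<delta> * \<epsilon>) * (z^2 - \<epsilon>^2)\<close> turns the
  denominator of the law of cosines at \<open>w2\<close> into a function of \<open>N\<close> and
  \<open>S\<close>. So \<open>N / S\<close> is \<open>cot\<close> or \<open>coth\<close> of the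
  angle for \<epsilon> = 1 or -1, and for \<epsilon> = 0 the angle is
  \<open>2 * S / N\<close>.\<close>

lemma gangle_eq_acot_gen:
  fixes x y z S :: real
  assumes w1: "gvertex \<delta> w1" and w2: "gvertex \<epsilon> w2" and w3: "gvertex \<epsilon> w3"
    and xyz: "x = - mink w1 w2" "y = - mink w1 w3" "z = - mink w2 w3"
    and pos: "0 < x" "0 < y" "0 < x\<^sup>2 - \<delta> * \<epsilon>" "\<epsilon> = 0 \<Longrightarrow> 0 < z" "\<epsilon> = -1 \<Longrightarrow> 1 < z"
    and S: "0 < S" "S\<^sup>2 = \<delta> * ((real_of_int \<epsilon>)\<^sup>2 - z\<^sup>2) - \<epsilon> * (x\<^sup>2 + y\<^sup>2) + 2 * x * y * z"
  shows "gangle \<epsilon> w2 w1 w3 = acot_gen \<epsilon> ((x * z - \<epsilon> * y) / S)"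
    and "\<epsilon> = -1 \<Longrightarrow> 1 < (x * z - \<epsilon> * y) / S"
proof -
  note g = gvertexD[OF w1] gvertexD[OF w2] gvertexD[OF w3]
  have m: "mink w2 w1 = - x" "mink w2 w3 = - z" "mink w1 w3 = - y"
    using xyz by (auto simp: mink_commute)
  have xyz': "x = - mink w2 w1" "z = - mink w2 w3" "y = - mink w1 w3" using m by auto
  define N where "N = x * z - \<epsilon> * y"
  have hyp: "S < N" "gangle (-1) w2 w1 w3 = acot_gen (-1) (N / S)" if e: "\<epsilon> = -1"
  proof -
    have z1: "1 < z" using pos e by simp
    have zz: "1 < z\<^sup>2" using z1 by (simp add: one_less_power)
    have p: "0 < \<delta> + x\<^sup>2" "0 < -1 + z\<^sup>2" "0 < z" using pos e z1 zz by simp_all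
    have NN: "N\<^sup>2 - S\<^sup>2 = (\<delta> + x\<^sup>2) * (-1 + z\<^sup>2)"
      unfolding S N_def e by (simp add: power2_eq_square algebra_simps)
    have "0 < N\<^sup>2 - S\<^sup>2" unfolding NN using p by simp
    moreover have N0: "0 < N" using pos p e by (simp add: N_def add_pos_pos)
    ultimately show SN: "S < N" using power2_less_imp_less[of S N] by simp
    have ww: "mink w2 w2 = 1" "mink w3 w3 = - (-1)" using g e by simp_all
    have "gangle (-1) w2 w1 w3 = arcosh ((x * z + y) / (sqrt (\<delta> + x\<^sup>2) * sqrt (-1 + z\<^sup>2)))"
      by (rule gangle_hyperideal(1)[OF ww(1) g(4) g(1,2) ww(2) g(6) xyz'(1) pos(1) p(1) xyz'(2) p(3,2) xyz'(3)])
    also have "\<dots> = arcosh (N / sqrt (N\<^sup>2 - S\<^sup>2))"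
      unfolding NN by (simp add: N_def e real_sqrt_mult)
    finally show "gangle (-1) w2 w1 w3 = acot_gen (-1) (N / S)"
      unfolding arcosh_eq_ln[OF S(1) SN] by (simp add: acot_gen_def)
  qed
  show "\<epsilon> = -1 \<Longrightarrow> 1 < (x * z - \<epsilon> * y) / S" using hyp(1) S(1) by (simp add: N_def)
  have "\<epsilon> \<in> {-1, 0, 1}" using w2 by (auto simp: gvertex_def)
  then consider "\<epsilon> = 0" | "\<epsilon> = 1" | "\<epsilon> = -1" by auto
  then have "gangle \<epsilon> w2 w1 w3 = acot_gen \<epsilon> (N / S)"
  proof cases
    case 1
    have z0: "0 < z" using pos 1 by simp
    have ww: "mink w2 w2 = 0" "mink w3 w3 = - 0" using g 1 by simp_all
    have "gangle 0 w2 w1 w3 = 2 * sqrt (2 * y / (x * z) - \<delta> / x\<^sup>2 - 0 / z\<^sup>2)"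
      by (rule gangle_ideal[OF ww(1) g(4) g(1) ww(2) xyz'(1) pos(1) xyz'(2) z0 xyz'(3)])
    also have "2 * y / (x * z) - \<delta> / x\<^sup>2 - 0 / z\<^sup>2 = (S / (x * z))\<^sup>2"
      unfolding power_divide S(2) using 1 z0 pos(1) by (simp add: power2_eq_square field_simps)
    also have "sqrt ((S / (x * z))\<^sup>2) = S / (x * z)" using S(1) pos(1) z0 by simp
    finally show ?thesis using 1 by (simp add: acot_gen_def N_def)
  next
    case 2
    have ww: "mink w2 w2 = -1" "mink w3 w3 = - 1" using g 2 by simp_all
    have "gangle 1 w2 w1 w3 = arccos ((x * z - y) / sqrt ((x\<^sup>2 - \<delta>) * (z\<^sup>2 - 1)))"
      using gangle_point[OF ww(1) g(1) ww(2)] by (simp add: m)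
    also have "(x\<^sup>2 - \<delta>) * (z\<^sup>2 - 1) = N\<^sup>2 + S\<^sup>2"
      unfolding S(2) N_def using 2 by (simp add: power2_eq_square algebra_simps)
    also have "x * z - y = N" using 2 by (simp add: N_def)
    finally show ?thesis unfolding arccos_eq_arctan[OF S(1)] using 2 by (simp add: acot_gen_def)
  next
    case 3
    then show ?thesis using hyp by simp
  qed
  then show "gangle \<epsilon> w2 w1 w3 = acot_gen \<epsilon> ((x * z - \<epsilon> * y) / S)" by (simp add: N_def)
qed

section \<open>Existence of triangles and uniqueness of their angles\<close>

lemma gram_realization:
  fixes x y z :: real
  assumes "\<delta> \<in> {-1, 0, 1}" "\<epsilon> \<in> {-1, 0, 1}" "0 < x" "0 < y" "0 < x\<^sup>2 - \<delta> * \<epsilon>" "0 < y\<^sup>2 - \<delta> * \<epsilon>"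
    and z: "z = opp_gram \<epsilon> \<delta> \<phi> x y"
  shows "\<exists>w1 w2 w3. gvertex \<delta> w1 \<and> gvertex \<epsilon> w2 \<and> gvertex \<epsilon> w3 \<and>
    mink w1 w2 = - x \<and> mink w1 w3 = - y \<and> mink w2 w3 = - z"
proof -
  define X Y where "X = sqrt (x\<^sup>2 - \<delta> * \<epsilon>)" and "Y = sqrt (y\<^sup>2 - \<delta> * \<epsilon>)"
  have XY: "0 < X" "0 < Y" "X\<^sup>2 = x\<^sup>2 - \<delta> * \<epsilon>" "Y\<^sup>2 = y\<^sup>2 - \<delta> * \<epsilon>" using assms by (auto simp: X_def Y_def)
  have v3: "(vector [a, b, c] :: real^3) $ 1 = a" "(vector [a, b, c] :: real^3) $ 2 = b"
    "(vector [a, b, c] :: real^3) $ 3 = c" for a b c by (simp_all add: vector_3)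
  have mv: "mink (vector [a, b, c]) (vector [a', b', c']) = a * a' + b * b' - c * c'" for a b c a' b' c'
    by (simp add: mink_def v3)
  consider "\<delta> = 0" | "\<delta> = 1" | "\<delta> = -1" using assms by auto
  then show ?thesis
  proof cases
    case 1
    \<comment> \<open>Scaling the light-like vector by a small \<open>l\<close> is a boost, which makes the last coordinates positive.\<close>
    define l where "l = min x y / 2"
    have l: "0 < l" "l < x" "l < y" using assms by (auto simp: l_def)
    \<comment> \<open>In light-cone coordinates along \<open>w1\<close>, the products with
      \<open>w1\<close> fix \<open>u\<close> and \<open>v\<close>, the transverse coordinate
      \<open>k\<close> produces the angle, and \<open>s\<close>, \<open>t\<close> solve the norm
      equations \<open>s * u = \<epsilon>\<close> and
      \<open>t * v = k^2 + \<epsilon>\<close>.\<close>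
    define k where "k = y * \<phi> / 2"
    define u v where "u = x / l" and "v = y / l"
    define s t where "s = l * \<epsilon> / x" and "t = l * (k\<^sup>2 + \<epsilon>) / y"
    let ?w1 = "vector [0, l, l] :: real^3"
    let ?w2 = "vector [0, (s - u) / 2, (s + u) / 2] :: real^3"
    let ?w3 = "vector [k, (t - v) / 2, (t + v) / 2] :: real^3"
    have e: "-1 \<le> real_of_int \<epsilon>" using assms by auto
    have "- 1 < s"
    proof -
      have "l * (-1) \<le> l * \<epsilon>" using e l by (intro mult_left_mono) auto
      then have "- x < l * \<epsilon>" using l by linarith
      then show ?thesis using assms by (simp add: s_def pos_less_divide_eq)
    qed
    moreover have "- 1 < t"
    proof -
      have "l * (-1) \<le> l * (k\<^sup>2 + \<epsilon>)" using e l by (intro mult_left_mono) (auto simp: add_increasing)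
      then have "- y < l * (k\<^sup>2 + \<epsilon>)" using l by linarith
      then show ?thesis using assms by (simp add: t_def pos_less_divide_eq)
    qed
    moreover have "1 < u" "1 < v" using l by (simp_all add: u_def v_def)
    ultimately have pos: "0 < (s + u) / 2" "0 < (t + v) / 2" by simp_all
    have sx: "s * (u) = \<epsilon>" "t * (v) = k\<^sup>2 + \<epsilon>" using l assms by (simp_all add: s_def t_def u_def v_def)
    have "gvertex 0 ?w1" using l by (simp add: gvertex_def mv v3)
    moreover have "gvertex \<epsilon> ?w2"
    proof -
      have "mink ?w2 ?w2 = - (s * (u))" unfolding mv by (simp add: field_simps)
      then show ?thesis using pos assms(2) by (simp add: gvertex_def v3 sx)
    qed
    moreover have "gvertex \<epsilon> ?w3"
    proof -
      have "mink ?w3 ?w3 = k\<^sup>2 - t * (v)" unfolding mv by (simp add: field_simps power2_eq_square)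
      then show ?thesis using pos assms(2) by (simp add: gvertex_def v3 sx)
    qed
    moreover have "mink ?w1 ?w2 = - x" "mink ?w1 ?w3 = - y" using l by (simp_all add: mv u_def v_def field_simps)
    moreover have "mink ?w2 ?w3 = - z"
    proof -
      have "mink ?w2 ?w3 = - (s * (v) + t * (u)) / 2" unfolding mv by (simp add: field_simps)
      also have "s * (v) = \<epsilon> * (y / x)" using l by (simp add: s_def v_def)
      also have "t * (u) = (k\<^sup>2 + \<epsilon>) * (x / y)" using l by (simp add: t_def u_def)
      also have "- (\<epsilon> * (y / x) + (k\<^sup>2 + \<epsilon>) * (x / y)) / 2 = - z"
        using assms(3,4) 1 by (simp add: z opp_gram_def k_def power2_eq_square field_simps)
      finally show ?thesis .
    qed
    ultimately show ?thesis using 1 by blast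
  next
    case 2
    let ?w1 = "vector [0, 0, 1] :: real^3"
    let ?w2 = "vector [X, 0, x] :: real^3"
    let ?w3 = "vector [Y * cos \<phi>, Y * sin \<phi>, y] :: real^3"
    have "gvertex 1 ?w1" by (simp add: gvertex_def mv v3)
    moreover have "gvertex \<epsilon> ?w2"
      using assms(2,3) XY(3) 2 by (simp add: gvertex_def mv v3 power2_eq_square)
    moreover have "gvertex \<epsilon> ?w3"
    proof -
      have "mink ?w3 ?w3 = Y\<^sup>2 * ((sin \<phi>)\<^sup>2 + (cos \<phi>)\<^sup>2) - y\<^sup>2"
        unfolding mv by algebra
      then show ?thesis using assms(2,4) XY(4) 2 by (simp add: gvertex_def v3)
    qed
    moreover have "mink ?w1 ?w2 = - x" "mink ?w1 ?w3 = - y" by (simp_all add: mv)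
    moreover have "mink ?w2 ?w3 = - z" using 2 by (simp add: mv z opp_gram_def X_def Y_def)
    ultimately show ?thesis using 2 by blast
  next
    case 3
    define Y' where "Y' = Y * cosh \<phi>"
    have Y': "0 < Y'" using XY by (simp add: Y'_def cosh_real_pos)
    \<comment> \<open>The simplest choice would be \<open>w1 = (1, 0, 0)\<close>, but
      \<open>gvertex\<close> asks for a positive last coordinate. A boost with small parameter
      \<open>s\<close> provides it; \<open>s * x < X\<close> and \<open>s * y < Y'\<close> keep the
      last coordinates of the other two vertices positive.\<close>
    define s where "s = min (X / x) (Y' / y) / 2"
    have s: "0 < s" "s * x < X" "s * y < Y'"
    proof -
      have "0 < X / x" "0 < Y' / y" using XY Y' assms by simp_all
      then show "0 < s" by (simp add: s_def)
      have "min A B / 2 < A \<and> min A B / 2 < B" if "0 < A" "0 < B" for A B :: real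
        using that by (auto simp: min_def)
      then have "s < X / x" "s < Y' / y" using \<open>0 < X / x\<close> \<open>0 < Y' / y\<close> by (simp_all only: s_def)
      then show "s * x < X" "s * y < Y'" using assms by (simp_all add: pos_less_divide_eq)
    qed
    define c where "c = sqrt (1 + s\<^sup>2)"
    have c: "1 \<le> c" "c\<^sup>2 = 1 + s\<^sup>2" by (simp_all add: c_def add_nonneg_nonneg)
    let ?w1 = "vector [c, 0, s] :: real^3"
    let ?w2 = "vector [- x * c + X * s, 0, - x * s + X * c] :: real^3"
    let ?w3 = "vector [- y * c + Y' * s, Y * sinh \<phi>, - y * s + Y' * c] :: real^3"
    have cX: "X \<le> X * c" "Y' \<le> Y' * c" using c XY Y' by simp_all
    have cc: "c * c = 1 + s * s" using c by (simp add: power2_eq_square)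
    have ch: "(cosh \<phi>)\<^sup>2 = 1 + (sinh \<phi>)\<^sup>2" by (simp add: cosh_square_eq)
    have "gvertex (-1) ?w1" using s c by (simp add: gvertex_def mv v3 power2_eq_square)
    moreover have "gvertex \<epsilon> ?w2"
    proof -
      have "mink ?w2 ?w2 = (c * c - s * s) * (x\<^sup>2 - X\<^sup>2)"
        unfolding mv by (simp add: power2_eq_square algebra_simps)
      then have "mink ?w2 ?w2 = - \<epsilon>" unfolding cc XY(3) using 3 by simp
      moreover have "0 < - x * s + X * c" using s(2) cX(1) by (simp add: mult.commute)
      ultimately show ?thesis using assms(2) by (simp add: gvertex_def v3)
    qed
    moreover have "gvertex \<epsilon> ?w3"
    proof -
      have "mink ?w3 ?w3 = (c * c - s * s) * (y\<^sup>2 - Y\<^sup>2 * (cosh \<phi>)\<^sup>2) + Y\<^sup>2 * (sinh \<phi>)\<^sup>2"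
        unfolding mv Y'_def by (simp add: power2_eq_square algebra_simps)
      then have "mink ?w3 ?w3 = - \<epsilon>" unfolding cc ch XY(4) using 3 by (simp add: algebra_simps)
      moreover have "0 < - y * s + Y' * c" using s(3) cX(2) by (simp add: mult.commute)
      ultimately show ?thesis using assms(2) by (simp add: gvertex_def v3)
    qed
    moreover have "mink ?w1 ?w2 = - x * (c * c - s * s)" "mink ?w1 ?w3 = - y * (c * c - s * s)"
      unfolding mv by (simp_all add: algebra_simps)
    then have "mink ?w1 ?w2 = - x" "mink ?w1 ?w3 = - y" by (simp_all add: cc)
    moreover have "mink ?w2 ?w3 = - z"
    proof -
      have "mink ?w2 ?w3 = (c * c - s * s) * (x * y - X * Y')"
        unfolding mv by (simp add: algebra_simps)
      then show ?thesis
        using 3 by (simp add: cc z opp_gram_def Y'_def X_def Y_def add.commute)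
    qed
    ultimately show ?thesis using 3 by blast
  qed
qed

lemma side_gram_pos:
  assumes "a \<in> J (\<delta> * \<epsilon>)" "\<delta> \<in> {-1, 0, 1}" "\<epsilon> \<in> {-1, 0, 1}"
  shows "0 < side_gram \<delta> \<epsilon> a" "0 < (side_gram \<delta> \<epsilon> a)\<^sup>2 - real_of_int \<delta> * real_of_int \<epsilon>"
proof -
  consider "\<delta> * \<epsilon> = 0" | "\<delta> * \<epsilon> = 1" | "\<delta> * \<epsilon> = -1" using assms(2,3) by auto
  then have "0 < side_gram \<delta> \<epsilon> a \<and> 0 < (side_gram \<delta> \<epsilon> a)\<^sup>2 - real_of_int \<delta> * real_of_int \<epsilon>"
  proof cases
    case 2
    have de: "real_of_int \<delta> * real_of_int \<epsilon> = 1" using 2 by (metis of_int_1 of_int_mult)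
    from 2 have "0 < a" "side_gram \<delta> \<epsilon> a = cosh a" using assms by (auto simp: J_def side_gram_def)
    then show ?thesis by (simp add: de cosh_square_eq cosh_real_pos)
  next
    case 3
    have de: "real_of_int \<delta> * real_of_int \<epsilon> = -1" using 3 by (metis of_int_1 of_int_minus of_int_mult)
    from 3 have "0 < a" "side_gram \<delta> \<epsilon> a = sinh a" using assms by (auto simp: J_def side_gram_def)
    then show ?thesis by (simp add: de add_pos_nonneg)
  qed (auto simp: side_gram_def)
  then show "0 < side_gram \<delta> \<epsilon> a" "0 < (side_gram \<delta> \<epsilon> a)\<^sup>2 - real_of_int \<delta> * real_of_int \<epsilon>" by simp_all
qed

lemma opp_gram_0:
  assumes "0 < x" "0 < y"
  shows "opp_gram 0 \<delta> \<phi> x y =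
    x * y * (if \<delta> = 0 then \<phi>\<^sup>2 / 8 else if \<delta> = 1 then 1 - cos \<phi> else cosh \<phi> - 1)"
  using assms by (simp add: opp_gram_def algebra_simps)

lemma cos_less_1:
  assumes "0 < \<phi>" "\<phi> < pi"
  shows "cos \<phi> < 1"
  using cos_monotone_0_pi[of 0 \<phi>] assms by simp

lemma cosh_gt_1: "0 < (t::real) \<Longrightarrow> 1 < cosh t"
  using cosh_real_ge_1[of t] cosh_real_one_iff[of t] by linarith

lemma opp_gram_0_pos:
  assumes "0 < x" "0 < y" "\<phi> \<in> Iopen \<delta>" "\<delta> \<in> {-1, 0, 1}"
  shows "0 < opp_gram 0 \<delta> \<phi> x y"
  using assms by (auto simp: opp_gram_0 Iopen_def cos_less_1 cosh_gt_1)

text \<open>The lengths and the angle amount to the three Gram entries. From right to left,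
  positivity of \<open>root_det\<close> makes the volume nonzero, so the vertices are independent,
  and the sides meet the plane once the products are negative and, between hyperideal vertices,
  below -1. For the sides at the \<delta>-vertex this follows from \<open>J\<close>; for the
  opposite side it is the condition \<open>1 < z\<close>.\<close>

lemma gtri_iff:
  assumes d: "\<delta> \<in> {-1, 0, 1}" and e: "\<epsilon> \<in> {-1, 0, 1}" and \<phi>: "\<phi> \<in> Iopen \<delta>"
    and ab: "a \<in> J (\<delta> * \<epsilon>)" "b \<in> J (\<delta> * \<epsilon>)"
    and xyz: "x = side_gram \<delta> \<epsilon> a" "y = side_gram \<delta> \<epsilon> b" "z = opp_gram \<epsilon> \<delta> \<phi> x y"
  shows "gtri \<delta> \<epsilon> \<epsilon> w1 w2 w3 \<and> glen \<delta> \<epsilon> w1 w2 = a \<and> glen \<delta> \<epsilon> w1 w3 = b \<and> gangle \<delta> w1 w2 w3 = \<phi> \<longleftrightarrow>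
    gvertex \<delta> w1 \<and> gvertex \<epsilon> w2 \<and> gvertex \<epsilon> w3 \<and>
    mink w1 w2 = - x \<and> mink w1 w3 = - y \<and> mink w2 w3 = - z \<and> (\<epsilon> = -1 \<longrightarrow> 1 < z)"
    (is "?L \<longleftrightarrow> ?R")
proof
  note pos = side_gram_pos[OF ab(1) d e, folded xyz] side_gram_pos[OF ab(2) d e, folded xyz]
  assume L: ?L
  then have g: "gvertex \<delta> w1" "gvertex \<epsilon> w2" "gvertex \<epsilon> w3"
    and ind: "\<And>a b c. a *\<^sub>R w1 + b *\<^sub>R w2 + c *\<^sub>R w3 = 0 \<Longrightarrow> a = 0 \<and> b = 0 \<and> c = 0"
    and seg: "seg_meets w1 w2" "seg_meets w2 w3" "seg_meets w1 w3"
    unfolding gtri_def by blast+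
  have ne: "w1 \<noteq> w2" "w1 \<noteq> w3" using ind[of 1 "-1" 0] ind[of 1 0 "-1"] by auto
  have x: "mink w1 w2 = - x" using glen_eq_iff[OF g(1,2) ne(1) seg(1) ab(1)] L xyz by simp
  have y: "mink w1 w3 = - y" using glen_eq_iff[OF g(1,3) ne(2) seg(3) ab(2)] L xyz by simp
  have "- mink w2 w3 = z"
    using gangle_eq_iff[OF g, of x y _ \<phi>] x y pos \<phi> L xyz(3) by simp
  moreover have "\<epsilon> = -1 \<Longrightarrow> mink w2 w3 < -1" using seg_meets_mink_neg(2)[OF g(2,3) seg(2)] by simp
  ultimately show ?R using g x y by auto
next
  note pos = side_gram_pos[OF ab(1) d e, folded xyz] side_gram_pos[OF ab(2) d e, folded xyz]
  assume R: ?R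
  then have g: "gvertex \<delta> w1" "gvertex \<epsilon> w2" "gvertex \<epsilon> w3"
    and m: "mink w1 w2 = - x" "mink w1 w3 = - y" "mink w2 w3 = - z" and z1: "\<epsilon> = -1 \<Longrightarrow> 1 < z" by auto
  note gg = gvertexD(1)[OF g(1)] gvertexD(1)[OF g(2)] gvertexD(1)[OF g(3)]
  have "(vol w1 w2 w3)\<^sup>2 = (root_det \<epsilon> \<delta> \<phi> x y)\<^sup>2"
    unfolding gram_vol root_det_square[OF d e pos(1,3,2,4) xyz(3)] m gg
    by (simp add: power2_eq_square algebra_simps)
  moreover have "0 < root_det \<epsilon> \<delta> \<phi> x y" by (rule root_det_pos[OF \<phi> d pos(2,4)])
  ultimately have "vol w1 w2 w3 \<noteq> 0" by auto
  note ind = vol_nonzero_independent[OF this]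
  have ne: "w1 \<noteq> w2" "w1 \<noteq> w3" using ind[of 1 "-1" 0] ind[of 1 0 "-1"] by auto
  have gt1: "1 < t" if "0 < t" "0 < t\<^sup>2 - real_of_int \<delta> * real_of_int \<epsilon>" "\<delta> = -1" "\<epsilon> = -1" for t :: real
    using that power2_le_imp_le[of t 1] power_le_one[of t 2] by (cases "t \<le> 1") auto
  have z0: "0 < z"
  proof -
    consider "\<epsilon> = 0" | "\<epsilon> = 1" | "\<epsilon> = -1" using e by auto
    then show ?thesis
    proof cases
      case 1
      then show ?thesis using opp_gram_0_pos pos \<phi> d xyz(3) by simp
    next
      case 2
      then show ?thesis using H2_mink_ge_1[of w2 w3] gvertex_H2 g m by simp
    qed (use z1 in simp)
  qed
  have seg1: "seg_meets w1 w2"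
    by (rule seg_meetsI[OF g(1,2)]) (simp_all add: m(1) pos(1) gt1[OF pos(1,2)])
  have seg2: "seg_meets w1 w3"
    by (rule seg_meetsI[OF g(1,3)]) (simp_all add: m(2) pos(3) gt1[OF pos(3,4)])
  have seg3: "seg_meets w2 w3"
    by (rule seg_meetsI[OF g(2,3)]) (simp_all add: m(3) z0 z1)
  note seg = seg1 seg2 seg3
  have "gtri \<delta> \<epsilon> \<epsilon> w1 w2 w3" unfolding gtri_def using g seg ind by blast
  moreover have "glen \<delta> \<epsilon> w1 w2 = a" using glen_eq_iff[OF g(1,2) ne(1) seg(1) ab(1)] m xyz by simp
  moreover have "glen \<delta> \<epsilon> w1 w3 = b" using glen_eq_iff[OF g(1,3) ne(2) seg(2) ab(2)] m xyz by simp
  moreover have "gangle \<delta> w1 w2 w3 = \<phi>"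
    using gangle_eq_iff[OF g, of x y z \<phi>] m pos \<phi> xyz(3) by simp
  ultimately show ?L by blast
qed

theorem Ddom_iff:
  assumes d: "\<delta> \<in> {-1, 0, 1}" and e: "\<epsilon> \<in> {-1, 0, 1}" and \<phi>: "\<phi> \<in> Iopen \<delta>"
  shows "(a, b) \<in> Ddom \<epsilon> \<delta> \<phi> \<longleftrightarrow> a \<in> J (\<delta> * \<epsilon>) \<and> b \<in> J (\<delta> * \<epsilon>) \<and>
    (\<epsilon> = -1 \<longrightarrow> 1 < opp_gram \<epsilon> \<delta> \<phi> (side_gram \<delta> \<epsilon> a) (side_gram \<delta> \<epsilon> b))"
proof (cases "a \<in> J (\<delta> * \<epsilon>) \<and> b \<in> J (\<delta> * \<epsilon>)")
  case True
  then have ab: "a \<in> J (\<delta> * \<epsilon>)" "b \<in> J (\<delta> * \<epsilon>)" by auto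
  note pos = side_gram_pos[OF ab(1) d e] side_gram_pos[OF ab(2) d e]
  have "(a, b) \<in> Ddom \<epsilon> \<delta> \<phi> \<longleftrightarrow> (\<exists>w1 w2 w3. gtri \<delta> \<epsilon> \<epsilon> w1 w2 w3 \<and> glen \<delta> \<epsilon> w1 w2 = a
      \<and> glen \<delta> \<epsilon> w1 w3 = b \<and> gangle \<delta> w1 w2 w3 = \<phi>)"
    using ab by (simp add: Ddom_def mult.commute)
  also have "\<dots> \<longleftrightarrow> (\<epsilon> = -1 \<longrightarrow> 1 < opp_gram \<epsilon> \<delta> \<phi> (side_gram \<delta> \<epsilon> a) (side_gram \<delta> \<epsilon> b))"
    unfolding gtri_iff[OF d e \<phi> ab refl refl refl]
    using gram_realization[OF d e pos(1,3,2,4) refl, of \<phi>] by blast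
  finally show ?thesis using ab by blast
qed (auto simp: Ddom_def mult.commute)

text \<open>The angle is a function of the Gram data alone, hence the same for all triangles with
  these sides and this angle, which makes the description in \<open>tri_angle\<close>
  definite.\<close>

theorem tri_angle_eq:
  assumes d: "\<delta> \<in> {-1, 0, 1}" and e: "\<epsilon> \<in> {-1, 0, 1}" and \<phi>: "\<phi> \<in> Iopen \<delta>"
    and D: "(a, b) \<in> Ddom \<epsilon> \<delta> \<phi>"
    and q: "q = cot_gram \<epsilon> \<delta> \<phi> (side_gram \<delta> \<epsilon> a) (side_gram \<delta> \<epsilon> b)"
  shows "tri_angle \<epsilon> \<delta> \<phi> a b = acot_gen \<epsilon> q" "\<epsilon> = -1 \<Longrightarrow> 1 < q"
proof -
  have ab: "a \<in> J (\<delta> * \<epsilon>)" "b \<in> J (\<delta> * \<epsilon>)" using D unfolding Ddom_iff[OF d e \<phi>] by auto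
  define x y where "x = side_gram \<delta> \<epsilon> a" and "y = side_gram \<delta> \<epsilon> b"
  define z where "z = opp_gram \<epsilon> \<delta> \<phi> x y"
  note pos = side_gram_pos[OF ab(1) d e, folded x_def] side_gram_pos[OF ab(2) d e, folded y_def]
  note iff = gtri_iff[OF d e \<phi> ab x_def y_def z_def]
  have S: "0 < root_det \<epsilon> \<delta> \<phi> x y" by (rule root_det_pos[OF \<phi> d pos(2,4)])
  have qq: "q = (x * z - \<epsilon> * y) / root_det \<epsilon> \<delta> \<phi> x y"
    unfolding q cot_gram_def x_def y_def z_def ..
  have ang: "gangle \<epsilon> w2 w1 w3 = acot_gen \<epsilon> q \<and> (\<epsilon> = -1 \<longrightarrow> 1 < q)"
    if "gtri \<delta> \<epsilon> \<epsilon> w1 w2 w3 \<and> glen \<delta> \<epsilon> w1 w2 = a \<and> glen \<delta> \<epsilon> w1 w3 = b \<and> gangle \<delta> w1 w2 w3 = \<phi>"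
    for w1 w2 w3
  proof -
    from that[unfolded iff] have g: "gvertex \<delta> w1" "gvertex \<epsilon> w2" "gvertex \<epsilon> w3"
      and m: "x = - mink w1 w2" "y = - mink w1 w3" "z = - mink w2 w3" and z1: "\<epsilon> = -1 \<Longrightarrow> 1 < z" by auto
    have z0: "\<epsilon> = 0 \<Longrightarrow> 0 < z" using opp_gram_0_pos[OF pos(1,3) \<phi> d] by (simp add: z_def)
    show ?thesis
      using gangle_eq_acot_gen[OF g m pos(1,3,2) z0 z1 S root_det_square[OF d e pos(1,3,2,4) z_def]]
      unfolding qq by blast
  qed
  obtain w1 w2 w3 where w: "gtri \<delta> \<epsilon> \<epsilon> w1 w2 w3 \<and> glen \<delta> \<epsilon> w1 w2 = a \<and> glen \<delta> \<epsilon> w1 w3 = b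
      \<and> gangle \<delta> w1 w2 w3 = \<phi>" using D unfolding Ddom_def by blast
  show "\<epsilon> = -1 \<Longrightarrow> 1 < q" using ang[OF w] by blast
  show "tri_angle \<epsilon> \<delta> \<phi> a b = acot_gen \<epsilon> q"
    unfolding tri_angle_def
  proof (rule the_equality)
    show "\<exists>w1 w2 w3. gtri \<delta> \<epsilon> \<epsilon> w1 w2 w3 \<and> glen \<delta> \<epsilon> w1 w2 = a \<and> glen \<delta> \<epsilon> w1 w3 = b \<and>
        gangle \<delta> w1 w2 w3 = \<phi> \<and> gangle \<epsilon> w2 w1 w3 = acot_gen \<epsilon> q"
      using w ang[OF w] by blast
    show "\<alpha> = acot_gen \<epsilon> q" if "\<exists>w1 w2 w3. gtri \<delta> \<epsilon> \<epsilon> w1 w2 w3 \<and> glen \<delta> \<epsilon> w1 w2 = a \<and> glen \<delta> \<epsilon> w1 w3 = b \<and>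
        gangle \<delta> w1 w2 w3 = \<phi> \<and> gangle \<epsilon> w2 w1 w3 = \<alpha>" for \<alpha>
      using that ang by blast
  qed
qed

section \<open>Curvature as a function of the side lengths\<close>

definition curv :: "int \<Rightarrow> real \<Rightarrow> real \<Rightarrow> real" where
  "curv \<epsilon> h \<alpha> = 2 * interval_lebesgue_integral lborel (ereal 1) (ereal \<alpha>) (\<lambda>t. rho \<epsilon> t powr h)"

lemma rho_pos: "t \<in> Iopen \<epsilon> \<Longrightarrow> 0 < rho \<epsilon> t"
  by (auto simp: Iopen_def rho_def sin_gt_zero split: if_splits)

lemma open_Iopen: "open (Iopen \<epsilon>)"
  by (simp add: Iopen_def)

lemma smooth_on_subset:
  fixes f :: "'a::euclidean_space \<Rightarrow> 'b::euclidean_space"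
  assumes "smooth_on S f" "open T" "T \<subseteq> S"
  shows "smooth_on T f"
  using smooth_on_compose_linear[OF assms(1) bounded_linear_ident assms(2)] assms(3) by auto

lemma smooth_on_rho_powr: "smooth_on (Iopen \<epsilon>) (\<lambda>t. rho \<epsilon> t powr h)"
proof (rule smooth_on_compose[OF smooth_on_powr])
  have "smooth_on UNIV (rho \<epsilon>)"
  proof -
    consider "\<epsilon> = 1" | "\<epsilon> = 0" | "\<epsilon> \<noteq> 1" "\<epsilon> \<noteq> 0" by blast
    then show ?thesis
    proof cases
      case 1
      then have "rho \<epsilon> = sin" by (auto simp: rho_def)
      then show ?thesis using smooth_on_sin by simp
    next
      case 2
      then have "rho \<epsilon> = (\<lambda>t. t)" by (auto simp: rho_def)
      then show ?thesis using smooth_on_ident[of UNIV] by simp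
    next
      case 3
      then have "rho \<epsilon> = sinh" by (auto simp: rho_def)
      then show ?thesis using smooth_on_sinh by simp
    qed
  qed
  then show "smooth_on (Iopen \<epsilon>) (rho \<epsilon>)"
    by (rule smooth_on_subset[OF _ open_Iopen]) simp
qed (simp add: rho_pos)

lemma curv_deriv:
  assumes "t \<in> Iopen \<epsilon>"
  shows "(curv \<epsilon> h has_real_derivative 2 * rho \<epsilon> t powr h) (at t)"
proof -
  \<comment> \<open>The fundamental theorem is applied on a compact interval inside
    \<open>Iopen \<epsilon>\<close> that contains the base point 1 and has \<open>t\<close> in its
    interior; for \<epsilon> = 1 this uses \<open>1 < pi\<close>.\<close>
  obtain a b where ab: "a < t" "t < b" "a \<le> 1" "1 \<le> b" "{a..b} \<subseteq> Iopen \<epsilon>"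
  proof (cases "\<epsilon> = 1")
    case True
    show ?thesis
      by (rule that[of "min 1 t / 2" "(max 1 t + pi) / 2"])
        (use assms True pi_gt3 in \<open>auto simp: Iopen_def min_def max_def split: if_splits\<close>)
  next
    case False
    show ?thesis
      by (rule that[of "min 1 t / 2" "max 1 t + 1"])
        (use assms False in \<open>auto simp: Iopen_def min_def max_def split: if_splits\<close>)
  qed
  have "continuous_on {a..b} (\<lambda>t. rho \<epsilon> t powr h)"
  proof -
    obtain D where "\<forall>x\<in>Iopen \<epsilon>. ((\<lambda>t. rho \<epsilon> t powr h) has_derivative (\<lambda>v. D v x)) (at x)"
      using smooth_onD[OF smooth_on_rho_powr] by blast
    then have "continuous_on (Iopen \<epsilon>) (\<lambda>t. rho \<epsilon> t powr h)"
      by (blast intro: continuous_at_imp_continuous_on has_derivative_continuous)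
    then show ?thesis using ab(5) by (rule continuous_on_subset)
  qed
  from interval_integral_FTC2[OF ab(3,4) this, of t]
  have "((\<lambda>u. interval_lebesgue_integral lborel (ereal 1) (ereal u) (\<lambda>t. rho \<epsilon> t powr h))
      has_vector_derivative rho \<epsilon> t powr h) (at t within {a..b})"
    using ab by simp
  then have "((\<lambda>u. interval_lebesgue_integral lborel (ereal 1) (ereal u) (\<lambda>t. rho \<epsilon> t powr h))
      has_real_derivative rho \<epsilon> t powr h) (at t)"
    using ab(1,2) by (simp add: at_within_Icc_at has_real_derivative_iff_has_vector_derivative)
  then show ?thesis
    unfolding curv_def[abs_def] by (rule DERIV_cmult)
qed

lemma smooth_on_curv: "smooth_on (Iopen \<epsilon>) (curv \<epsilon> h)"
proof (rule smooth_on_antideriv)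
  show "smooth_on (Iopen \<epsilon>) (\<lambda>t. 2 * rho \<epsilon> t powr h)"
    by (intro smooth_on_mult smooth_on_const smooth_on_rho_powr open_Iopen)
qed (rule curv_deriv)

definition acot_dom :: "int \<Rightarrow> real set" where
  "acot_dom \<epsilon> = (if \<epsilon> = 1 then UNIV else if \<epsilon> = 0 then {0<..} else {1<..})"

lemma acot_gen_props:
  assumes e: "\<epsilon> \<in> {-1, 0, 1}"
  shows "smooth_on (acot_dom \<epsilon>) (acot_gen \<epsilon>)"
    and "q \<in> acot_dom \<epsilon> \<Longrightarrow> acot_gen \<epsilon> q \<in> Iopen \<epsilon>"
    and "q \<in> acot_dom \<epsilon> \<Longrightarrow> \<exists>d<0. (acot_gen \<epsilon> has_real_derivative d) (at q)"
proof -
  consider "\<epsilon> = 1" | "\<epsilon> = 0" | "\<epsilon> = -1" using e by auto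
  then have "smooth_on (acot_dom \<epsilon>) (acot_gen \<epsilon>) \<and> (\<forall>q\<in>acot_dom \<epsilon>. acot_gen \<epsilon> q \<in> Iopen \<epsilon> \<and>
    (\<exists>d<0. (acot_gen \<epsilon> has_real_derivative d) (at q)))"
  proof cases
    case 1
    have a: "acot_gen \<epsilon> = (\<lambda>q. pi / 2 - arctan q)" using 1 by (auto simp: acot_gen_def)
    have "smooth_on UNIV (\<lambda>q. pi / 2 - arctan q)"
      by (intro smooth_on_diff smooth_on_const smooth_on_arctan) simp
    moreover have "\<exists>d<0. ((\<lambda>q. pi / 2 - arctan q) has_real_derivative d) (at q)" for q
    proof (intro exI conjI)
      show "((\<lambda>q. pi / 2 - arctan q) has_real_derivative - (1 / (1 + q\<^sup>2))) (at q)"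
        by (auto intro!: derivative_eq_intros simp: inverse_eq_divide)
      show "- (1 / (1 + q\<^sup>2)) < 0" by (simp add: add_pos_nonneg)
    qed
    moreover have "pi / 2 - arctan q \<in> Iopen 1" for q
      using arctan_lbound[of q] arctan_ubound[of q] by (auto simp: Iopen_def)
    ultimately show ?thesis unfolding a using 1 by (auto simp: acot_dom_def)
  next
    case 2
    have a: "acot_gen \<epsilon> = (\<lambda>q. 2 / q)" using 2 by (auto simp: acot_gen_def)
    have "smooth_on {0<..} (\<lambda>q::real. 2 / q)"
      by (intro smooth_on_divide smooth_on_const smooth_on_ident) auto
    moreover have "\<exists>d<0. ((\<lambda>q. 2 / q) has_real_derivative d) (at q)" if "0 < q" for q :: real
    proof (intro exI conjI)
      show "((\<lambda>q. 2 / q) has_real_derivative - (2 / q\<^sup>2)) (at q)"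
        using that by (auto intro!: derivative_eq_intros simp: power2_eq_square)
      show "- (2 / q\<^sup>2) < 0" using that by simp
    qed
    moreover have "2 / q \<in> Iopen 0" if "0 < q" for q using that by (simp add: Iopen_def)
    ultimately show ?thesis unfolding a using 2 by (auto simp: acot_dom_def)
  next
    case 3
    have a: "acot_gen \<epsilon> = (\<lambda>q. ln ((q + 1) / (q - 1)) / 2)" using 3 by (auto simp: acot_gen_def)
    have "smooth_on {1<..} (\<lambda>q::real. (q + 1) / (q - 1))"
      by (intro smooth_on_divide smooth_on_add smooth_on_diff smooth_on_const smooth_on_ident) auto
    from smooth_on_compose[OF smooth_on_ln this]
    have "smooth_on {1<..} (\<lambda>q::real. ln ((q + 1) / (q - 1)))" by simp
    then have "smooth_on {1<..} (\<lambda>q::real. ln ((q + 1) / (q - 1)) / 2)"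
      by (rule smooth_on_divide) (auto intro: smooth_on_const)
    moreover have "\<exists>d<0. ((\<lambda>q. ln ((q + 1) / (q - 1)) / 2) has_real_derivative d) (at q)"
      if "1 < q" for q :: real
    proof (intro exI conjI)
      have "((\<lambda>q. (ln (q + 1) - ln (q - 1)) / 2) has_real_derivative (1 / (q + 1) - 1 / (q - 1)) / 2) (at q)"
        using that by (auto intro!: derivative_eq_intros)
      moreover have "(1 / (q + 1) - 1 / (q - 1)) / 2 = - (1 / ((q + 1) * (q - 1)))"
        using that by (simp add: diff_frac_eq)
      ultimately have "((\<lambda>q. (ln (q + 1) - ln (q - 1)) / 2) has_real_derivative - (1 / ((q + 1) * (q - 1)))) (at q)"
        by simp
      then show "((\<lambda>q. ln ((q + 1) / (q - 1)) / 2) has_real_derivative - (1 / ((q + 1) * (q - 1)))) (at q)"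
        by (rule has_field_derivative_transform_within_open[of _ _ _ "{1<..}"]) (use that in \<open>auto simp: ln_div\<close>)
      show "- (1 / ((q + 1) * (q - 1))) < 0" using that by simp
    qed
    moreover have "ln ((q + 1) / (q - 1)) / 2 \<in> Iopen (-1)" if "1 < q" for q
      using that by (simp add: Iopen_def)
    ultimately show ?thesis unfolding a using 3 by (auto simp: acot_dom_def)
  qed
  then show "smooth_on (acot_dom \<epsilon>) (acot_gen \<epsilon>)"
    and "q \<in> acot_dom \<epsilon> \<Longrightarrow> acot_gen \<epsilon> q \<in> Iopen \<epsilon>"
    and "q \<in> acot_dom \<epsilon> \<Longrightarrow> \<exists>d<0. (acot_gen \<epsilon> has_real_derivative d) (at q)" by blast+
qed

text \<open>\<open>rho\<close> is positive on \<open>Iopen \<epsilon>\<close>, hence so is its power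
  for every real \<open>h\<close>, and the sign is that of the derivative of
  \<open>acot_gen\<close>.\<close>

lemma curv_acot_deriv_neg:
  assumes e: "\<epsilon> \<in> {-1, 0, 1}" and q: "q \<in> acot_dom \<epsilon>"
  shows "\<exists>d<0. ((\<lambda>q. curv \<epsilon> h (acot_gen \<epsilon> q)) has_real_derivative d) (at q)"
proof -
  obtain d where d: "d < 0" "(acot_gen \<epsilon> has_real_derivative d) (at q)"
    using acot_gen_props(3)[OF e q] by blast
  have "acot_gen \<epsilon> q \<in> Iopen \<epsilon>" by (rule acot_gen_props(2)[OF e q])
  note c = curv_deriv[OF this, of h] and r = rho_pos[OF this]
  have "2 * rho \<epsilon> (acot_gen \<epsilon> q) powr h * d < 0"
    using d(1) r by (simp add: mult_pos_neg)
  with DERIV_chain2[OF c d(2)] show ?thesis by blast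
qed

text \<open>The interface between the computations by type and the maximum principle. For
  \<open>q = f u + g u * k v\<close> the partial derivatives are \<open>f' u + g' u * k v\<close>
  and \<open>g u * k' v\<close>. That \<open>q\<close> lies in \<open>acot_dom\<close> is automatic
  for \<epsilon> = 1, part of \<open>tri_angle_eq\<close> for \<epsilon> = -1 and supplied by
  \<open>pos0\<close> for \<epsilon> = 0.\<close>

lemma edge_dominant_Ddom:
  fixes U X f g k f' g' k' :: "real \<Rightarrow> real" and V :: "real set"
  assumes d: "\<delta> \<in> {-1, 0, 1}" and e: "\<epsilon> \<in> {-1, 0, 1}" and \<phi>: "\<phi> \<in> Iopen \<delta>"
    and U: "smooth_on (J (\<delta> * \<epsilon>)) U" "\<And>a. a \<in> J (\<delta> * \<epsilon>) \<Longrightarrow> (U has_real_derivative 1 / X a) (at a)"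
      "\<And>a. a \<in> J (\<delta> * \<epsilon>) \<Longrightarrow> 0 < X a"
    and W: "convex W" "open W" "W \<subseteq> V \<times> V"
    and smooth: "smooth_on V f" "smooth_on V g" "smooth_on V k"
    and deriv: "\<And>u. u \<in> V \<Longrightarrow> (f has_real_derivative f' u) (at u)"
      "\<And>u. u \<in> V \<Longrightarrow> (g has_real_derivative g' u) (at u)"
      "\<And>u. u \<in> V \<Longrightarrow> (k has_real_derivative k' u) (at u)"
    and dm: "\<And>u v. (u, v) \<in> W \<Longrightarrow> \<bar>g u * k' v\<bar> < f' u + g' u * k v"
    and mem: "\<And>a b. a \<in> J (\<delta> * \<epsilon>) \<Longrightarrow> b \<in> J (\<delta> * \<epsilon>) \<Longrightarrow> (U a, U b) \<in> W \<longleftrightarrow>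
      (\<epsilon> = -1 \<longrightarrow> 1 < opp_gram \<epsilon> \<delta> \<phi> (side_gram \<delta> \<epsilon> a) (side_gram \<delta> \<epsilon> b))"
    and cot: "\<And>a b. a \<in> J (\<delta> * \<epsilon>) \<Longrightarrow> b \<in> J (\<delta> * \<epsilon>) \<Longrightarrow>
      cot_gram \<epsilon> \<delta> \<phi> (side_gram \<delta> \<epsilon> a) (side_gram \<delta> \<epsilon> b) = f (U a) + g (U a) * k (U b)"
    and pos0: "\<And>a b. a \<in> J (\<delta> * \<epsilon>) \<Longrightarrow> b \<in> J (\<delta> * \<epsilon>) \<Longrightarrow> \<epsilon> = 0 \<Longrightarrow>
      0 < cot_gram \<epsilon> \<delta> \<phi> (side_gram \<delta> \<epsilon> a) (side_gram \<delta> \<epsilon> b)"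
  shows "edge_dominant U X (Ddom \<epsilon> \<delta> \<phi>) (\<lambda>a b. curv \<epsilon> h (tri_angle \<epsilon> \<delta> \<phi> a b))"
proof -
  let ?D = "Ddom \<epsilon> \<delta> \<phi>"
  have D: "?D = {(a, b). a \<in> J (\<delta> * \<epsilon>) \<and> b \<in> J (\<delta> * \<epsilon>) \<and> (U a, U b) \<in> W}"
    using Ddom_iff[OF d e \<phi>] mem by (auto simp del: mem_Times_iff)
  have UV: "U a \<in> V" "U b \<in> V" if "(a, b) \<in> ?D" for a b using that W(3) unfolding D by auto
  obtain F' where F': "\<And>q. q \<in> acot_dom \<epsilon> \<Longrightarrow> F' q < 0 \<and>
      ((\<lambda>q. curv \<epsilon> h (acot_gen \<epsilon> q)) has_real_derivative F' q) (at q)"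
    using curv_acot_deriv_neg[OF e, of _ h] by metis
  have q: "f (U a) + g (U a) * k (U b) \<in> acot_dom \<epsilon>" if ab: "(a, b) \<in> ?D" for a b
  proof -
    have J: "a \<in> J (\<delta> * \<epsilon>)" "b \<in> J (\<delta> * \<epsilon>)" using ab unfolding D by auto
    show ?thesis
      using tri_angle_eq(2)[OF d e \<phi> ab refl] pos0[OF J] e
      unfolding cot[OF J] by (auto simp: acot_dom_def)
  qed
  show ?thesis
  proof (rule edge_dominantI[OF U D W(1,2), where Q = "\<lambda>u v. f u + g u * k v"
        and A = "\<lambda>u v. f' u + g' u * k v" and B = "\<lambda>u v. g u * k' v" and I = "acot_dom \<epsilon>"
        and F = "\<lambda>q. curv \<epsilon> h (acot_gen \<epsilon> q)" and F' = F'])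
    have openD: "open ?D" unfolding D by (rule open_coord_domain[OF U(1,2) W(2)])
    have sU: "smooth_on ?D (\<lambda>p. U (fst p))" "smooth_on ?D (\<lambda>p. U (snd p))"
      by (rule smooth_on_compose_linear[OF U(1) _ openD]; auto simp: D bounded_linear_fst bounded_linear_snd)+
    show "smooth_on ?D (\<lambda>p. f (U (fst p)) + g (U (fst p)) * k (U (snd p)))"
      by (intro smooth_on_add smooth_on_mult smooth_on_compose[OF smooth(1) sU(1)]
          smooth_on_compose[OF smooth(2) sU(1)] smooth_on_compose[OF smooth(3) sU(2)]) (use UV in auto)
    show "((\<lambda>p. f (fst p) + g (fst p) * k (snd p)) has_derivative
        (\<lambda>p. (f' u + g' u * k v) * fst p + g u * k' v * snd p)) (at (u, v))" if "(u, v) \<in> W" for u v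
    proof -
      have uv: "u \<in> V" "v \<in> V" using that W(3) by auto
      have 1: "((\<lambda>p. G (fst p)) has_derivative (\<lambda>p. d * fst p)) (at (u, v))"
        if "(G has_real_derivative d) (at u)" for G d
        using has_derivative_compose[OF has_derivative_fst[OF has_derivative_ident], of G "(*) d" "(u, v)"]
          that unfolding has_field_derivative_def fst_conv by blast
      have 2: "((\<lambda>p. G (snd p)) has_derivative (\<lambda>p. d * snd p)) (at (u, v))"
        if "(G has_real_derivative d) (at v)" for G d
        using has_derivative_compose[OF has_derivative_snd[OF has_derivative_ident], of G "(*) d" "(u, v)"]
          that unfolding has_field_derivative_def snd_conv by blast
      show ?thesis
        by (rule has_derivative_eq_rhs[OF has_derivative_add[OF 1[OF deriv(1)[OF uv(1)]]
              has_derivative_mult[OF 1[OF deriv(2)[OF uv(1)]] 2[OF deriv(3)[OF uv(2)]]]]])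
          (auto simp: algebra_simps)
    qed
    show "is_interval (acot_dom \<epsilon>)" by (auto simp: acot_dom_def is_interval_1)
    show "smooth_on (acot_dom \<epsilon>) (\<lambda>q. curv \<epsilon> h (acot_gen \<epsilon> q))"
      by (rule smooth_on_compose[OF smooth_on_curv acot_gen_props(1)[OF e] acot_gen_props(2)[OF e]])
    show "curv \<epsilon> h (tri_angle \<epsilon> \<delta> \<phi> a b) = curv \<epsilon> h (acot_gen \<epsilon> (f (U a) + g (U a) * k (U b)))"
      if ab: "(a, b) \<in> ?D" for a b
    proof -
      have J: "a \<in> J (\<delta> * \<epsilon>)" "b \<in> J (\<delta> * \<epsilon>)" using ab unfolding D by auto
      show ?thesis using tri_angle_eq(1)[OF d e \<phi> ab refl] unfolding cot[OF J] by simp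
    qed
  qed (use dm q F' in auto)
qed

section \<open>Coordinates on the radii and domination for each type\<close>

lemma convex_open_sum_gt:
  fixes V :: "real set"
  assumes "convex V" "open V"
  shows "convex ({p. c < fst p + snd p} \<inter> V \<times> V)" "open ({p. c < fst p + snd p} \<inter> V \<times> V)"
proof -
  have "{p::real \<times> real. c < fst p + snd p} = {p. (1, 1) \<bullet> p > c}"
    by (auto simp: inner_prod_def)
  then have "convex {p::real \<times> real. c < fst p + snd p}"
    using convex_halfspace_gt[of c "(1::real, 1::real)"] by simp
  then show "convex ({p. c < fst p + snd p} \<inter> V \<times> V)"
    using assms by (intro convex_Int convex_Times)
  have "open {p::real \<times> real. c < fst p + snd p}"
    by (intro open_Collect_less continuous_intros)
  then show "open ({p. c < fst p + snd p} \<inter> V \<times> V)"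
    using assms by (intro open_Int open_Times)
qed

text \<open>The coordinates for \<open>\<delta> \<epsilon> = 1\<close> and \<open>\<delta> \<epsilon> = -1\<close>; for \<open>\<delta> \<epsilon> = 0\<close> the coordinate is \<open>- exp (- a)\<close>.\<close>

definition csch_coord :: "real \<Rightarrow> real" where
  "csch_coord a = ln ((cosh a - 1) / sinh a)"

definition sech_coord :: "real \<Rightarrow> real" where
  "sech_coord a = arctan (sinh a)"

text \<open>The argument of the logarithm is \<open>tanh (a / 2)\<close>, and
  \<open>u = csch_coord a\<close> is the negative solution of
  \<open>sinh u * sinh a = -1\<close>.\<close>

lemma csch_coord_props:
  assumes a: "0 < a"
  shows "sinh (csch_coord a) = - 1 / sinh a" "cosh (csch_coord a) = cosh a / sinh a" "csch_coord a < 0"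
    "(csch_coord has_real_derivative 1 / sinh a) (at a)"
proof -
  define S C where "S = sinh a" and "C = cosh a"
  have SC: "0 < S" "1 < C" "S * S = (C - 1) * (C + 1)"
    using a cosh_gt_1[OF a] cosh_square_eq[of a] by (auto simp: S_def C_def power2_eq_square algebra_simps)
  define t where "t = (C - 1) / S"
  have t: "0 < t" "inverse t = (C + 1) / S"
    using SC by (simp_all add: t_def field_simps)
  have u: "csch_coord a = ln t" by (simp add: csch_coord_def t_def S_def C_def)
  show sh: "sinh (csch_coord a) = - 1 / sinh a"
    unfolding u sinh_ln_real[OF t(1)] t(2) unfolding t_def S_def[symmetric] using SC by (simp add: field_simps)
  show "cosh (csch_coord a) = cosh a / sinh a"
    unfolding u cosh_ln_real[OF t(1)] t(2) unfolding t_def S_def[symmetric] C_def[symmetric]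
    using SC by (simp add: field_simps)
  have "sinh (csch_coord a) < 0" unfolding sh using SC by (simp add: S_def)
  then show "csch_coord a < 0" by simp
  have "(csch_coord has_real_derivative (S * S - (C - 1) * C) / (S * S) / t) (at a)"
    unfolding csch_coord_def[abs_def] using SC(1,2)
    by (auto intro!: derivative_eq_intros simp: t_def S_def[symmetric] C_def[symmetric])
  moreover have "(S * S - (C - 1) * C) / (S * S) / t = 1 / S"
  proof -
    have "S * S - (C - 1) * C = C - 1" using SC(3) by algebra
    then show ?thesis unfolding t_def using SC(1,2) by simp
  qed
  ultimately show "(csch_coord has_real_derivative 1 / sinh a) (at a)" by (simp add: S_def)
qed

text \<open>\<open>sech_coord\<close> is the Gudermannian function, which exchanges
  \<open>sinh a\<close> with \<open>tan u\<close>.\<close>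

lemma sech_coord_props:
  shows "sin (sech_coord a) = sinh a / cosh a" "cos (sech_coord a) = 1 / cosh a"
    "0 < a \<Longrightarrow> sech_coord a \<in> {0<..<pi/2}" "(sech_coord has_real_derivative 1 / cosh a) (at a)"
proof -
  have c: "sqrt (1 + (sinh a)\<^sup>2) = cosh a"
    using cosh_square_eq[of a] cosh_real_pos[of a] by (intro real_sqrt_unique) auto
  show "sin (sech_coord a) = sinh a / cosh a" "cos (sech_coord a) = 1 / cosh a"
    by (simp_all add: sech_coord_def sin_arctan cos_arctan c)
  show "0 < a \<Longrightarrow> sech_coord a \<in> {0<..<pi/2}"
    using arctan_ubound[of "sinh a"] by (simp add: sech_coord_def)
  have "(sech_coord has_real_derivative cosh a / (1 + (sinh a)\<^sup>2)) (at a)"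
    unfolding sech_coord_def[abs_def] by (auto intro!: derivative_eq_intros simp: inverse_eq_divide)
  moreover have "1 + (sinh a)\<^sup>2 = (cosh a)\<^sup>2" by (simp add: cosh_square_eq)
  then have "cosh a / (1 + (sinh a)\<^sup>2) = 1 / cosh a" by (simp add: power2_eq_square)
  ultimately show "(sech_coord has_real_derivative 1 / cosh a) (at a)" by simp
qed

lemma smooth_on_csch_coord: "smooth_on {0<..} csch_coord"
proof (rule smooth_on_antideriv)
  show "smooth_on {0<..} (\<lambda>a. 1 / sinh a :: real)"
    by (intro smooth_on_divide smooth_on_const smooth_on_subset[OF smooth_on_sinh]) auto
qed (simp add: csch_coord_props)

lemma smooth_on_sech_coord: "smooth_on {0<..} sech_coord"
proof (rule smooth_on_antideriv)
  show "smooth_on {0<..} (\<lambda>a. 1 / cosh a :: real)"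
    by (intro smooth_on_divide smooth_on_const smooth_on_subset[OF smooth_on_cosh]) (auto simp: cosh_real_pos)
qed (simp add: sech_coord_props)

lemma exp_coord_props:
  "smooth_on UNIV (\<lambda>a::real. - exp (- a))"
  "((\<lambda>a. - exp (- a)) has_real_derivative 1 / exp a) (at a)"
proof -
  show "smooth_on UNIV (\<lambda>a::real. - exp (- a))"
    by (intro smooth_on_uminus smooth_on_compose[OF smooth_on_exp] smooth_on_ident) auto
  show "((\<lambda>a. - exp (- a)) has_real_derivative 1 / exp a) (at a)"
    by (auto intro!: derivative_eq_intros simp: exp_minus inverse_eq_divide)
qed

lemma smooth_on_divide_neg:
  fixes f g :: "'a::euclidean_space \<Rightarrow> real"
  assumes "smooth_on S f" "smooth_on S g" "\<And>x. x \<in> S \<Longrightarrow> g x < 0"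
  shows "smooth_on S (\<lambda>x. f x / g x)"
  using smooth_on_divide[OF smooth_on_uminus[OF assms(1)] smooth_on_uminus[OF assms(2)]] assms(3) by simp

text \<open>In each of the following six cases \<open>cot_gram\<close> is \<open>f u + g u * k v\<close> in the coordinates \<open>u\<close>, \<open>v\<close>, and
  the difference of the two sides of the domination inequality has the sign of
  \<open>cosh (u - v) - cos \<phi>\<close> for \<open>\<epsilon> = \<delta> = 1\<close>, and of the analogous expressions in the other cases.\<close>

lemma edge_dominant_1_1:
  assumes \<phi>: "\<phi> \<in> Iopen 1"
  shows "edge_dominant csch_coord sinh (Ddom 1 1 \<phi>) (\<lambda>a b. curv 1 h (tri_angle 1 1 \<phi> a b))"
proof -
  define s k where "s = sin \<phi>" and "k = cos \<phi>"
  have s: "0 < s" and k: "k < 1" using \<phi> by (auto simp: s_def k_def Iopen_def sin_gt_zero cos_less_1)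
  let ?V = "{..<0::real}"
  have S: "smooth_on ?V sinh" "smooth_on ?V cosh"
    by (auto intro: smooth_on_subset smooth_on_sinh smooth_on_cosh)
  have W: "convex (?V \<times> ?V)" "open (?V \<times> ?V)" by (auto intro: convex_Times open_Times)
  show ?thesis
  proof (rule edge_dominant_Ddom[where W = "?V \<times> ?V" and V = ?V and f = "\<lambda>u. (k / s) * cosh u / sinh u"
        and g = "\<lambda>u. (- 1 / s) / sinh u" and k = cosh and f' = "\<lambda>u. (k / s) * (- 1 / (sinh u)\<^sup>2)"
        and g' = "\<lambda>u. (1 / s) * cosh u / (sinh u)\<^sup>2" and k' = sinh, OF _ _ \<phi>])
    show "smooth_on ?V (\<lambda>u. (k / s) * cosh u / sinh u)" "smooth_on ?V (\<lambda>u. (- 1 / s) / sinh u)"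
      by (intro smooth_on_divide_neg smooth_on_mult smooth_on_const S; simp)+
    fix u v :: real
    have hs: "(cosh u)\<^sup>2 = (sinh u)\<^sup>2 + 1" for u :: real by (rule cosh_square_eq)
    show "((\<lambda>u. (k / s) * cosh u / sinh u) has_real_derivative (k / s) * (- 1 / (sinh u)\<^sup>2)) (at u)" if "u \<in> ?V"
    proof -
      have "((\<lambda>u. (k / s) * (cosh u / sinh u)) has_real_derivative
          (k / s) * ((sinh u * sinh u - cosh u * cosh u) / (sinh u * sinh u))) (at u)"
        using that by (intro DERIV_cmult) (auto intro!: derivative_eq_intros)
      moreover have "sinh u * sinh u - cosh u * cosh u = - 1" using hs[of u] by (simp add: power2_eq_square)
      ultimately show ?thesis by (simp add: power2_eq_square)
    qed
    show "((\<lambda>u. (- 1 / s) / sinh u) has_real_derivative (1 / s) * cosh u / (sinh u)\<^sup>2) (at u)" if "u \<in> ?V"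
      using that s by (auto intro!: derivative_eq_intros simp: power2_eq_square field_simps)
    show "\<bar>(- 1 / s) / sinh u * sinh v\<bar> < (k / s) * (- 1 / (sinh u)\<^sup>2) + (1 / s) * cosh u / (sinh u)\<^sup>2 * cosh v"
      if "(u, v) \<in> ?V \<times> ?V"
    proof -
      have uv: "sinh u < 0" "sinh v < 0" using that by auto
      then have "\<bar>(- 1 / s) / sinh u * sinh v\<bar> = (sinh u * sinh v) / (s * (sinh u)\<^sup>2)"
        using s by (simp add: abs_mult power2_eq_square)
      also have "\<dots> < (cosh u * cosh v - k) / (s * (sinh u)\<^sup>2)"
        using s uv k cosh_real_ge_1[of "u - v"] by (intro divide_strict_right_mono) (auto simp: cosh_diff)
      also have "\<dots> = (k / s) * (- 1 / (sinh u)\<^sup>2) + (1 / s) * cosh u / (sinh u)\<^sup>2 * cosh v"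
        using s uv by (simp add: field_simps)
      finally show ?thesis .
    qed
    fix a b :: real assume "a \<in> J (1 * 1)" "b \<in> J (1 * 1)"
    then have ab: "0 < a" "0 < b" by (simp_all add: J_def)
    define X Y where "X = sinh a" and "Y = sinh b"
    have XY: "0 < X" "0 < Y" "sqrt ((cosh a)\<^sup>2 - 1) = X" "sqrt ((cosh b)\<^sup>2 - 1) = Y" "(cosh a)\<^sup>2 = X\<^sup>2 + 1"
      using ab by (simp_all add: X_def Y_def cosh_square_eq)
    show "cot_gram 1 1 \<phi> (side_gram 1 1 a) (side_gram 1 1 b) =
        (k / s) * cosh (csch_coord a) / sinh (csch_coord a) + (- 1 / s) / sinh (csch_coord a) * cosh (csch_coord b)"
    proof -
      have "cot_gram 1 1 \<phi> (side_gram 1 1 a) (side_gram 1 1 b) =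
          (cosh a * (cosh a * cosh b - k * (X * Y)) - cosh b) / (s * (X * Y))"
        by (simp add: cot_gram_def root_det_def opp_gram_def side_gram_def XY(3,4) s_def k_def)
      also have "cosh a * (cosh a * cosh b - k * (X * Y)) - cosh b = X * X * cosh b - k * (cosh a * X * Y)"
        using XY(5) by algebra
      also have "\<dots> / (s * (X * Y)) = (X * (cosh b / Y) - k * cosh a) / s"
        using XY(1,2) s by (simp add: field_simps)
      finally show ?thesis
        unfolding csch_coord_props[OF ab(1)] csch_coord_props[OF ab(2)] X_def[symmetric] Y_def[symmetric]
        using XY(1,2) s by (simp add: field_simps)
    qed
  qed (use csch_coord_props(3,4) smooth_on_csch_coord W S in
      \<open>auto simp: J_def intro!: derivative_eq_intros\<close>)
qed

text \<open>The existence condition \<open>1 < z\<close> and the domination inequality are both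
  \<open>cosh (u + v) < cosh \<phi>\<close>. As \<open>u\<close> and \<open>v\<close> are negative,
  this is the half-plane \<open>- \<phi> < u + v\<close>.\<close>

lemma edge_dominant_m1_m1:
  assumes \<phi>: "\<phi> \<in> Iopen (-1)"
  shows "edge_dominant csch_coord sinh (Ddom (-1) (-1) \<phi>) (\<lambda>a b. curv (-1) h (tri_angle (-1) (-1) \<phi> a b))"
proof -
  define s k where "s = sinh \<phi>" and "k = cosh \<phi>"
  have \<phi>0: "0 < \<phi>" using \<phi> by (simp add: Iopen_def)
  have s: "0 < s" using \<phi>0 by (simp add: s_def)
  let ?V = "{..<0::real}"
  let ?W = "{p. - \<phi> < fst p + snd p} \<inter> ?V \<times> ?V"
  have S: "smooth_on ?V sinh" "smooth_on ?V cosh"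
    by (auto intro: smooth_on_subset smooth_on_sinh smooth_on_cosh)
  have W: "convex ?W" "open ?W" using convex_open_sum_gt[of ?V "- \<phi>"] by simp_all
  have less_iff: "- \<phi> < u + v \<longleftrightarrow> cosh (u + v) < k" if "u < 0" "v < 0" for u v
  proof -
    have "- \<phi> < u + v \<longleftrightarrow> - (u + v) < \<phi>" by auto
    also have "\<dots> \<longleftrightarrow> cosh (- (u + v)) < cosh \<phi>"
      using that \<phi>0 by (subst cosh_real_nonneg_less_iff) auto
    finally show ?thesis unfolding cosh_minus k_def .
  qed
  show ?thesis
  proof (rule edge_dominant_Ddom[where W = ?W and V = ?V and f = "\<lambda>u. (- k / s) * cosh u / sinh u"
        and g = "\<lambda>u. (1 / s) / sinh u" and k = cosh and f' = "\<lambda>u. (k / s) * (1 / (sinh u)\<^sup>2)"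
        and g' = "\<lambda>u. (- 1 / s) * cosh u / (sinh u)\<^sup>2" and k' = sinh, OF _ _ \<phi>])
    show "smooth_on ?V (\<lambda>u. (- k / s) * cosh u / sinh u)" "smooth_on ?V (\<lambda>u. (1 / s) / sinh u)"
      by (intro smooth_on_divide_neg smooth_on_mult smooth_on_const S; simp)+
    fix u v :: real
    have hs: "(cosh u)\<^sup>2 = (sinh u)\<^sup>2 + 1" for u :: real by (rule cosh_square_eq)
    show "((\<lambda>u. (- k / s) * cosh u / sinh u) has_real_derivative (k / s) * (1 / (sinh u)\<^sup>2)) (at u)" if "u \<in> ?V"
    proof -
      have "((\<lambda>u. (- k / s) * (cosh u / sinh u)) has_real_derivative
          (- k / s) * ((sinh u * sinh u - cosh u * cosh u) / (sinh u * sinh u))) (at u)"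
        using that by (intro DERIV_cmult) (auto intro!: derivative_eq_intros)
      moreover have "sinh u * sinh u - cosh u * cosh u = - 1" using hs[of u] by (simp add: power2_eq_square)
      ultimately show ?thesis by (simp add: power2_eq_square)
    qed
    show "((\<lambda>u. (1 / s) / sinh u) has_real_derivative (- 1 / s) * cosh u / (sinh u)\<^sup>2) (at u)" if "u \<in> ?V"
      using that s by (auto intro!: derivative_eq_intros simp: power2_eq_square field_simps)
    show "\<bar>(1 / s) / sinh u * sinh v\<bar> < (k / s) * (1 / (sinh u)\<^sup>2) + (- 1 / s) * cosh u / (sinh u)\<^sup>2 * cosh v"
      if "(u, v) \<in> ?W"
    proof -
      have uv: "sinh u < 0" "sinh v < 0" using that by auto
      then have "\<bar>(1 / s) / sinh u * sinh v\<bar> = (sinh u * sinh v) / (s * (sinh u)\<^sup>2)"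
        using s by (simp add: abs_mult power2_eq_square)
      also have "\<dots> < (k - cosh u * cosh v) / (s * (sinh u)\<^sup>2)"
        using s uv less_iff[of u v] that by (intro divide_strict_right_mono) (auto simp: cosh_add)
      also have "\<dots> = (k / s) * (1 / (sinh u)\<^sup>2) + (- 1 / s) * cosh u / (sinh u)\<^sup>2 * cosh v"
        using s uv by (simp add: field_simps)
      finally show ?thesis .
    qed
    fix a b :: real assume "a \<in> J (- 1 * - 1)" "b \<in> J (- 1 * - 1)"
    then have ab: "0 < a" "0 < b" by (simp_all add: J_def)
    define X Y where "X = sinh a" and "Y = sinh b"
    have XY: "0 < X" "0 < Y" "sqrt ((cosh a)\<^sup>2 - 1) = X" "sqrt ((cosh b)\<^sup>2 - 1) = Y" "(cosh a)\<^sup>2 = X\<^sup>2 + 1"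
      using ab by (simp_all add: X_def Y_def cosh_square_eq)
    have opp: "opp_gram (-1) (-1) \<phi> (side_gram (-1) (-1) a) (side_gram (-1) (-1) b) = k * (X * Y) - cosh a * cosh b"
      by (simp add: opp_gram_def side_gram_def XY(3,4) k_def)
    show "cot_gram (-1) (-1) \<phi> (side_gram (-1) (-1) a) (side_gram (-1) (-1) b) =
        (- k / s) * cosh (csch_coord a) / sinh (csch_coord a) + (1 / s) / sinh (csch_coord a) * cosh (csch_coord b)"
    proof -
      have "cot_gram (-1) (-1) \<phi> (side_gram (-1) (-1) a) (side_gram (-1) (-1) b) =
          (cosh a * (k * (X * Y) - cosh a * cosh b) + cosh b) / (s * (X * Y))"
        unfolding cot_gram_def opp by (simp add: root_det_def side_gram_def XY(3,4) s_def)
      also have "cosh a * (k * (X * Y) - cosh a * cosh b) + cosh b = k * (cosh a * X * Y) - X * X * cosh b"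
        using XY(5) by algebra
      also have "\<dots> / (s * (X * Y)) = (k * cosh a - X * (cosh b / Y)) / s"
        using XY(1,2) s by (simp add: field_simps)
      finally show ?thesis
        unfolding csch_coord_props[OF ab(1)] csch_coord_props[OF ab(2)] X_def[symmetric] Y_def[symmetric]
        using XY(1,2) s by (simp add: field_simps)
    qed
    show "(csch_coord a, csch_coord b) \<in> ?W \<longleftrightarrow> (- 1 = (- 1 :: int) \<longrightarrow>
        1 < opp_gram (-1) (-1) \<phi> (side_gram (-1) (-1) a) (side_gram (-1) (-1) b))"
    proof -
      have neg: "csch_coord a < 0" "csch_coord b < 0" using csch_coord_props(3) ab by auto
      then have "(csch_coord a, csch_coord b) \<in> ?W \<longleftrightarrow> cosh (csch_coord a + csch_coord b) < k"
        using less_iff by simp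
      also have "cosh (csch_coord a + csch_coord b) = (cosh a * cosh b + 1) / (X * Y)"
        unfolding cosh_add csch_coord_props[OF ab(1)] csch_coord_props[OF ab(2)] X_def[symmetric] Y_def[symmetric]
        using XY(1,2) by (simp add: field_simps)
      also have "(cosh a * cosh b + 1) / (X * Y) < k \<longleftrightarrow> 1 < k * (X * Y) - cosh a * cosh b"
        using XY(1,2) by (simp add: pos_divide_less_eq) linarith
      finally show ?thesis unfolding opp by simp
    qed
  qed (use csch_coord_props(3,4) smooth_on_csch_coord W S in
      \<open>auto simp: J_def intro!: derivative_eq_intros\<close>)
qed

lemma sech_derivs:
  fixes u :: real
  assumes "cos u \<noteq> 0"
  shows "((\<lambda>u. c * sin u / cos u) has_real_derivative c * (1 / (cos u)\<^sup>2)) (at u)"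
    "((\<lambda>u. c / cos u) has_real_derivative c * sin u / (cos u)\<^sup>2) (at u)"
proof -
  have "((\<lambda>u. c * (sin u / cos u)) has_real_derivative
      c * ((cos u * cos u - sin u * - sin u) / (cos u * cos u))) (at u)"
    using assms by (intro DERIV_cmult) (auto intro!: derivative_eq_intros)
  moreover have "cos u * cos u - sin u * - sin u = 1"
    using sin_cos_squared_add[of u] by (simp add: power2_eq_square)
  ultimately show "((\<lambda>u. c * sin u / cos u) has_real_derivative c * (1 / (cos u)\<^sup>2)) (at u)"
    by (simp add: power2_eq_square)
  show "((\<lambda>u. c / cos u) has_real_derivative c * sin u / (cos u)\<^sup>2) (at u)"
    using assms by (auto intro!: derivative_eq_intros simp: power2_eq_square field_simps)
qed

text \<open>Domination amounts to \<open>cos (u - v) < cosh \<phi>\<close>, and the right-hand side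
  exceeds 1.\<close>

lemma edge_dominant_1_m1:
  assumes \<phi>: "\<phi> \<in> Iopen (-1)"
  shows "edge_dominant sech_coord cosh (Ddom 1 (-1) \<phi>) (\<lambda>a b. curv 1 h (tri_angle 1 (-1) \<phi> a b))"
proof -
  define s k where "s = sinh \<phi>" and "k = cosh \<phi>"
  have s: "0 < s" and k: "1 < k" using \<phi> by (auto simp: s_def k_def Iopen_def cosh_gt_1)
  let ?V = "{0<..<pi/2}"
  have S: "smooth_on ?V sin" "smooth_on ?V cos"
    by (auto intro: smooth_on_subset smooth_on_sin smooth_on_cos)
  have W: "convex (?V \<times> ?V)" "open (?V \<times> ?V)" by (auto intro: convex_Times open_Times)
  have c: "0 < cos u" if "u \<in> ?V" for u using that by (simp add: cos_gt_zero)
  show ?thesis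
  proof (rule edge_dominant_Ddom[where W = "?V \<times> ?V" and V = ?V and f = "\<lambda>u. (k / s) * sin u / cos u"
        and g = "\<lambda>u. (- 1 / s) / cos u" and k = sin and f' = "\<lambda>u. (k / s) * (1 / (cos u)\<^sup>2)"
        and g' = "\<lambda>u. (- 1 / s) * sin u / (cos u)\<^sup>2" and k' = cos, OF _ _ \<phi>])
    show "smooth_on ?V (\<lambda>u. (k / s) * sin u / cos u)" "smooth_on ?V (\<lambda>u. (- 1 / s) / cos u)"
      by (intro smooth_on_divide smooth_on_mult smooth_on_const S c; simp)+
    fix u v :: real
    show "((\<lambda>u. (k / s) * sin u / cos u) has_real_derivative (k / s) * (1 / (cos u)\<^sup>2)) (at u)"
      "((\<lambda>u. (- 1 / s) / cos u) has_real_derivative (- 1 / s) * sin u / (cos u)\<^sup>2) (at u)" if "u \<in> ?V"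
      by (rule sech_derivs; use c[OF that] in simp)+
    show "\<bar>(- 1 / s) / cos u * cos v\<bar> < (k / s) * (1 / (cos u)\<^sup>2) + (- 1 / s) * sin u / (cos u)\<^sup>2 * sin v"
      if "(u, v) \<in> ?V \<times> ?V"
    proof -
      have uv: "0 < cos u" "0 < cos v" using that c by auto
      then have "\<bar>(- 1 / s) / cos u * cos v\<bar> = (cos u * cos v) / (s * (cos u)\<^sup>2)"
        using s by (simp add: abs_mult power2_eq_square)
      also have "\<dots> < (k - sin u * sin v) / (s * (cos u)\<^sup>2)"
        using s uv k cos_le_one[of "u - v"] by (intro divide_strict_right_mono) (auto simp: cos_diff)
      also have "\<dots> = (k / s) * (1 / (cos u)\<^sup>2) + (- 1 / s) * sin u / (cos u)\<^sup>2 * sin v"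
        using s uv by (simp add: field_simps)
      finally show ?thesis .
    qed
    fix a b :: real assume "a \<in> J (- 1 * 1)" "b \<in> J (- 1 * 1)"
    then have ab: "0 < a" "0 < b" by (simp_all add: J_def)
    show "(sech_coord a, sech_coord b) \<in> ?V \<times> ?V \<longleftrightarrow>
      (1 = (- 1 :: int) \<longrightarrow> 1 < opp_gram 1 (- 1) \<phi> (side_gram (- 1) 1 a) (side_gram (- 1) 1 b))"
      using sech_coord_props(3) ab by simp
    define X Y where "X = cosh a" and "Y = cosh b"
    have XY: "0 < X" "0 < Y" "sqrt ((sinh a)\<^sup>2 + 1) = X" "sqrt ((sinh b)\<^sup>2 + 1) = Y" "(sinh a)\<^sup>2 = X\<^sup>2 - 1"
      by (simp_all add: X_def Y_def cosh_real_pos sinh_square_eq)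
    have XY': "sqrt (1 + (sinh a)\<^sup>2) = X" "sqrt (1 + (sinh b)\<^sup>2) = Y"
      using XY(3,4) by (simp_all only: add.commute[of 1])
    show "cot_gram 1 (-1) \<phi> (side_gram (-1) 1 a) (side_gram (-1) 1 b) =
        (k / s) * sin (sech_coord a) / cos (sech_coord a) + (- 1 / s) / cos (sech_coord a) * sin (sech_coord b)"
    proof -
      have "cot_gram 1 (-1) \<phi> (side_gram (-1) 1 a) (side_gram (-1) 1 b) =
          (sinh a * (k * (X * Y) - sinh a * sinh b) - sinh b) / (s * (X * Y))"
        by (simp add: cot_gram_def root_det_def opp_gram_def side_gram_def XY(3,4) XY' s_def k_def)
      also have "sinh a * (k * (X * Y) - sinh a * sinh b) - sinh b = k * (sinh a * X * Y) - X * X * sinh b"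
        using XY(5) by algebra
      also have "\<dots> / (s * (X * Y)) = (k * sinh a - X * (sinh b / Y)) / s"
        using XY(1,2) s by (simp add: field_simps)
      finally show ?thesis
        unfolding sech_coord_props X_def[symmetric] Y_def[symmetric]
        using XY(1,2) s by (simp add: field_simps)
    qed
  qed (use sech_coord_props(4) smooth_on_sech_coord W S in
      \<open>auto simp: J_def cosh_real_pos intro!: derivative_eq_intros\<close>)
qed

text \<open>Existence and domination are both \<open>cos (u + v) < - cos \<phi>\<close>. Since
  \<open>u + v\<close> stays between 0 and \<open>pi\<close>, where \<open>cos\<close> decreases,
  this is the half-plane \<open>pi - \<phi> < u + v\<close>.\<close>

lemma edge_dominant_m1_1:
  assumes \<phi>: "\<phi> \<in> Iopen 1"
  shows "edge_dominant sech_coord cosh (Ddom (-1) 1 \<phi>) (\<lambda>a b. curv (-1) h (tri_angle (-1) 1 \<phi> a b))"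
proof -
  define s k where "s = sin \<phi>" and "k = cos \<phi>"
  have \<phi>0: "0 < \<phi>" "\<phi> < pi" using \<phi> by (simp_all add: Iopen_def)
  have s: "0 < s" using \<phi>0 by (simp add: s_def sin_gt_zero)
  let ?V = "{0<..<pi/2}"
  let ?W = "{p. pi - \<phi> < fst p + snd p} \<inter> ?V \<times> ?V"
  have S: "smooth_on ?V sin" "smooth_on ?V cos"
    by (auto intro: smooth_on_subset smooth_on_sin smooth_on_cos)
  have W: "convex ?W" "open ?W" using convex_open_sum_gt[of ?V "pi - \<phi>"] by simp_all
  have c: "0 < cos u" if "u \<in> ?V" for u using that by (simp add: cos_gt_zero)
  have less_iff: "pi - \<phi> < u + v \<longleftrightarrow> cos (u + v) < - k" if "u \<in> ?V" "v \<in> ?V" for u v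
  proof -
    have "pi - \<phi> < u + v \<longleftrightarrow> cos (u + v) < cos (pi - \<phi>)"
      using that \<phi>0 by (subst cos_mono_less_eq) auto
    then show ?thesis by (simp add: k_def)
  qed
  show ?thesis
  proof (rule edge_dominant_Ddom[where W = ?W and V = ?V and f = "\<lambda>u. (- k / s) * sin u / cos u"
        and g = "\<lambda>u. (1 / s) / cos u" and k = sin and f' = "\<lambda>u. (- k / s) * (1 / (cos u)\<^sup>2)"
        and g' = "\<lambda>u. (1 / s) * sin u / (cos u)\<^sup>2" and k' = cos, OF _ _ \<phi>])
    show "smooth_on ?V (\<lambda>u. (- k / s) * sin u / cos u)" "smooth_on ?V (\<lambda>u. (1 / s) / cos u)"
      by (intro smooth_on_divide smooth_on_mult smooth_on_const S c; simp)+
    fix u v :: real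
    show "((\<lambda>u. (- k / s) * sin u / cos u) has_real_derivative (- k / s) * (1 / (cos u)\<^sup>2)) (at u)"
      "((\<lambda>u. (1 / s) / cos u) has_real_derivative (1 / s) * sin u / (cos u)\<^sup>2) (at u)" if "u \<in> ?V"
      by (rule sech_derivs; use c[OF that] in simp)+
    show "\<bar>(1 / s) / cos u * cos v\<bar> < (- k / s) * (1 / (cos u)\<^sup>2) + (1 / s) * sin u / (cos u)\<^sup>2 * sin v"
      if "(u, v) \<in> ?W"
    proof -
      have uv: "0 < cos u" "0 < cos v" using that c by auto
      then have "\<bar>(1 / s) / cos u * cos v\<bar> = (cos u * cos v) / (s * (cos u)\<^sup>2)"
        using s by (simp add: abs_mult power2_eq_square)
      also have "\<dots> < (sin u * sin v - k) / (s * (cos u)\<^sup>2)"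
        using s uv less_iff[of u v] that by (intro divide_strict_right_mono) (auto simp: cos_add)
      also have "\<dots> = (- k / s) * (1 / (cos u)\<^sup>2) + (1 / s) * sin u / (cos u)\<^sup>2 * sin v"
        using s uv by (simp add: field_simps)
      finally show ?thesis .
    qed
    fix a b :: real assume "a \<in> J (1 * - 1)" "b \<in> J (1 * - 1)"
    then have ab: "0 < a" "0 < b" by (simp_all add: J_def)
    define X Y where "X = cosh a" and "Y = cosh b"
    have XY: "0 < X" "0 < Y" "sqrt ((sinh a)\<^sup>2 + 1) = X" "sqrt ((sinh b)\<^sup>2 + 1) = Y" "(sinh a)\<^sup>2 = X\<^sup>2 - 1"
      by (simp_all add: X_def Y_def cosh_real_pos sinh_square_eq)
    have opp: "opp_gram (-1) 1 \<phi> (side_gram 1 (-1) a) (side_gram 1 (-1) b) = sinh a * sinh b - k * (X * Y)"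
      by (simp add: opp_gram_def side_gram_def XY(3,4) k_def)
    show "cot_gram (-1) 1 \<phi> (side_gram 1 (-1) a) (side_gram 1 (-1) b) =
        (- k / s) * sin (sech_coord a) / cos (sech_coord a) + (1 / s) / cos (sech_coord a) * sin (sech_coord b)"
    proof -
      have "cot_gram (-1) 1 \<phi> (side_gram 1 (-1) a) (side_gram 1 (-1) b) =
          (sinh a * (sinh a * sinh b - k * (X * Y)) + sinh b) / (s * (X * Y))"
        unfolding cot_gram_def opp by (simp add: root_det_def side_gram_def XY(3,4) s_def)
      also have "sinh a * (sinh a * sinh b - k * (X * Y)) + sinh b = X * X * sinh b - k * (sinh a * X * Y)"
        using XY(5) by algebra
      also have "\<dots> / (s * (X * Y)) = (X * (sinh b / Y) - k * sinh a) / s"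
        using XY(1,2) s by (simp add: field_simps)
      finally show ?thesis
        unfolding sech_coord_props X_def[symmetric] Y_def[symmetric]
        using XY(1,2) s by (simp add: field_simps)
    qed
    show "(sech_coord a, sech_coord b) \<in> ?W \<longleftrightarrow> (- 1 = (- 1 :: int) \<longrightarrow>
        1 < opp_gram (-1) 1 \<phi> (side_gram 1 (-1) a) (side_gram 1 (-1) b))"
    proof -
      have mem: "sech_coord a \<in> ?V" "sech_coord b \<in> ?V" using sech_coord_props(3) ab by auto
      then have "(sech_coord a, sech_coord b) \<in> ?W \<longleftrightarrow> cos (sech_coord a + sech_coord b) < - k"
        using less_iff[OF mem] by auto
      also have "cos (sech_coord a + sech_coord b) = (1 - sinh a * sinh b) / (X * Y)"
        unfolding cos_add sech_coord_props X_def[symmetric] Y_def[symmetric]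
        using XY(1,2) by (simp add: field_simps)
      also have "(1 - sinh a * sinh b) / (X * Y) < - k \<longleftrightarrow> 1 < sinh a * sinh b - k * (X * Y)"
        using XY(1,2) by (simp add: pos_divide_less_eq) linarith
      finally show ?thesis unfolding opp by simp
    qed
  qed (use sech_coord_props(4) smooth_on_sech_coord W S in
      \<open>auto simp: J_def cosh_real_pos intro!: derivative_eq_intros\<close>)
qed

text \<open>With \<open>s = \<phi> / 2\<close>, domination amounts to
  \<open>0 < s^2 + (u - v)^2\<close>.\<close>

lemma edge_dominant_1_0:
  assumes \<phi>: "\<phi> \<in> Iopen 0"
  shows "edge_dominant (\<lambda>a. - exp (- a)) exp (Ddom 1 0 \<phi>) (\<lambda>a b. curv 1 h (tri_angle 1 0 \<phi> a b))"
proof -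
  define s where "s = \<phi> / 2"
  have s: "0 < s" "\<phi> = 2 * s" using \<phi> by (simp_all add: s_def Iopen_def)
  let ?V = "{..<0::real}"
  have W: "convex (?V \<times> ?V)" "open (?V \<times> ?V)" by (auto intro: convex_Times open_Times)
  show ?thesis
  proof (rule edge_dominant_Ddom[where W = "?V \<times> ?V" and V = ?V and f = "\<lambda>u. (- s / 2) / u + u / (2 * s)"
        and g = "\<lambda>u. (- 1 / (2 * s)) / u" and k = "\<lambda>v. v * v" and f' = "\<lambda>u. s / (2 * u\<^sup>2) + 1 / (2 * s)"
        and g' = "\<lambda>u. 1 / (2 * s * u\<^sup>2)" and k' = "\<lambda>v. 2 * v", OF _ _ \<phi>])
    show "smooth_on ?V (\<lambda>u. (- s / 2) / u + u / (2 * s))"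
      by (intro smooth_on_add smooth_on_divide_neg[of _ _ "\<lambda>u. u"] smooth_on_divide[of _ "\<lambda>u. u"]
          smooth_on_const smooth_on_ident) (use s in auto)
    show "smooth_on ?V (\<lambda>u. (- 1 / (2 * s)) / u)"
      by (intro smooth_on_divide_neg[of _ _ "\<lambda>u. u"] smooth_on_const smooth_on_ident) auto
    show "smooth_on ?V (\<lambda>v. v * v)" by (intro smooth_on_mult smooth_on_ident) auto
    fix u v :: real
    show "((\<lambda>u. (- s / 2) / u + u / (2 * s)) has_real_derivative s / (2 * u\<^sup>2) + 1 / (2 * s)) (at u)" if "u \<in> ?V"
      using that s(1) by (auto intro!: derivative_eq_intros simp: power2_eq_square)
    show "((\<lambda>u. (- 1 / (2 * s)) / u) has_real_derivative 1 / (2 * s * u\<^sup>2)) (at u)" if "u \<in> ?V"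
      using that s(1) by (auto intro!: derivative_eq_intros simp: power2_eq_square)
    show "\<bar>(- 1 / (2 * s)) / u * (2 * v)\<bar> < s / (2 * u\<^sup>2) + 1 / (2 * s) + 1 / (2 * s * u\<^sup>2) * (v * v)"
      if "(u, v) \<in> ?V \<times> ?V"
    proof -
      have uv: "u < 0" "v < 0" using that by auto
      then have "\<bar>(- 1 / (2 * s)) / u * (2 * v)\<bar> = (2 * u * v) / (2 * s * u\<^sup>2)"
        using s by (simp add: abs_mult power2_eq_square)
      also have "\<dots> < (s\<^sup>2 + u\<^sup>2 + v\<^sup>2) / (2 * s * u\<^sup>2)"
      proof (rule divide_strict_right_mono)
        have "0 < s\<^sup>2 + (u - v)\<^sup>2" using s by (simp add: add_pos_nonneg)
        then show "2 * u * v < s\<^sup>2 + u\<^sup>2 + v\<^sup>2" by (simp add: power2_eq_square algebra_simps)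
      qed (use s uv in simp)
      also have "\<dots> = s / (2 * u\<^sup>2) + 1 / (2 * s) + 1 / (2 * s * u\<^sup>2) * (v * v)"
        using s(1) uv by (simp add: field_simps power2_eq_square)
      finally show ?thesis .
    qed
    fix a b :: real
    show "(- exp (- a), - exp (- b)) \<in> ?V \<times> ?V \<longleftrightarrow>
      (1 = (- 1 :: int) \<longrightarrow> 1 < opp_gram 1 0 \<phi> (side_gram 0 1 a) (side_gram 0 1 b))" by simp
    define x y where "x = exp a" and "y = exp b"
    have xy: "0 < x" "0 < y" "exp (- a) = 1 / x" "exp (- b) = 1 / y"
      by (simp_all add: x_def y_def exp_minus inverse_eq_divide)
    show "cot_gram 1 0 \<phi> (side_gram 0 1 a) (side_gram 0 1 b) =
      (- s / 2) / - exp (- a) + - exp (- a) / (2 * s) + (- 1 / (2 * s)) / - exp (- a) * (- exp (- b) * - exp (- b))"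
    proof -
      have "cot_gram 1 0 \<phi> (side_gram 0 1 a) (side_gram 0 1 b) =
          (x * (x * y * (2 * s)\<^sup>2 / 8 + (x / y + y / x) / 2) - y) / (s * (x * y))"
        using xy(1,2) s by (simp add: cot_gram_def root_det_def opp_gram_def side_gram_def x_def y_def)
      also have "\<dots> = (- s / 2) / - (1 / x) + - (1 / x) / (2 * s) + (- 1 / (2 * s)) / - (1 / x) * (- (1 / y) * - (1 / y))"
        using xy(1,2) s(1) by (simp add: field_simps power2_eq_square)
      finally show ?thesis unfolding xy(3,4) .
    qed
  qed (use exp_coord_props W in \<open>auto simp: J_def intro!: derivative_eq_intros\<close>)
qed

text \<open>With \<open>s = \<phi> / 2\<close>, existence and domination are both
  \<open>(u + v)^2 < s^2\<close>, which for negative \<open>u\<close>, \<open>v\<close> is the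
  half-plane \<open>- s < u + v\<close>.\<close>

lemma edge_dominant_m1_0:
  assumes \<phi>: "\<phi> \<in> Iopen 0"
  shows "edge_dominant (\<lambda>a. - exp (- a)) exp (Ddom (-1) 0 \<phi>) (\<lambda>a b. curv (-1) h (tri_angle (-1) 0 \<phi> a b))"
proof -
  define s where "s = \<phi> / 2"
  have s: "0 < s" "\<phi> = 2 * s" using \<phi> by (simp_all add: s_def Iopen_def)
  let ?V = "{..<0::real}"
  let ?W = "{p. - s < fst p + snd p} \<inter> ?V \<times> ?V"
  have W: "convex ?W" "open ?W" using convex_open_sum_gt[of ?V "- s"] by simp_all
  have less_iff: "- s < u + v \<longleftrightarrow> (u + v)\<^sup>2 < s\<^sup>2" if "u < 0" "v < 0" for u v
  proof -
    have "(- (u + v))\<^sup>2 < s\<^sup>2 \<longleftrightarrow> - (u + v) < s"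
      using that s by (intro iffI power_strict_mono) (auto intro: power_less_imp_less_base)
    then have "(u + v)\<^sup>2 < s\<^sup>2 \<longleftrightarrow> - (u + v) < s" unfolding power2_minus .
    then show ?thesis by auto
  qed
  show ?thesis
  proof (rule edge_dominant_Ddom[where W = ?W and V = ?V and f = "\<lambda>u. (- s / 2) / u - u / (2 * s)"
        and g = "\<lambda>u. (1 / (2 * s)) / u" and k = "\<lambda>v. v * v" and f' = "\<lambda>u. s / (2 * u\<^sup>2) - 1 / (2 * s)"
        and g' = "\<lambda>u. - 1 / (2 * s * u\<^sup>2)" and k' = "\<lambda>v. 2 * v", OF _ _ \<phi>])
    show "smooth_on ?V (\<lambda>u. (- s / 2) / u - u / (2 * s))"
      by (intro smooth_on_diff smooth_on_divide_neg[of _ _ "\<lambda>u. u"] smooth_on_divide[of _ "\<lambda>u. u"]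
          smooth_on_const smooth_on_ident) (use s in auto)
    show "smooth_on ?V (\<lambda>u. (1 / (2 * s)) / u)"
      by (intro smooth_on_divide_neg[of _ _ "\<lambda>u. u"] smooth_on_const smooth_on_ident) auto
    show "smooth_on ?V (\<lambda>v. v * v)" by (intro smooth_on_mult smooth_on_ident) auto
    fix u v :: real
    show "((\<lambda>u. (- s / 2) / u - u / (2 * s)) has_real_derivative s / (2 * u\<^sup>2) - 1 / (2 * s)) (at u)" if "u \<in> ?V"
      using that s(1) by (auto intro!: derivative_eq_intros simp: power2_eq_square)
    show "((\<lambda>u. (1 / (2 * s)) / u) has_real_derivative - 1 / (2 * s * u\<^sup>2)) (at u)" if "u \<in> ?V"
      using that s(1) by (auto intro!: derivative_eq_intros simp: power2_eq_square)
    show "\<bar>(1 / (2 * s)) / u * (2 * v)\<bar> < s / (2 * u\<^sup>2) - 1 / (2 * s) + - 1 / (2 * s * u\<^sup>2) * (v * v)"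
      if "(u, v) \<in> ?W"
    proof -
      have uv: "u < 0" "v < 0" using that by auto
      then have "\<bar>(1 / (2 * s)) / u * (2 * v)\<bar> = (2 * u * v) / (2 * s * u\<^sup>2)"
        using s by (simp add: abs_mult power2_eq_square)
      also have "\<dots> < (s\<^sup>2 - u\<^sup>2 - v\<^sup>2) / (2 * s * u\<^sup>2)"
      proof (rule divide_strict_right_mono)
        have "(u + v)\<^sup>2 < s\<^sup>2" using less_iff[OF uv] that by simp
        then show "2 * u * v < s\<^sup>2 - u\<^sup>2 - v\<^sup>2" by (simp add: power2_eq_square algebra_simps)
      qed (use s uv in simp)
      also have "\<dots> = s / (2 * u\<^sup>2) - 1 / (2 * s) + - 1 / (2 * s * u\<^sup>2) * (v * v)"
        using s(1) uv by (simp add: field_simps power2_eq_square)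
      finally show ?thesis .
    qed
    fix a b :: real
    define x y where "x = exp a" and "y = exp b"
    have xy: "0 < x" "0 < y" "exp (- a) = 1 / x" "exp (- b) = 1 / y"
      by (simp_all add: x_def y_def exp_minus inverse_eq_divide)
    have opp: "opp_gram (-1) 0 \<phi> (side_gram 0 (-1) a) (side_gram 0 (-1) b) = x * y * s\<^sup>2 / 2 - (x / y + y / x) / 2"
      by (simp add: opp_gram_def side_gram_def x_def y_def s(2) power_mult_distrib mult.assoc
          del: minus_add_distrib)
    show "cot_gram (-1) 0 \<phi> (side_gram 0 (-1) a) (side_gram 0 (-1) b) =
      (- s / 2) / - exp (- a) - - exp (- a) / (2 * s) + (1 / (2 * s)) / - exp (- a) * (- exp (- b) * - exp (- b))"
    proof -
      have "cot_gram (-1) 0 \<phi> (side_gram 0 (-1) a) (side_gram 0 (-1) b) =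
          (x * (x * y * s\<^sup>2 / 2 - (x / y + y / x) / 2) + y) / (s * (x * y))"
        unfolding cot_gram_def opp using s by (simp add: root_det_def side_gram_def x_def y_def)
      also have "\<dots> = (- s / 2) / - (1 / x) - - (1 / x) / (2 * s) + (1 / (2 * s)) / - (1 / x) * (- (1 / y) * - (1 / y))"
        using xy(1,2) s(1) by (simp add: field_simps power2_eq_square)
      finally show ?thesis unfolding xy(3,4) .
    qed
    show "(- exp (- a), - exp (- b)) \<in> ?W \<longleftrightarrow> (- 1 = (- 1 :: int) \<longrightarrow>
        1 < opp_gram (-1) 0 \<phi> (side_gram 0 (-1) a) (side_gram 0 (-1) b))"
    proof -
      have "(- exp (- a), - exp (- b)) \<in> ?W \<longleftrightarrow> (1 / x + 1 / y)\<^sup>2 < s\<^sup>2"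
        using less_iff[of "- exp (- a)" "- exp (- b)"] xy(1,2)
        unfolding xy(3,4) by (simp add: power2_commute[of "- (1 / x)"] add.commute)
      also have "\<dots> \<longleftrightarrow> (1 / x + 1 / y)\<^sup>2 * (x * y / 2) < s\<^sup>2 * (x * y / 2)"
        using xy(1,2) by (subst mult_less_cancel_right_pos) auto
      also have "(1 / x + 1 / y)\<^sup>2 * (x * y / 2) = 1 + (x / y + y / x) / 2"
        using xy(1,2) by (simp add: field_simps power2_eq_square)
      finally show ?thesis unfolding opp by (auto simp: algebra_simps)
    qed
  qed (use exp_coord_props W in \<open>auto simp: J_def intro!: derivative_eq_intros\<close>)
qed

text \<open>For \<epsilon> = 0 both \<open>opp_gram\<close> and \<open>root_det\<close> are
  multiples of \<open>x * y\<close>, so the cotangent is a multiple of the own \<open>x\<close>.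
  With no dependence on the neighbour, domination is mere monotonicity.\<close>

lemma edge_dominant_0:
  assumes d: "\<delta> \<in> {-1, 0, 1}" and \<phi>: "\<phi> \<in> Iopen \<delta>"
  shows "edge_dominant (\<lambda>a. - exp (- a)) exp (Ddom 0 \<delta> \<phi>) (\<lambda>a b. curv 0 h (tri_angle 0 \<delta> \<phi> a b))"
proof -
  define \<kappa> where "\<kappa> = (if \<delta> = 0 then \<phi>\<^sup>2 / 8 else if \<delta> = 1 then 1 - cos \<phi> else cosh \<phi> - 1)"
  define \<sigma> where "\<sigma> = (if \<delta> = 0 then \<phi> / 2 else if \<delta> = 1 then sin \<phi> else sinh \<phi>)"
  \<comment> \<open>\<open>m\<close> is the factor that \<open>side_gram\<close> carries between two
    ideal vertices.\<close>
  define m :: real where "m = (if \<delta> = 0 then 2 else 1)"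
  have pos: "0 < \<kappa>" "0 < \<sigma>" "0 < m"
    using \<phi> by (auto simp: \<kappa>_def \<sigma>_def m_def Iopen_def cos_less_1 cosh_gt_1 sin_gt_zero split: if_splits)
  define C where "C = m * \<kappa> / \<sigma>"
  have C: "0 < C" using pos by (simp add: C_def)
  let ?V = "{..<0::real}"
  have W: "convex (?V \<times> ?V)" "open (?V \<times> ?V)" by (auto intro: convex_Times open_Times)
  have cot: "cot_gram 0 \<delta> \<phi> (side_gram \<delta> 0 a) (side_gram \<delta> 0 b) = C * exp a" for a b
  proof -
    have x: "side_gram \<delta> 0 a = m * exp a" for a by (simp add: side_gram_def m_def)
    have p: "0 < m * exp a" for a using pos by simp
    have "cot_gram 0 \<delta> \<phi> (side_gram \<delta> 0 a) (side_gram \<delta> 0 b) =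
      (m * exp a) * ((m * exp a) * (m * exp b) * \<kappa>) / (\<sigma> * ((m * exp a) * (m * exp b)))"
      unfolding cot_gram_def x opp_gram_0[OF p p] root_det_def \<kappa>_def[symmetric] \<sigma>_def[symmetric]
      using pos(3) by simp
    also have "\<dots> = C * exp a" using pos by (simp add: C_def)
    finally show ?thesis .
  qed
  show ?thesis
  proof (rule edge_dominant_Ddom[where W = "?V \<times> ?V" and V = ?V and f = "\<lambda>u. - C / u"
        and g = "\<lambda>u. 0" and k = "\<lambda>v. 0" and f' = "\<lambda>u. C / u\<^sup>2"
        and g' = "\<lambda>u. 0" and k' = "\<lambda>v. 0", OF d _ \<phi>])
    show "smooth_on ?V (\<lambda>u. - C / u)"
      by (intro smooth_on_divide_neg smooth_on_const smooth_on_ident) auto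
    show "((\<lambda>u. - C / u) has_real_derivative C / u\<^sup>2) (at u)" if "u \<in> ?V" for u
      using that by (auto intro!: derivative_eq_intros simp: power2_eq_square)
    show "cot_gram 0 \<delta> \<phi> (side_gram \<delta> 0 a) (side_gram \<delta> 0 b) = - C / - exp (- a) + 0 * 0" for a b
      unfolding cot by (simp add: exp_minus field_simps)
  qed (use exp_coord_props W C cot in \<open>auto simp: J_def smooth_on_const intro!: derivative_eq_intros\<close>)
qed

section \<open>All types together and the embedding theorem\<close>

lemma inj_on_csch_coord: "inj_on csch_coord {0<..}"
proof (rule inj_onI)
  fix a b :: real assume ab: "a \<in> {0<..}" "b \<in> {0<..}" "csch_coord a = csch_coord b"
  then have "- 1 / sinh a = - 1 / sinh b" using csch_coord_props(1) by (metis greaterThan_iff)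
  then have "sinh a = sinh b" by simp
  then show "a = b" by (metis arsinh_sinh_real)
qed

lemma inj_sech_coord: "inj sech_coord"
  by (rule injI) (metis sech_coord_def arctan_eq_iff arsinh_sinh_real)

text \<open>\<open>U\<close> and \<open>X\<close> are chosen before \<open>\<phi>\<close>: the
  maximum principle compares differences across edges with different angles, so all edges must share
  one coordinate.\<close>

lemma edge_dominant_exists:
  assumes d: "\<delta> \<in> {-1, 0, 1}" and e: "\<epsilon> \<in> {-1, 0, 1}"
  shows "\<exists>U X. inj_on U (J (\<delta> * \<epsilon>)) \<and>
    (\<forall>\<phi>\<in>Iopen \<delta>. edge_dominant U X (Ddom \<epsilon> \<delta> \<phi>) (\<lambda>a b. curv \<epsilon> h (tri_angle \<epsilon> \<delta> \<phi> a b)))"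
proof -
  have J: "J 1 = {0<..}" "J (-1) = {0<..}" by (simp_all add: J_def)
  have inj: "inj_on (\<lambda>a::real. - exp (- a)) A" for A by (auto intro: inj_onI)
  consider "\<delta> * \<epsilon> = 1" | "\<delta> * \<epsilon> = -1" | "\<delta> * \<epsilon> = 0" using d e by auto
  then show ?thesis
  proof cases
    case 1
    then have "\<delta> = 1 \<and> \<epsilon> = 1 \<or> \<delta> = -1 \<and> \<epsilon> = -1" using d e by auto
    then have "\<forall>\<phi>\<in>Iopen \<delta>. edge_dominant csch_coord sinh (Ddom \<epsilon> \<delta> \<phi>) (\<lambda>a b. curv \<epsilon> h (tri_angle \<epsilon> \<delta> \<phi> a b))"
      using edge_dominant_1_1 edge_dominant_m1_m1 by auto
    then show ?thesis using inj_on_csch_coord unfolding 1 J by blast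
  next
    case 2
    then have "\<delta> = 1 \<and> \<epsilon> = -1 \<or> \<delta> = -1 \<and> \<epsilon> = 1" using d e by auto
    then have "\<forall>\<phi>\<in>Iopen \<delta>. edge_dominant sech_coord cosh (Ddom \<epsilon> \<delta> \<phi>) (\<lambda>a b. curv \<epsilon> h (tri_angle \<epsilon> \<delta> \<phi> a b))"
      using edge_dominant_m1_1 edge_dominant_1_m1 by auto
    then show ?thesis using inj_on_subset[OF inj_sech_coord] unfolding 2 by blast
  next
    case 3
    then have "\<epsilon> = 0 \<or> \<delta> = 0 \<and> \<epsilon> = 1 \<or> \<delta> = 0 \<and> \<epsilon> = -1" using d e by auto
    then have "\<forall>\<phi>\<in>Iopen \<delta>. edge_dominant (\<lambda>a. - exp (- a)) exp (Ddom \<epsilon> \<delta> \<phi>)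
        (\<lambda>a b. curv \<epsilon> h (tri_angle \<epsilon> \<delta> \<phi> a b))"
      using edge_dominant_0[OF d] edge_dominant_1_0 edge_dominant_m1_0 by auto
    then show ?thesis using inj by blast
  qed
qed

theorem theorem1p6:
  fixes a0 a1 a2 :: "'d::finite \<Rightarrow> 'd"
    and face :: "'d \<Rightarrow> 'f::finite"
    and edge :: "'d \<Rightarrow> 'e"
    and \<epsilon> \<delta> :: int
    and \<theta> :: "'e \<Rightarrow> real"
    and h :: real
  assumes "cell_decomp a0 a1 a2 face edge"
    and "\<epsilon> \<in> {-1, 0, 1}" and "\<delta> \<in> {-1, 0, 1}"
    and "\<forall>e. \<theta> e \<in> Iopen \<delta>"
  shows "smooth_embedding (Eset \<epsilon> \<delta> \<theta> face edge a2) (Kh \<epsilon> \<delta> h \<theta> face edge a2)"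
proof -
  have surj: "surj face" using assms(1) by (simp add: cell_decomp_def)
  obtain U X where U: "inj_on U (J (\<delta> * \<epsilon>))"
    and dom: "\<And>\<phi>. \<phi> \<in> Iopen \<delta> \<Longrightarrow>
      edge_dominant U X (Ddom \<epsilon> \<delta> \<phi>) (\<lambda>a b. curv \<epsilon> h (tri_angle \<epsilon> \<delta> \<phi> a b))"
    using edge_dominant_exists[OF assms(3,2), of h] by blast
  have J: "a \<in> J (\<delta> * \<epsilon>)" if "(a, b) \<in> Ddom \<epsilon> \<delta> \<phi>" for a b \<phi>
    using that by (simp add: Ddom_def mult.commute)
  interpret dominant_pattern face "\<lambda>x. face (a2 x)" U X "\<lambda>x. Ddom \<epsilon> \<delta> (\<theta> (edge x))"
    "\<lambda>x a b. curv \<epsilon> h (tri_angle \<epsilon> \<delta> (\<theta> (edge x)) a b)"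
    "Eset \<epsilon> \<delta> \<theta> face edge a2" "Kh \<epsilon> \<delta> h \<theta> face edge a2"
  proof
    show "surj face" by (rule surj)
    show "edge_dominant U X (Ddom \<epsilon> \<delta> (\<theta> (edge x)))
        (\<lambda>a b. curv \<epsilon> h (tri_angle \<epsilon> \<delta> (\<theta> (edge x)) a b))" for x
      using dom assms(4) by blast
    show "a = a'" if "(a, b) \<in> Ddom \<epsilon> \<delta> (\<theta> (edge x))" "(a', b') \<in> Ddom \<epsilon> \<delta> (\<theta> (edge x))" "U a = U a'"
      for x a b a' b'
      by (rule inj_onD[OF U that(3) J[OF that(1)] J[OF that(2)]])
    \<comment> \<open>Every 2-cell is the face of some dart, and the pair condition of that dart
      puts its radius into \<open>J\<close>.\<close>
    have "r $ g \<in> J (\<epsilon> * \<delta>)"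
      if "\<forall>x. (r $ face x, r $ face (a2 x)) \<in> Ddom \<epsilon> \<delta> (\<theta> (edge x))" for r :: "real^'f" and g
    proof -
      obtain x where "g = face x" using surj by (rule surjE)
      then show ?thesis using J[OF spec[OF that, of x]] by (simp add: mult.commute)
    qed
    then show "Eset \<epsilon> \<delta> \<theta> face edge a2 =
        {r. \<forall>x. (r $ face x, r $ face (a2 x)) \<in> Ddom \<epsilon> \<delta> (\<theta> (edge x))}"
      by (auto simp: Eset_def)
    show "Kh \<epsilon> \<delta> h \<theta> face edge a2 r = (\<chi> g. (\<Sum>x\<in>{x. face x = g}.
        curv \<epsilon> h (tri_angle \<epsilon> \<delta> (\<theta> (edge x)) (r $ face x) (r $ face (a2 x)))) / 2)" for r
      by (simp add: Kh_def curv_def)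
  qed
  show ?thesis by (rule smooth_embedding_K)
qed

end
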